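(* Let $n\ge 2$ and let $f:(\mathbb{C}^n,0)\to(\mathbb{C}^{2n},0)$ be a monomial map-germ. Write $\underline{x}=(x_1,\ldots,x_{n-1})$. Then $f$ is $\mathcal{A}$-finite if and only if $f$ is $\mathcal{A}$-equivalent to one of the following: (i) $(\underline{x},y,0,\ldots,0)$ (an immersion); (ii) $(\underline{x},\ y^{m_1},\ y^{m_2},\ x_1^{\lambda_1}y,\ldots,x_{n-1}^{\lambda_{n-1}}y)$ for some integers $\lambda_i\ge 1$, $i=1,\ldots,n-1$, and some positive integers $m_1,m_2$ with $\gcd(m_1,m_2)=1$.
   Context: All germs are holomorphic. Two germs $f,g:(\mathbb{C}^n,0)\to(\mathbb{C}^p,0)$ are $\mathcal{A}$-equivalent if $g=\psi\circ f\circ\rho^{-1}$ for germs of biholomorphisms $\rho$ of $(\mathbb{C}^n,0)$ and $\psi$ of $(\mathbb{C}^p,0)$. A germ $f$ is $\mathcal{A}$-finite (finitely determined) if there is $r<\infty$ such that every germ $g:(\mathbb{C}^n,0)\to(\mathbb{C}^p,0)$ with the same $r$-jet at $0$ as $f$ is $\mathcal{A}$-equivalent to $f$. A map-germ is monomial if each of its components is a monomial in the source coordinates (the zero component is allowed). *)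

theory Defs
  imports "HOL-Analysis.Analysis"
begin

text \<open>
  Germs at the origin are represented by total functions; only the behaviour near \<open>0\<close> is
  constrained, and equality of germs is equality of functions on a neighbourhood of \<open>0\<close>.
  Holomorphy is complex differentiability on a neighbourhood: the real (Frechet) derivative
  is given by multiplication with a complex Jacobian matrix.
\<close>

definition holo_germ :: "(complex^'n \<Rightarrow> complex^'p) \<Rightarrow> bool" where
  "holo_germ f \<longleftrightarrow> f 0 = 0 \<and>
     (\<forall>\<^sub>F z in nhds 0. \<exists>J :: complex^'n^'p. (f has_derivative (\<lambda>h. J *v h)) (at z))"

definition inverse_germs :: "(complex^'n \<Rightarrow> complex^'n) \<Rightarrow> (complex^'n \<Rightarrow> complex^'n) \<Rightarrow> bool" where
  "inverse_germs \<rho> \<sigma> \<longleftrightarrow> holo_germ \<rho> \<and> holo_germ \<sigma> \<and>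
     (\<forall>\<^sub>F z in nhds 0. \<sigma> (\<rho> z) = z) \<and> (\<forall>\<^sub>F z in nhds 0. \<rho> (\<sigma> z) = z)"

definition biholo_germ :: "(complex^'n \<Rightarrow> complex^'n) \<Rightarrow> bool" where
  "biholo_germ \<rho> \<longleftrightarrow> (\<exists>\<sigma>. inverse_germs \<rho> \<sigma>)"

text \<open>Here \<open>\<sigma>\<close> plays the role of \<open>\<rho>\<inverse>\<close> in \<open>g = \<psi> \<circ> f \<circ> \<rho>\<inverse>\<close>.\<close>

definition A_equivalent :: "(complex^'n \<Rightarrow> complex^'p) \<Rightarrow> (complex^'n \<Rightarrow> complex^'p) \<Rightarrow> bool" where
  "A_equivalent f g \<longleftrightarrow>
     (\<exists>\<rho> \<sigma> \<psi>. inverse_germs \<rho> \<sigma> \<and> biholo_germ \<psi> \<and> (\<forall>\<^sub>F z in nhds 0. g z = \<psi> (f (\<sigma> z))))"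

definition partial_deriv :: "'n \<Rightarrow> (complex^'n \<Rightarrow> complex) \<Rightarrow> complex^'n \<Rightarrow> complex" where
  "partial_deriv i h z = deriv (\<lambda>t. h (z + axis i t)) 0"

text \<open>The \<open>r\<close>-jet at \<open>0\<close> is recorded by all iterated partial derivatives of order at most \<open>r\<close>.\<close>

definition same_jet :: "nat \<Rightarrow> (complex^'n \<Rightarrow> complex^'p) \<Rightarrow> (complex^'n \<Rightarrow> complex^'p) \<Rightarrow> bool" where
  "same_jet r f g \<longleftrightarrow>
     (\<forall>j is. length is \<le> r \<longrightarrow>
        foldr partial_deriv is (\<lambda>z. f z $ j) 0 = foldr partial_deriv is (\<lambda>z. g z $ j) 0)"

definition A_finite :: "(complex^'n \<Rightarrow> complex^'p) \<Rightarrow> bool" where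
  "A_finite f \<longleftrightarrow> (\<exists>r. \<forall>g. holo_germ g \<and> same_jet r f g \<longrightarrow> A_equivalent g f)"

definition monomial_germ :: "(complex^'n \<Rightarrow> complex^'p) \<Rightarrow> bool" where
  "monomial_germ f \<longleftrightarrow>
     (\<forall>j. (\<forall>\<^sub>F z in nhds 0. f z $ j = 0) \<or>
          (\<exists>a :: 'n \<Rightarrow> nat. \<forall>\<^sub>F z in nhds 0. f z $ j = (\<Prod>i\<in>UNIV. (z $ i) ^ a i)))"

text \<open>
  Coordinates are numbered by labellings: \<open>s\<close> maps \<open>{1..n}\<close> bijectively onto the index type of
  the source and \<open>t\<close> maps \<open>{1..2 * n}\<close> bijectively onto that of the target. Thus
  \<open>x\<^sub>k = z $ s k\<close> for \<open>k < n\<close> and \<open>y = z $ s n\<close>, and \<open>coord_vec N t c\<close> is the vector whose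
  coordinates, in the order given by \<open>t\<close>, are \<open>c 1, \<dots>, c N\<close>.
\<close>

definition coord_vec :: "nat \<Rightarrow> (nat \<Rightarrow> 'p) \<Rightarrow> (nat \<Rightarrow> complex) \<Rightarrow> complex^'p" where
  "coord_vec N t c = (\<chi> j. c (the_inv_into {1..N} t j))"

definition immersion_form :: "nat \<Rightarrow> (nat \<Rightarrow> 'n) \<Rightarrow> (nat \<Rightarrow> 'p) \<Rightarrow> complex^'n \<Rightarrow> complex^'p" where
  "immersion_form n s t z = coord_vec (2 * n) t (\<lambda>k. if k \<le> n then z $ s k else 0)"

definition singular_form ::
  "nat \<Rightarrow> (nat \<Rightarrow> 'n) \<Rightarrow> (nat \<Rightarrow> 'p) \<Rightarrow> nat \<Rightarrow> nat \<Rightarrow> (nat \<Rightarrow> nat) \<Rightarrow> complex^'n \<Rightarrow> complex^'p" where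
  "singular_form n s t m1 m2 l z = coord_vec (2 * n) t
     (\<lambda>k. if k < n then z $ s k
          else if k = n then (z $ s n) ^ m1
          else if k = n + 1 then (z $ s n) ^ m2
          else (z $ s (k - (n + 1))) ^ l (k - (n + 1)) * z $ s n)"

end

theory Submission
  imports Defs "HOL-Complex_Analysis.Complex_Analysis"
begin

text \<open>
  Sufficiency. For both normal forms \<open>F\<close>, every germ \<open>h\<close> vanishing to high order is \<open>H \<circ> F\<close> with
  \<open>H\<close> of order at least two: divide \<open>h\<close> by a power of \<open>y\<close>; the quotient is absorbed because the
  semigroup generated by \<open>m1\<close> and \<open>m2\<close> contains all large exponents, the remainder because its
  coefficients are divisible by powers of the \<open>x\<^sub>i\<close>. Hence \<open>F + h\<close> is \<open>id + H\<close> after \<open>F\<close>, that is,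
  \<open>F\<close> is finitely determined by left equivalence alone.

  Necessity. If no component of \<open>f\<close> has the form \<open>x\<^sub>i^k x\<^sub>j\<close>, then \<open>f\<close> fails to be an immersion along
  the whole \<open>x\<^sub>i\<close>-axis; if the exponents of the pure powers of \<open>x\<^sub>i\<close> have a common divisor \<open>d \<ge> 2\<close>,
  then \<open>f\<close> is invariant under a rotation of that axis. Both properties pass to every germ
  equivalent to \<open>f\<close>, with a regular curve in place of the axis. Perturb \<open>f\<close> to high order by a
  polynomial whose coefficients are algebraically independent over the rationals: the property
  would express so many of these coefficients as rational polynomials in the Taylor coefficients
  of the curve that the transcendence degree is exceeded. With \<open>2 n\<close> components available, the
  two conditions leave only the stated normal forms.
\<close>

no_notation fps_nth (infixl "$" 75)

section \<open>Complex differentiability in several variables\<close>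

text \<open>Algebraic independence stands in for a transversality theorem: monomials have
  coefficient 1, so every Taylor coefficient of the perturbed germ along a curve is a rational
  polynomial in the perturbation coefficients and the data of the curve, and counting unknowns
  suffices. Both counts are tight. Failure of immersivity gives 2n power series equations in a curve
  (n series) and a direction along it (n series); this contradicts the bound only after scaling the
  direction, which frees one series. Invariance under a rotation of order d gives equations in the
  degrees not divisible by d; for d = 2 these are half of all degrees, so 2n equations face 2n
  unknowns in every two degrees, a tie. It is broken by reparametrising the curve so that one
  coordinate is prescribed in the degrees congruent to 1 modulo d. The perturbations are powers of
  sums of two coordinates, because some such sum has nonzero derivative along the curve and along
  the direction at once, which makes the equations triangular in the coefficients to be
  eliminated.\<close>

definition chol_at :: "(complex^'n \<Rightarrow> complex) \<Rightarrow> complex^'n \<Rightarrow> bool" where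
  "chol_at u z \<longleftrightarrow> (\<exists>c::complex^'n. (u has_derivative (\<lambda>h. \<Sum>i\<in>UNIV. c $ i * h $ i)) (at z))"

abbreviation cgerm :: "(complex^'n \<Rightarrow> complex) \<Rightarrow> bool" where
  "cgerm u \<equiv> \<forall>\<^sub>F z in nhds 0. chol_at u z"

lemma complex_linear_expansion:
  fixes D :: "complex^'n \<Rightarrow> complex"
  assumes "linear D" "\<And>a h. D (a *s h) = a * D h"
  shows "D h = (\<Sum>i\<in>UNIV. D (axis i 1) * h $ i)"
proof -
  have "D h = D (\<Sum>i\<in>UNIV. (h $ i) *s axis i 1)" by (simp add: basis_expansion)
  also have "\<dots> = (\<Sum>i\<in>UNIV. D ((h $ i) *s axis i 1))" by (rule linear_sum[OF assms(1)])
  finally show ?thesis by (simp add: assms(2) mult.commute)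
qed

text \<open>A Frechet derivative is a priori only real-linear; compatibility with complex scalars is
  all that has to be added, and it passes through sums, products and compositions more readily than
  an explicit coefficient vector.\<close>

lemma chol_at_iff:
  fixes u :: "complex^'n \<Rightarrow> complex"
  shows "chol_at u z \<longleftrightarrow> (\<exists>D. (u has_derivative D) (at z) \<and> (\<forall>a h. D (a *s h) = a * D h))"
proof
  assume "chol_at u z"
  then obtain c :: "complex^'n" where "(u has_derivative (\<lambda>h. \<Sum>i\<in>UNIV. c $ i * h $ i)) (at z)"
    unfolding chol_at_def by blast
  moreover have "\<forall>a h. (\<Sum>i\<in>UNIV. c $ i * (a *s h) $ i) = a * (\<Sum>i\<in>UNIV. c $ i * h $ i)"
    by (simp add: sum_distrib_left mult.left_commute)
  ultimately show "\<exists>D. (u has_derivative D) (at z) \<and> (\<forall>a h. D (a *s h) = a * D h)" by blast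
next
  assume "\<exists>D. (u has_derivative D) (at z) \<and> (\<forall>a h. D (a *s h) = a * D h)"
  then obtain D where D: "(u has_derivative D) (at z)" "\<And>a h. D (a *s h) = a * D h" by blast
  note lin = bounded_linear.linear[OF has_derivative_bounded_linear[OF D(1)]]
  have "D h = (\<Sum>i\<in>UNIV. (\<chi> i. D (axis i 1)) $ i * h $ i)" for h
    by (subst complex_linear_expansion[OF lin D(2)]) simp
  then show "chol_at u z" using D(1) unfolding chol_at_def by (metis (no_types, lifting) ext)
qed

lemma chol_atE:
  assumes "chol_at u z"
  obtains D where "(u has_derivative D) (at z)" "\<forall>a h. D (a *s h) = a * D h"
  using assms unfolding chol_at_iff by blast

lemma chol_atI: "(u has_derivative D) (at z) \<Longrightarrow> (\<And>a h. D (a *s h) = a * D h) \<Longrightarrow> chol_at u z"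
  unfolding chol_at_iff by blast

lemma chol_at_const [simp]: "chol_at (\<lambda>z. c) z"
  by (rule chol_atI[of _ "\<lambda>_. 0"]) auto

lemma chol_at_nth [simp]: "chol_at (\<lambda>z. z $ i) z"
  by (rule chol_atI[of _ "\<lambda>h. h $ i"])
     (auto intro!: bounded_linear_imp_has_derivative bounded_linear_vec_nth)

lemma chol_at_add:
  assumes "chol_at u z" "chol_at v z" shows "chol_at (\<lambda>z. u z + v z) z"
  using assms by (elim chol_atE) (rule chol_atI, rule has_derivative_add, auto simp: algebra_simps)

lemma chol_at_mult:
  assumes "chol_at u z" "chol_at v z" shows "chol_at (\<lambda>z. u z * v z) z"
  using assms by (elim chol_atE) (rule chol_atI, rule has_derivative_mult, auto simp: algebra_simps)

lemma chol_at_minus: "chol_at u z \<Longrightarrow> chol_at (\<lambda>z. - u z) z"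
  using chol_at_mult[of "\<lambda>_. -1" z u] by simp

lemma chol_at_diff: "chol_at u z \<Longrightarrow> chol_at v z \<Longrightarrow> chol_at (\<lambda>z. u z - v z) z"
  using chol_at_add[of u z "\<lambda>z. - v z"] chol_at_minus[of v z] by simp

lemma chol_at_power: "chol_at u z \<Longrightarrow> chol_at (\<lambda>z. u z ^ k) z"
  by (induction k) (auto intro: chol_at_mult)

lemma chol_at_sum: "(\<And>i. i \<in> A \<Longrightarrow> chol_at (u i) z) \<Longrightarrow> chol_at (\<lambda>z. \<Sum>i\<in>A. u i z) z"
  by (induction A rule: infinite_finite_induct) (auto intro: chol_at_add)

lemma chol_at_prod: "(\<And>i. i \<in> A \<Longrightarrow> chol_at (u i) z) \<Longrightarrow> chol_at (\<lambda>z. \<Prod>i\<in>A. u i z) z"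
  by (induction A rule: infinite_finite_induct) (auto intro: chol_at_mult)

lemma chol_at_continuous: "chol_at u z \<Longrightarrow> isCont u z"
  by (metis chol_atE has_derivative_continuous)

lemma chol_at_field:
  assumes "chol_at u z" "g field_differentiable at (u z)"
  shows "chol_at (\<lambda>z. g (u z)) z"
proof -
  obtain D where D: "(u has_derivative D) (at z)" "\<forall>a h. D (a *s h) = a * D h"
    using assms(1) by (rule chol_atE)
  obtain d where "(g has_field_derivative d) (at (u z))"
    using assms(2) by (auto simp: field_differentiable_def)
  then have "((\<lambda>z. g (u z)) has_derivative (\<lambda>h. d * D h)) (at z)"
    using D(1) has_derivative_compose[of u D z UNIV g "\<lambda>h. d * h"]
    by (simp add: has_field_derivative_def)
  then show ?thesis using D(2) by (intro chol_atI) auto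
qed

lemma chol_at_transform:
  assumes "chol_at u z" "\<forall>\<^sub>F w in nhds z. u w = v w"
  shows "chol_at v z"
proof -
  obtain D where D: "(u has_derivative D) (at z)" "\<forall>a h. D (a *s h) = a * D h"
    using assms(1) by (rule chol_atE)
  have "(v has_derivative D) (at z)"
    using D(1) by (rule has_derivative_transform_eventually)
      (use assms(2) in \<open>auto simp: eventually_at_filter elim: eventually_mono dest: eventually_nhds_x_imp_x\<close>)
  then show ?thesis by (rule chol_atI) (simp add: D(2))
qed

lemma has_derivative_vecI:
  fixes f :: "'a::real_normed_vector \<Rightarrow> complex^'p"
  assumes "\<And>j. ((\<lambda>z. f z $ j) has_derivative D j) F"
  shows "(f has_derivative (\<lambda>h. \<chi> j. D j h)) F"
proof -
  have "((\<lambda>z. \<Sum>j\<in>UNIV. axis j (f z $ j)) has_derivative (\<lambda>h. \<Sum>j\<in>UNIV. axis j (D j h))) F"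
  proof (intro has_derivative_sum)
    fix j :: 'p
    have "bounded_linear (\<lambda>c::complex. axis j c :: complex^'p)"
      by (rule linear_conv_bounded_linear[THEN iffD1], rule linearI) (auto simp: vec_eq_iff axis_def)
    from bounded_linear.has_derivative[OF this assms]
    show "((\<lambda>z. axis j (f z $ j)) has_derivative (\<lambda>h. axis j (D j h))) F" .
  qed
  moreover have "(\<Sum>j\<in>UNIV. axis j (x j)) = (\<chi> j. x j)" for x :: "'p \<Rightarrow> complex"
    by (simp add: vec_eq_iff axis_def if_distrib sum.delta' cong: if_cong)
  ultimately show ?thesis by (simp add: vec_nth_inverse)
qed

lemma chol_at_vec:
  fixes F :: "complex^'n \<Rightarrow> complex^'p"
  assumes "\<And>j. chol_at (\<lambda>z. F z $ j) z"
  obtains D where "(F has_derivative D) (at z)" "\<forall>a h. D (a *s h) = a *s D h"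
proof -
  from assms have "\<forall>j. \<exists>D. ((\<lambda>z. F z $ j) has_derivative D) (at z) \<and> (\<forall>a h. D (a *s h) = a * D h)"
    unfolding chol_at_iff by blast
  then obtain D where D: "\<And>j. ((\<lambda>z. F z $ j) has_derivative D j) (at z)"
    "\<And>j a h. D j (a *s h) = a * D j h" by metis
  show thesis
    by (rule that[OF has_derivative_vecI[OF D(1)]]) (simp add: vec_eq_iff D(2))
qed

lemma chol_at_compose:
  fixes F :: "complex^'n \<Rightarrow> complex^'p"
  assumes "\<And>j. chol_at (\<lambda>z. F z $ j) z" "chol_at u (F z)"
  shows "chol_at (\<lambda>z. u (F z)) z"
proof -
  obtain D where D: "(F has_derivative D) (at z)" "\<forall>a h. D (a *s h) = a *s D h"
    by (rule chol_at_vec[OF assms(1)])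
  obtain E where E: "(u has_derivative E) (at (F z))" "\<forall>a h. E (a *s h) = a * E h"
    using assms(2) by (rule chol_atE)
  show ?thesis
    using has_derivative_compose[OF D(1) E(1)] by (rule chol_atI) (simp add: D(2) E(2))
qed

lemma eventually_all_iff:
  "(\<forall>\<^sub>F x in F. \<forall>j::'p::finite. P x j) \<longleftrightarrow> (\<forall>j. \<forall>\<^sub>F x in F. P x j)"
  using eventually_all_finite[of P F] by (auto elim: eventually_mono)

lemma holo_germ_iff:
  fixes f :: "complex^'n \<Rightarrow> complex^'p"
  shows "holo_germ f \<longleftrightarrow> f 0 = 0 \<and> (\<forall>j. cgerm (\<lambda>z. f z $ j))"
proof -
  have "(\<exists>J :: complex^'n^'p. (f has_derivative (\<lambda>h. J *v h)) (at z)) \<longleftrightarrow>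
      (\<forall>j. chol_at (\<lambda>z. f z $ j) z)" for z
  proof
    assume "\<exists>J :: complex^'n^'p. (f has_derivative (\<lambda>h. J *v h)) (at z)"
    then obtain J :: "complex^'n^'p" where J: "(f has_derivative (\<lambda>h. J *v h)) (at z)" by blast
    show "\<forall>j. chol_at (\<lambda>z. f z $ j) z"
      unfolding chol_at_def
      using bounded_linear.has_derivative[OF bounded_linear_vec_nth J]
      by (auto simp: matrix_vector_mult_def)
  next
    assume "\<forall>j. chol_at (\<lambda>z. f z $ j) z"
    then obtain c :: "'p \<Rightarrow> complex^'n" where
      c: "\<And>j. ((\<lambda>z. f z $ j) has_derivative (\<lambda>h. \<Sum>i\<in>UNIV. c j $ i * h $ i)) (at z)"
      unfolding chol_at_def by metis
    have "(f has_derivative (\<lambda>h. (\<chi> j. c j) *v h)) (at z)"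
      using has_derivative_vecI[OF c] by (simp add: matrix_vector_mult_def)
    then show "\<exists>J :: complex^'n^'p. (f has_derivative (\<lambda>h. J *v h)) (at z)" by blast
  qed
  then show ?thesis by (simp add: holo_germ_def eventually_all_iff)
qed

section \<open>Substitution into one coordinate\<close>

definition upd :: "complex^'n \<Rightarrow> 'n \<Rightarrow> complex \<Rightarrow> complex^'n" where
  "upd z i w = (\<chi> j. if j = i then w else z $ j)"

lemma upd_nth: "upd z i w $ j = (if j = i then w else z $ j)"
  by (simp add: upd_def)

lemma upd_same [simp]: "upd z i (z $ i) = z"
  by (simp add: upd_def vec_eq_iff)

lemma upd_upd [simp]: "upd (upd z i w) i w' = upd z i w'"
  by (simp add: upd_def vec_eq_iff)

lemma norm_axis_complex [simp]: "norm (axis i w :: complex^'n) = norm w"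
  by (simp add: norm_eq_sqrt_inner inner_axis_axis)

lemma norm_upd:
  fixes z :: "complex^'b"
  shows "norm (upd z i w) \<le> norm z + norm w"
proof -
  have "norm (upd z i w) \<le> norm (upd z i 0) + norm (axis i w)"
    by (rule order_trans[OF eq_refl norm_triangle_ineq])
       (auto simp: vec_eq_iff upd_def axis_def intro!: arg_cong[where f=norm])
  moreover have "norm (upd z i 0) \<le> norm z"
    by (rule norm_le_componentwise_cart) (simp add: upd_nth)
  ultimately show ?thesis by simp
qed

lemma has_derivative_upd: "((\<lambda>w. upd z i w) has_derivative (\<lambda>h. axis i h)) F"
proof -
  have "((\<lambda>w. upd z i w $ j) has_derivative (\<lambda>h. if j = i then h else 0)) F" for j
    by (cases "j = i") (simp_all add: upd_nth)
  then have "((\<lambda>w. upd z i w) has_derivative (\<lambda>h. \<chi> j. if j = i then h else 0)) F"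
    by (rule has_derivative_vecI)
  then show ?thesis by (simp add: axis_def)
qed

lemma chol_at_slice:
  assumes "chol_at u (upd z i w)"
  shows "(\<lambda>w. u (upd z i w)) field_differentiable at w"
proof -
  obtain D where D: "(u has_derivative D) (at (upd z i w))" "\<forall>a h. D (a *s h) = a * D h"
    using assms by (rule chol_atE)
  have "((\<lambda>w. u (upd z i w)) has_derivative (\<lambda>h. D (axis i h))) (at w)"
    by (rule has_derivative_compose[OF has_derivative_upd D(1)])
  moreover have "D (axis i h) = D (axis i 1) * h" for h
    using D(2)[rule_format, of h "axis i 1"] by (simp add: vector_scalar_mult_def axis_def mult.commute if_distrib cong: if_cong)
  ultimately show ?thesis
    unfolding field_differentiable_def has_field_derivative_def by (metis (no_types, lifting) ext)
qed

lemma chol_at_upd: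
  assumes "chol_at u (upd z i w)"
  shows "chol_at (\<lambda>z. u (upd z i w)) z"
  by (rule chol_at_compose[of "\<lambda>z. upd z i w", OF _ assms]) (case_tac "j = i", simp_all add: upd_nth)

lemma holomorphic_onI_at:
  "(\<And>w. w \<in> S \<Longrightarrow> f field_differentiable at w) \<Longrightarrow> f holomorphic_on S"
  by (simp add: holomorphic_on_def field_differentiable_at_within)

text \<open>The velocity of the circle is 2 pi i times its position, so this factor cancels and
  contour integrals become integrals over \<open>{0..1}\<close>, the form to which the Leibniz rule
  for real parameter integrals applies.\<close>

lemma cauchy_mean:
  assumes "continuous_on (cball 0 \<delta>) \<phi>" "\<phi> holomorphic_on ball 0 \<delta>" "norm y < \<delta>"
  shows "(deriv ^^ k) \<phi> y / fact k =
    integral {0..1} (\<lambda>s. \<phi> (circlepath 0 \<delta> s) * circlepath 0 \<delta> s / (circlepath 0 \<delta> s - y) ^ Suc k)"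
proof -
  let ?c = "circlepath 0 \<delta>"
  have d: "vector_derivative ?c (at s) = 2 * pi * \<i> * ?c s" for s
    by (subst vector_derivative_circlepath) (simp add: circlepath)
  have "(deriv ^^ k) \<phi> y / fact k =
      contour_integral ?c (\<lambda>u. \<phi> u / (u - y) ^ Suc k) / (2 * pi * \<i>)"
    by (subst Cauchy_higher_derivative_integral_circlepath(2)[OF assms(1,2)])
       (use assms in \<open>auto simp: field_simps\<close>)
  also have "contour_integral ?c (\<lambda>u. \<phi> u / (u - y) ^ Suc k) =
      integral {0..1} (\<lambda>s. 2 * pi * \<i> * (\<phi> (?c s) * ?c s / (?c s - y) ^ Suc k))"
    unfolding contour_integral_integral d by (simp add: mult_ac)
  also have "\<dots> = 2 * pi * \<i> * integral {0..1} (\<lambda>s. \<phi> (?c s) * ?c s / (?c s - y) ^ Suc k)"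
    by (rule integral_mult_right)
  finally show ?thesis by simp
qed

lemmas cauchy_mean_value = cauchy_mean[where k=0, simplified]

lemma norm_circlepath [simp]: "norm (circlepath 0 \<delta> s) = \<bar>\<delta>\<bar>"
  by (simp add: circlepath norm_mult)

lemma continuous_on_circlepath [continuous_intros]:
  "continuous_on A g \<Longrightarrow> continuous_on A (\<lambda>x. circlepath 0 \<delta> (g x))"
  unfolding circlepath by (intro continuous_intros) auto

section \<open>Integrals depending holomorphically on parameters\<close>

lemma has_derivative_add_axis: "((\<lambda>w. z + axis i w :: complex^'n) has_derivative (\<lambda>h. axis i h)) F"
proof -
  have "((\<lambda>w. (z + axis i w) $ j) has_derivative (\<lambda>h. if j = i then h else 0)) F" for j
    by (cases "j = i") (auto simp: axis_def intro!: derivative_eq_intros)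
  then have "((\<lambda>w. z + axis i w) has_derivative (\<lambda>h. \<chi> j. if j = i then h else 0)) F"
    by (rule has_derivative_vecI)
  then show ?thesis by (simp add: axis_def)
qed

lemma add_axis_in_ball:
  fixes x :: "complex^'n"
  assumes "x \<in> ball z (\<rho> / 2)" "norm w \<le> \<rho> / 2" shows "x + axis i w \<in> ball z \<rho>"
proof -
  have "dist z (x + axis i w) \<le> dist z x + norm w"
    using dist_triangle[of z "x + axis i w" x] by (simp add: dist_norm)
  then show ?thesis using assms by simp
qed

lemma axis_0 [simp]: "axis i 0 = 0"
  by (simp add: vec_eq_iff axis_def)

lemma continuous_on_axis [continuous_intros]:
  assumes "continuous_on A g" shows "continuous_on A (\<lambda>x. axis i (g x) :: complex^'n)"
proof -
  have "continuous_on UNIV (\<lambda>w. axis i w :: complex^'n)"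
    using has_derivative_add_axis[of 0 i]
    by (auto intro!: continuous_at_imp_continuous_on has_derivative_continuous)
  from continuous_on_compose2[OF this assms] show ?thesis by simp
qed

lemma axis_smult: "axis i h = h *s (axis i 1 :: complex^'n)"
  by (simp add: vec_eq_iff axis_def)

lemma axis_slice_has_field_derivative:
  fixes z :: "complex^'n"
  assumes "(u has_derivative D) (at (z + axis i w))" "\<forall>a h. D (a *s h) = a * D h"
  shows "((\<lambda>w. u (z + axis i w)) has_field_derivative D (axis i 1)) (at w)"
proof -
  have "((\<lambda>w. u (z + axis i w)) has_derivative (\<lambda>h. D (axis i h))) (at w)"
    by (rule has_derivative_compose[OF has_derivative_add_axis assms(1)])
  moreover have "D (axis i h) = D (axis i 1) * h" for h
    using assms(2) by (subst axis_smult) simp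
  ultimately show ?thesis
    unfolding has_field_derivative_def by (metis (no_types, lifting) ext)
qed

lemma chol_at_partial_deriv:
  fixes u :: "complex^'n \<Rightarrow> complex"
  assumes "chol_at u z"
  shows "(u has_derivative (\<lambda>h. \<Sum>i\<in>UNIV. partial_deriv i u z * h $ i)) (at z)"
proof -
  obtain D where D: "(u has_derivative D) (at z)" "\<forall>a h. D (a *s h) = a * D h"
    using assms by (rule chol_atE)
  have pd: "partial_deriv i u z = D (axis i 1)" for i
    unfolding partial_deriv_def
    by (rule DERIV_imp_deriv, rule axis_slice_has_field_derivative) (use D in simp_all)
  have "D h = (\<Sum>i\<in>UNIV. partial_deriv i u z * h $ i)" for h
    unfolding pd
    by (rule complex_linear_expansion[OF bounded_linear.linear[OF has_derivative_bounded_linear[OF D(1)]]])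
      (use D(2) in blast)
  then show ?thesis using D(1) by presburger
qed

lemma partial_deriv_formula:
  fixes u :: "complex^'n \<Rightarrow> complex"
  assumes "\<epsilon> > 0" "\<And>w. norm w \<le> \<epsilon> \<Longrightarrow> chol_at u (z + axis i w)"
  shows "partial_deriv i u z =
    integral {0..1} (\<lambda>s. u (z + axis i (circlepath 0 \<epsilon> s)) / circlepath 0 \<epsilon> s)"
proof -
  have d: "(\<lambda>w. u (z + axis i w)) field_differentiable at w" if "norm w \<le> \<epsilon>" for w
    using assms(2)[OF that] unfolding field_differentiable_def
    by (elim chol_atE) (blast intro: axis_slice_has_field_derivative)
  have c0: "circlepath 0 \<epsilon> s \<noteq> 0" for s
    using norm_circlepath[of \<epsilon> s] assms(1) by force
  have "deriv (\<lambda>w. u (z + axis i w)) 0 =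
      integral {0..1} (\<lambda>s. u (z + axis i (circlepath 0 \<epsilon> s)) * circlepath 0 \<epsilon> s
        / (circlepath 0 \<epsilon> s - 0) ^ Suc 1)"
  proof -
    have "continuous_on (cball 0 \<epsilon>) (\<lambda>w. u (z + axis i w))"
      using d by (intro continuous_at_imp_continuous_on)
        (auto intro: field_differentiable_imp_continuous_at)
    moreover have "(\<lambda>w. u (z + axis i w)) holomorphic_on ball 0 \<epsilon>"
      by (rule holomorphic_onI_at) (use d in simp)
    ultimately show ?thesis
      using cauchy_mean[of \<epsilon> "\<lambda>w. u (z + axis i w)" 0 1] assms(1) by simp
  qed
  then show ?thesis
    unfolding partial_deriv_def using c0 by (simp add: field_simps)
qed

text \<open>The Leibniz rule asks for a derivative jointly continuous in point and parameter, while
  only \<open>\<Phi>\<close> itself is assumed continuous. Cauchy's formula closes the gap: each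
  partial derivative is again a circle integral of \<open>\<Phi>\<close>, so continuity is
  inherited.\<close>

lemma chol_at_integral:
  fixes \<Phi> :: "complex^'n \<Rightarrow> real \<Rightarrow> complex"
  assumes S: "open S" "z0 \<in> S"
    and cont: "continuous_on (S \<times> {0..1}) (\<lambda>(z, s). \<Phi> z s)"
    and hol: "\<And>z s. z \<in> S \<Longrightarrow> s \<in> {0..1} \<Longrightarrow> chol_at (\<lambda>z. \<Phi> z s) z"
  shows "chol_at (\<lambda>z. integral {0..1} (\<Phi> z)) z0"
proof -
  obtain \<rho> where \<rho>: "\<rho> > 0" "ball z0 \<rho> \<subseteq> S"
    using S open_contains_ball by blast
  \<comment> \<open>Half of the radius: circles of radius \<open>\<epsilon>\<close> around points of
    \<open>U\<close> must stay in \<open>S\<close>.\<close>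
  define \<epsilon> where "\<epsilon> = \<rho> / 2"
  have \<epsilon>: "\<epsilon> > 0" using \<rho> by (simp add: \<epsilon>_def)
  define U where "U = ball z0 \<epsilon>"
  have in_S: "z + axis i w \<in> S" if "z \<in> U" "norm w \<le> \<epsilon>" for z i w
    using add_axis_in_ball[of z z0 \<rho> w i] that \<rho>(2) by (auto simp: U_def \<epsilon>_def)
  have U_S: "z \<in> S" if "z \<in> U" for z
    using in_S[OF that, of 0] \<epsilon> by simp
  let ?c = "circlepath 0 \<epsilon>"
  have c0: "?c s \<noteq> 0" for s
    using norm_circlepath[of \<epsilon> s] \<epsilon> by force
  define P where "P i x = integral {0..1} (\<lambda>\<tau>. \<Phi> (fst x + axis i (?c \<tau>)) (snd x) / ?c \<tau>)" for i x
  have contP: "continuous_on (U \<times> {0..1}) (P i)" for i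
    unfolding P_def
  proof (rule integral_continuous_on_param[of _ 0 "1::real", simplified])
    have "continuous_on ((U \<times> {0..1}) \<times> {0..1}) (\<lambda>x. (fst (fst x) + axis i (?c (snd x)), snd (fst x)))"
      by (intro continuous_intros)
    moreover have "(\<lambda>x. (fst (fst x) + axis i (?c (snd x)), snd (fst x))) ` ((U \<times> {0..1}) \<times> {0..1})
        \<subseteq> S \<times> {0..1}"
      using \<epsilon> by (auto intro!: in_S)
    ultimately have "continuous_on ((U \<times> {0..1}) \<times> {0..1}) (\<lambda>x. \<Phi> (fst (fst x) + axis i (?c (snd x))) (snd (fst x)))"
      using continuous_on_compose2[OF cont, of "(U \<times> {0..1}) \<times> {0..1}"
        "\<lambda>x. (fst (fst x) + axis i (?c (snd x)), snd (fst x))"] by (simp only: split_conv)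
    then show "continuous_on ((U \<times> {0..1}) \<times> {0..1}) (\<lambda>(x, \<tau>). \<Phi> (fst x + axis i (?c \<tau>)) (snd x) / ?c \<tau>)"
      unfolding split_beta by (intro continuous_intros) (auto simp: c0)
  qed
  define fx where "fx z s = Blinfun (\<lambda>h::complex^'n. \<Sum>i\<in>UNIV. P i (z, s) * h $ i)" for z s
  have bl: "bounded_linear (\<lambda>h::complex^'n. \<Sum>i\<in>UNIV. P i x * h $ i)" for x
    by (intro bounded_linear_sum bounded_linear_const_mult bounded_linear_vec_nth)
  have fx: "blinfun_apply (fx z s) = (\<lambda>h. \<Sum>i\<in>UNIV. P i (z, s) * h $ i)" for z s
    unfolding fx_def by (rule bounded_linear_Blinfun_apply[OF bl])
  have "((\<lambda>z. integral (cbox 0 (1::real)) (\<Phi> z)) has_derivative integral (cbox 0 1) (fx z0)) (at z0 within U)"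
  proof (rule leibniz_rule)
    fix z s assume zs: "z \<in> U" "s \<in> cbox 0 (1::real)"
    then have "chol_at (\<lambda>z. \<Phi> z s) z" using hol U_S by auto
    from chol_at_partial_deriv[OF this]
    have "((\<lambda>z. \<Phi> z s) has_derivative (\<lambda>h. \<Sum>i\<in>UNIV. partial_deriv i (\<lambda>z. \<Phi> z s) z * h $ i)) (at z)" .
    moreover have "partial_deriv i (\<lambda>z. \<Phi> z s) z = P i (z, s)" for i
      unfolding P_def using zs in_S
      by (subst partial_deriv_formula[OF \<epsilon>]) (auto intro!: hol)
    ultimately show "((\<lambda>x. \<Phi> x s) has_derivative blinfun_apply (fx z s)) (at z within U)"
      by (simp add: fx has_derivative_at_withinI)
  next
    fix z assume "z \<in> U"
    then have "Pair z ` {0..1} \<subseteq> S \<times> {0..1::real}" using U_S by auto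
    moreover have "continuous_on {0..1::real} (Pair z)" by (intro continuous_intros)
    ultimately have "continuous_on {0..1} (\<Phi> z)"
      using continuous_on_compose2[OF cont, of "{0..1}" "Pair z"] by (simp only: split_conv)
    then show "\<Phi> z integrable_on cbox 0 1" by (simp add: integrable_continuous_real)
  next
    show "continuous_on (U \<times> cbox 0 (1::real)) (\<lambda>(x, t). fx x t)"
    proof (rule continuous_on_blinfun_componentwise)
      fix b :: "complex^'n"
      have "continuous_on (U \<times> {0..1}) (\<lambda>x. \<Sum>i\<in>UNIV. P i x * b $ i)"
        by (intro continuous_on_sum continuous_on_mult contP continuous_on_const)
      then show "continuous_on (U \<times> cbox 0 (1::real)) (\<lambda>x. blinfun_apply (case x of (z, s) \<Rightarrow> fx z s) b)"
        by (simp add: fx split_beta)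
    qed
  next
    show "z0 \<in> U" "convex U" using \<epsilon> by (auto simp: U_def)
  qed
  then have "((\<lambda>z. integral {0..1} (\<Phi> z)) has_derivative integral {0..1} (fx z0)) (at z0)"
    by (subst (asm) at_within_open[of z0 U]) (simp_all add: U_def \<epsilon>)
  then show ?thesis
  proof (rule chol_atI)
    fix a :: complex and h :: "complex^'n"
    have "continuous_on {0..1} (\<lambda>s. P i (z0, s))" for i
      by (rule continuous_on_compose2[OF contP[of i]]) (use \<epsilon> in \<open>auto simp: U_def continuous_on_Pair\<close>)
    then have "continuous_on {0..1} (fx z0)"
      by (intro continuous_on_blinfun_componentwise)
        (simp only: fx, intro continuous_on_sum continuous_on_mult continuous_on_const)
    then have "blinfun_apply (integral {0..1} (fx z0)) h = integral {0..1} (\<lambda>s. fx z0 s h)" for h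
      by (intro blinfun_apply_integral integrable_continuous_real)
    then have *: "blinfun_apply (integral {0..1} (fx z0)) h = integral {0..1} (\<lambda>s. \<Sum>i\<in>UNIV. P i (z0, s) * h $ i)" for h
      by (simp only: fx)
    have "(\<Sum>i\<in>UNIV. P i (z0, s) * (a *s h) $ i) = a * (\<Sum>i\<in>UNIV. P i (z0, s) * h $ i)" for s
      by (simp add: sum_distrib_left mult.left_commute)
    then show "blinfun_apply (integral {0..1} (fx z0)) (a *s h) = a * blinfun_apply (integral {0..1} (fx z0)) h"
      unfolding * by (simp only: integral_mult_right)
  qed
qed

text \<open>By Cauchy's formula the partial derivative is locally an integral of translates of
  \<open>u\<close>, to which the preceding lemma applies; by iteration, germs have holomorphic
  derivatives of all orders.\<close>

lemma chol_at_partial: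
  fixes u :: "complex^'n \<Rightarrow> complex"
  assumes "open S" "z \<in> S" "\<And>z. z \<in> S \<Longrightarrow> chol_at u z"
  shows "chol_at (partial_deriv i u) z"
proof -
  obtain \<rho> where \<rho>: "\<rho> > 0" "ball z \<rho> \<subseteq> S"
    using assms open_contains_ball by blast
  define \<epsilon> where "\<epsilon> = \<rho> / 2"
  have \<epsilon>: "\<epsilon> > 0" using \<rho> by (simp add: \<epsilon>_def)
  have in_S: "x + axis i w \<in> S" if "x \<in> ball z \<epsilon>" "norm w \<le> \<epsilon>" for x w
    using add_axis_in_ball[of x z \<rho> w i] that \<rho>(2) by (auto simp: \<epsilon>_def)
  let ?c = "circlepath 0 \<epsilon>"
  have c0: "?c s \<noteq> 0" for s
    using norm_circlepath[of \<epsilon> s] \<epsilon> by force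
  have contu: "continuous_on S u"
    using assms by (intro continuous_at_imp_continuous_on) (auto intro: chol_at_continuous)
  have "continuous_on (ball z \<epsilon> \<times> {0..1}) (\<lambda>x. fst x + axis i (?c (snd x)))"
    by (intro continuous_intros)
  moreover have "(\<lambda>x. fst x + axis i (?c (snd x))) ` (ball z \<epsilon> \<times> {0..1}) \<subseteq> S"
    using \<epsilon> by (intro image_subsetI in_S) auto
  ultimately have "continuous_on (ball z \<epsilon> \<times> {0..1}) (\<lambda>x. u (fst x + axis i (?c (snd x))))"
    by (rule continuous_on_compose2[OF contu])
  then have 1: "continuous_on (ball z \<epsilon> \<times> {0..1}) (\<lambda>(x, s). u (x + axis i (?c s)) / ?c s)"
    unfolding split_beta by (intro continuous_intros) (auto simp: c0)
  have 2: "chol_at (\<lambda>x. u (x + axis i (?c s)) / ?c s) x" if "x \<in> ball z \<epsilon>" for x s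
  proof -
    have "chol_at (\<lambda>x. u (x + axis i (?c s))) x"
    proof (rule chol_at_compose[of "\<lambda>x. x + axis i (?c s)"])
      show "chol_at (\<lambda>z. (z + axis i (?c s)) $ j) x" for j
        unfolding vector_add_component by (intro chol_at_add chol_at_nth chol_at_const)
      have "x + axis i (?c s) \<in> S" using that \<epsilon> by (intro in_S) simp_all
      then show "chol_at u (x + axis i (?c s))" by (rule assms(3))
    qed
    from chol_at_mult[OF this chol_at_const[of "1 / ?c s"]]
    show ?thesis by simp
  qed
  have "chol_at (\<lambda>x. integral {0..1} (\<lambda>s. u (x + axis i (?c s)) / ?c s)) z"
    by (rule chol_at_integral[of "ball z \<epsilon>"]) (use \<epsilon> in \<open>simp_all add: 1 2\<close>)
  moreover have "\<forall>\<^sub>F x in nhds z. integral {0..1} (\<lambda>s. u (x + axis i (?c s)) / ?c s) = partial_deriv i u x"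
  proof -
    have "\<forall>\<^sub>F x in nhds z. x \<in> ball z \<epsilon>"
      using \<epsilon> by (intro eventually_nhds_in_open) auto
    then show ?thesis
    proof eventually_elim
      case (elim x)
      show ?case by (rule partial_deriv_formula[symmetric, OF \<epsilon>]) (rule assms(3), rule in_S[OF elim])
    qed
  qed
  ultimately show ?thesis by (rule chol_at_transform)
qed

lemma cgerm_partial:
  assumes "cgerm u" shows "cgerm (partial_deriv i u)"
proof -
  obtain S where "open S" "0 \<in> S" "\<And>z. z \<in> S \<Longrightarrow> chol_at u z"
    using assms unfolding eventually_nhds by blast
  then show ?thesis
    unfolding eventually_nhds using chol_at_partial[of S _ u i] by blast
qed

text \<open>Common shape of the quotients and remainders below: coordinate \<open>i\<close> is
  integrated out over a circle and re-enters only through the kernel \<open>\<kappa>\<close>. The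
  factor 2 in the hypothesis on \<open>u\<close> covers \<open>norm z + \<delta>\<close>, the bound
  on the substituted point.\<close>

lemma chol_at_kernel:
  fixes u :: "complex^'n \<Rightarrow> complex"
  assumes u: "\<And>z. norm z < 2 * \<delta> \<Longrightarrow> chol_at u z" and "\<delta> > 0"
    and contk: "continuous_on (ball 0 \<eta> \<times> {0..1}) (\<lambda>(y, s). \<kappa> y s)"
    and holk: "\<And>y s. norm y < \<eta> \<Longrightarrow> s \<in> {0..1} \<Longrightarrow> (\<lambda>y. \<kappa> y s) field_differentiable at y"
    and z: "norm z < \<delta>" "norm (z $ i) < \<eta>"
  shows "chol_at (\<lambda>z. integral {0..1} (\<lambda>s. u (upd z i (circlepath 0 \<delta> s)) * \<kappa> (z $ i) s)) z"
proof (rule chol_at_integral)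
  let ?S = "{z::complex^'n. norm z < \<delta>} \<inter> {z. norm (z $ i) < \<eta>}"
  show "open ?S" by (intro open_Int open_Collect_less continuous_intros)
  show "z \<in> ?S" using z by simp
  have n: "norm (upd x i (circlepath 0 \<delta> s)) < 2 * \<delta>" if "x \<in> ?S" for x s
    using norm_upd[of x i "circlepath 0 \<delta> s"] that \<open>\<delta> > 0\<close> by simp
  have contu: "continuous_on {z. norm z < 2 * \<delta>} u"
    using u by (intro continuous_at_imp_continuous_on) (auto intro: chol_at_continuous)
  have cupd: "continuous_on (?S \<times> {0..1}) (\<lambda>x. upd (fst x) i (circlepath 0 \<delta> (snd x)))"
  proof -
    have "continuous_on (?S \<times> {0..1}) (\<lambda>x. if j = i then circlepath 0 \<delta> (snd x) else fst x $ j)" for j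
      by (cases "j = i") (auto intro!: continuous_intros)
    then show ?thesis unfolding upd_def by (intro continuous_on_vec_lambda) auto
  qed
  have "continuous_on (?S \<times> {0..1}) (\<lambda>x. u (upd (fst x) i (circlepath 0 \<delta> (snd x))))"
    by (rule continuous_on_compose2[OF contu cupd]) (use n in auto)
  moreover have "continuous_on (?S \<times> {0..1}) (\<lambda>x. \<kappa> (fst x $ i) (snd x))"
  proof -
    have "continuous_on (?S \<times> {0..1}) (\<lambda>x. (fst x $ i, snd x))"
      by (intro continuous_intros)
    moreover have "(\<lambda>x. (fst x $ i, snd x)) ` (?S \<times> {0..1}) \<subseteq> ball 0 \<eta> \<times> {0..1::real}"
      by auto
    ultimately have "continuous_on (?S \<times> {0..1}) (\<lambda>x. case (fst x $ i, snd x) of (y, s) \<Rightarrow> \<kappa> y s)"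
      by (rule continuous_on_compose2[OF contk])
    then show ?thesis by simp
  qed
  ultimately show "continuous_on (?S \<times> {0..1}) (\<lambda>(x, s). u (upd x i (circlepath 0 \<delta> s)) * \<kappa> (x $ i) s)"
    unfolding split_beta by (intro continuous_intros)
  show "chol_at (\<lambda>x. u (upd x i (circlepath 0 \<delta> s)) * \<kappa> (x $ i) s) x"
    if "x \<in> ?S" "s \<in> {0..1}" for x s
  proof (rule chol_at_mult)
    show "chol_at (\<lambda>x. u (upd x i (circlepath 0 \<delta> s))) x"
      by (rule chol_at_upd, rule u, rule n, fact)
    show "chol_at (\<lambda>x. \<kappa> (x $ i) s) x"
      by (rule chol_at_field[of _ _ "\<lambda>y. \<kappa> y s", OF chol_at_nth]) (use that in \<open>auto intro: holk\<close>)
  qed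
qed

section \<open>Order of vanishing and Weierstrass division\<close>

text \<open>Order of vanishing is measured by growth instead of Taylor coefficients, so that
  products, compositions and division are handled by estimates; the value at 0 is recovered by
  continuity in \<open>flat_zero\<close>.\<close>

definition flat :: "nat \<Rightarrow> (complex^'n \<Rightarrow> 'b::real_normed_vector) \<Rightarrow> bool" where
  "flat N u \<longleftrightarrow> (\<exists>C. \<forall>\<^sub>F z in at 0. norm (u z) \<le> C * norm z ^ N)"

lemma flatE:
  assumes "flat N u"
  obtains C \<epsilon> where "C \<ge> 0" "\<epsilon> > 0" "\<And>z. z \<noteq> 0 \<Longrightarrow> norm z < \<epsilon> \<Longrightarrow> norm (u z) \<le> C * norm z ^ N"
proof -
  obtain C where "\<forall>\<^sub>F z in at 0. norm (u z) \<le> C * norm z ^ N"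
    using assms unfolding flat_def by blast
  then obtain \<epsilon> where \<epsilon>: "\<epsilon> > 0" "\<And>z. z \<noteq> 0 \<Longrightarrow> norm z < \<epsilon> \<Longrightarrow> norm (u z) \<le> C * norm z ^ N"
    unfolding eventually_at by (auto simp: dist_norm)
  show thesis
  proof (rule that[of "\<bar>C\<bar>" \<epsilon>])
    fix z :: "complex^'a" assume z: "z \<noteq> 0" "norm z < \<epsilon>"
    have "norm (u z) \<le> C * norm z ^ N" by (rule \<epsilon>(2)[OF z])
    also have "\<dots> \<le> \<bar>C\<bar> * norm z ^ N" by (intro mult_right_mono) auto
    finally show "norm (u z) \<le> \<bar>C\<bar> * norm z ^ N" .
  qed (use \<epsilon> in auto)
qed

lemma flatI:
  assumes "\<epsilon> > 0" "\<And>z. z \<noteq> 0 \<Longrightarrow> norm z < \<epsilon> \<Longrightarrow> norm (u z) \<le> C * norm z ^ N"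
  shows "flat N u"
  unfolding flat_def eventually_at using assms by (intro exI[of _ C] exI[of _ \<epsilon>]) (auto simp: dist_norm)

lemma flat_mono:
  assumes "flat N u" "M \<le> N" shows "flat M u"
proof -
  obtain C \<epsilon> where C: "C \<ge> 0" "\<epsilon> > 0" "\<And>z. z \<noteq> 0 \<Longrightarrow> norm z < \<epsilon> \<Longrightarrow> norm (u z) \<le> C * norm z ^ N"
    using assms(1) by (rule flatE) blast
  show ?thesis
  proof (rule flatI[of "min \<epsilon> 1" u C])
    fix z :: "complex^'a" assume z: "z \<noteq> 0" "norm z < min \<epsilon> 1"
    have "norm (u z) \<le> C * norm z ^ N" using C(3) z by simp
    also have "\<dots> \<le> C * norm z ^ M"
      using z C(1) assms(2) by (intro mult_left_mono power_decreasing) auto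
    finally show "norm (u z) \<le> C * norm z ^ M" .
  qed (use C in auto)
qed

lemma flat_add:
  assumes "flat N u" "flat N v" shows "flat N (\<lambda>z. u z + v z)"
proof -
  obtain C D where "\<forall>\<^sub>F z in at 0. norm (u z) \<le> C * norm z ^ N" "\<forall>\<^sub>F z in at 0. norm (v z) \<le> D * norm z ^ N"
    using assms unfolding flat_def by blast
  then have "\<forall>\<^sub>F z in at 0. norm (u z + v z) \<le> (C + D) * norm z ^ N"
  proof eventually_elim
    case (elim z)
    then show ?case using norm_triangle_ineq[of "u z" "v z"] by (simp add: distrib_right)
  qed
  then show ?thesis unfolding flat_def by blast
qed

lemma flat_const_0: "flat N (\<lambda>z. 0)"
  unfolding flat_def by (intro exI[of _ 0]) simp

lemma flat_sum: "(\<And>i. i \<in> A \<Longrightarrow> flat N (u i)) \<Longrightarrow> flat N (\<lambda>z. \<Sum>i\<in>A. u i z)"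
  by (induction A rule: infinite_finite_induct) (auto intro: flat_add flat_const_0)

lemma flat_le:
  assumes "flat N v" "\<And>z. norm (u z) \<le> norm (v z)" shows "flat N u"
  using assms(1) unfolding flat_def
  by (elim exE, intro exI, elim eventually_mono) (rule order_trans[OF assms(2)])

lemma flat_norm: "flat N u \<Longrightarrow> flat N (\<lambda>z. norm (u z))"
  by (erule flat_le) simp

lemma flat_zero:
  assumes "flat (Suc N) u" "isCont u 0" shows "u 0 = 0"
proof -
  obtain C \<epsilon> where C: "C \<ge> 0" "\<epsilon> > 0" "\<And>z. z \<noteq> 0 \<Longrightarrow> norm z < \<epsilon> \<Longrightarrow> norm (u z) \<le> C * norm z ^ Suc N"
    using assms(1) by (rule flatE) blast
  have "((\<lambda>z::complex^'a. C * norm z ^ Suc N) \<longlongrightarrow> C * norm (0::complex^'a) ^ Suc N) (at 0)"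
    by (intro tendsto_intros)
  then have "((\<lambda>z::complex^'a. C * norm z ^ Suc N) \<longlongrightarrow> 0) (at 0)" by simp
  moreover have "\<forall>\<^sub>F z in at 0. norm (u z) \<le> C * norm z ^ Suc N"
    unfolding eventually_at using C by (intro exI[of _ \<epsilon>]) (auto simp: dist_norm)
  ultimately have "(u \<longlongrightarrow> 0) (at 0)" by (rule Lim_null_comparison[rotated])
  moreover have "(u \<longlongrightarrow> u 0) (at 0)" using assms(2) by (simp add: isCont_def)
  ultimately show ?thesis using tendsto_unique[OF _ _ \<open>(u \<longlongrightarrow> 0) (at 0)\<close>] by (metis at_neq_bot)
qed

lemma flatE_nhds:
  assumes "flat (Suc N) u" "isCont u 0"
  obtains C \<epsilon> where "C \<ge> 0" "\<epsilon> > 0" "\<And>z. norm z < \<epsilon> \<Longrightarrow> norm (u z) \<le> C * norm z ^ Suc N"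
proof -
  obtain C \<epsilon> where C: "C \<ge> 0" "\<epsilon> > 0" "\<And>z. z \<noteq> 0 \<Longrightarrow> norm z < \<epsilon> \<Longrightarrow> norm (u z) \<le> C * norm z ^ Suc N"
    using assms(1) by (rule flatE) blast
  moreover have "norm (u 0) \<le> C * norm (0::complex^'a) ^ Suc N" using flat_zero[OF assms] by simp
  ultimately show thesis using that[of C \<epsilon>] by metis
qed

lemma cgermE:
  assumes "cgerm u"
  obtains \<epsilon> where "\<epsilon> > 0" "\<And>z. norm z < \<epsilon> \<Longrightarrow> chol_at u z"
  using assms unfolding eventually_nhds_metric by (auto simp: dist_norm)

lemma cgermI:
  assumes "\<epsilon> > 0" "\<And>z. norm z < \<epsilon> \<Longrightarrow> chol_at u z"
  shows "cgerm u"
  using assms unfolding eventually_nhds_metric by (auto simp: dist_norm)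

lemma cgerm_isCont: "cgerm u \<Longrightarrow> isCont u 0"
  by (auto dest: eventually_nhds_x_imp_x chol_at_continuous)

section \<open>Division in one variable with holomorphic parameters\<close>

lemma has_integral_lincomb:
  fixes B :: "'b \<Rightarrow> real \<Rightarrow> complex"
  assumes "finite I" "\<And>b. b \<in> I \<Longrightarrow> B b integrable_on S"
  shows "((\<lambda>s. \<Sum>b\<in>I. l b * B b s) has_integral (\<Sum>b\<in>I. l b * integral S (B b))) S"
  using assms by (intro has_integral_sum has_integral_mult_right integrable_integral) auto

text \<open>Finite geometric expansion of the Cauchy kernel in \<open>y / w\<close>: the terms below
  \<open>c\<close> give the remainder of the division, the tail carries the factor
  \<open>y ^ c\<close>.\<close>

lemma geometric_split:
  fixes w y :: complex
  assumes "w \<noteq> 0" "w \<noteq> y"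
  shows "w / (w - y) = y ^ c * (w / (w ^ c * (w - y))) + (\<Sum>b<c. y ^ b * (1 / w ^ b))"
proof (induction c)
  case (Suc c)
  have "y ^ c * (w / (w ^ c * (w - y))) = y ^ Suc c * (w / (w ^ Suc c * (w - y))) + y ^ c * (1 / w ^ c)"
    using assms by (simp add: divide_simps) (simp add: algebra_simps)
  then show ?case using Suc by simp
qed simp

lemma slice_circle:
  fixes u :: "complex^'n \<Rightarrow> complex"
  assumes "\<delta> > 0" "\<And>z. norm z < 2 * \<delta> \<Longrightarrow> chol_at u z" "norm z < \<delta>"
  shows "continuous_on (cball 0 \<delta>) (\<lambda>w. u (upd z i w))" "(\<lambda>w. u (upd z i w)) holomorphic_on ball 0 \<delta>"
    "continuous_on {0..1} (\<lambda>s. u (upd z i (circlepath 0 \<delta> s)))"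
proof -
  have d: "(\<lambda>w. u (upd z i w)) field_differentiable at w" if "norm w \<le> \<delta>" for w
    by (rule chol_at_slice, rule assms(2)) (use norm_upd[of z i w] that assms in linarith)
  show c: "continuous_on (cball 0 \<delta>) (\<lambda>w. u (upd z i w))"
    by (intro continuous_at_imp_continuous_on ballI field_differentiable_imp_continuous_at d) simp
  show "(\<lambda>w. u (upd z i w)) holomorphic_on ball 0 \<delta>"
    by (rule holomorphic_onI_at) (use d in simp)
  show "continuous_on {0..1} (\<lambda>s. u (upd z i (circlepath 0 \<delta> s)))"
    by (rule continuous_on_compose2[OF c continuous_on_circlepath[OF continuous_on_id]])
       (use assms(1) in auto)
qed

text \<open>Inserting the split kernel into Cauchy's formula reads off quotient and remainders as
  explicit integrals. Hence the remainders visibly ignore coordinate \<open>i\<close>, independence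
  of other coordinates is inherited, and orders of vanishing can be tracked; existence alone would
  not support the induction over coordinates in \<open>hadamard_division\<close>.\<close>

lemma weierstrass_division:
  fixes u :: "complex^'n \<Rightarrow> complex"
  assumes "cgerm u"
  obtains q r where "cgerm q" "\<And>b. cgerm (r b)"
    "\<forall>\<^sub>F z in nhds 0. u z = z $ i ^ c * q z + (\<Sum>b<c. z $ i ^ b * r b z)"
    "\<And>b z w. r b (upd z i w) = r b z"
    "\<And>j b z w. j \<noteq> i \<Longrightarrow> (\<And>z w. u (upd z j w) = u z) \<Longrightarrow> q (upd z j w) = q z \<and> r b (upd z j w) = r b z"
    "\<And>N b. flat N u \<Longrightarrow> b \<le> N \<Longrightarrow> flat (N - b) (r b)"
proof -
  obtain \<epsilon> where \<epsilon>: "\<epsilon> > 0" "\<And>z. norm z < \<epsilon> \<Longrightarrow> chol_at u z"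
    using assms by (rule cgermE) blast
  define \<delta> where "\<delta> = \<epsilon> / 2"
  have \<delta>: "\<delta> > 0" "\<And>z. norm z < 2 * \<delta> \<Longrightarrow> chol_at u z" using \<epsilon> by (auto simp: \<delta>_def)
  let ?c = "circlepath 0 \<delta>"
  have c0: "?c s \<noteq> 0" for s using norm_circlepath[of \<delta> s] \<delta>(1) by force
  have cy: "?c s \<noteq> y" if "norm y < \<delta>" for s y using norm_circlepath[of \<delta> s] \<delta>(1) that by force
  define q where "q z = integral {0..1} (\<lambda>s. u (upd z i (?c s)) * (?c s / (?c s ^ c * (?c s - z $ i))))" for z
  define r where "r b z = integral {0..1} (\<lambda>s. u (upd z i (?c s)) * (1 / ?c s ^ b))" for b z
  have nth: "norm (z $ i) < \<delta>" if "norm z < \<delta>" for z :: "complex^'n"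
    using Finite_Cartesian_Product.norm_nth_le[of z i] that by linarith
  have cyc: "continuous_on A (\<lambda>x. ?c (snd x))" for A :: "(complex \<times> real) set"
    by (intro continuous_intros)
  show thesis
  proof (rule that[of q r])
    show "cgerm q"
    proof (rule cgermI[OF \<delta>(1)])
      fix z :: "complex^'n" assume z: "norm z < \<delta>"
      show "chol_at q z" unfolding q_def
      proof (rule chol_at_kernel[of \<delta> u \<delta> "\<lambda>y s. ?c s / (?c s ^ c * (?c s - y))", OF \<delta>(2,1) _ _ z nth[OF z]])
        show "continuous_on (ball 0 \<delta> \<times> {0..1}) (\<lambda>(y, s). ?c s / (?c s ^ c * (?c s - y)))"
          unfolding split_beta by (intro continuous_intros cyc) (use c0 cy in auto)
        show "(\<lambda>y. ?c s / (?c s ^ c * (?c s - y))) field_differentiable at y" if "norm y < \<delta>" for y s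
          by (intro derivative_intros) (use c0 cy that in auto)
      qed auto
    qed
    show "cgerm (r b)" for b
    proof (rule cgermI[OF \<delta>(1)])
      fix z :: "complex^'n" assume z: "norm z < \<delta>"
      show "chol_at (r b) z" unfolding r_def
      proof (rule chol_at_kernel[of \<delta> u \<delta> "\<lambda>y s. 1 / ?c s ^ b", OF \<delta>(2,1) _ _ z nth[OF z]])
        show "continuous_on (ball 0 \<delta> \<times> {0..1}) (\<lambda>(y, s). 1 / ?c s ^ b)"
          unfolding split_beta by (intro continuous_intros cyc) (use c0 in auto)
      qed (auto intro: derivative_intros)
    qed
    show "\<forall>\<^sub>F z in nhds 0. u z = z $ i ^ c * q z + (\<Sum>b<c. z $ i ^ b * r b z)"
      unfolding eventually_nhds_metric
    proof (intro exI[of _ \<delta>] conjI allI impI)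
      fix z :: "complex^'n" assume "dist z 0 < \<delta>"
      then have z: "norm z < \<delta>" by simp
      note sl = slice_circle[OF \<delta> z, of i]
      have "u z = integral {0..1} (\<lambda>s. u (upd z i (?c s)) * ?c s / (?c s - z $ i))"
        using cauchy_mean_value[OF sl(1,2) nth[OF z]] by simp
      also have "\<dots> = integral {0..1} (\<lambda>s. z $ i ^ c * (u (upd z i (?c s)) * (?c s / (?c s ^ c * (?c s - z $ i))))
          + (\<Sum>b<c. z $ i ^ b * (u (upd z i (?c s)) * (1 / ?c s ^ b))))"
      proof (rule integral_cong)
        fix s
        have "u (upd z i (?c s)) * ?c s / (?c s - z $ i) = u (upd z i (?c s)) * (?c s / (?c s - z $ i))" by simp
        also have "\<dots> = z $ i ^ c * (u (upd z i (?c s)) * (?c s / (?c s ^ c * (?c s - z $ i))))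
          + (\<Sum>b<c. z $ i ^ b * (u (upd z i (?c s)) * (1 / ?c s ^ b)))"
          by (subst geometric_split[OF c0 cy[OF nth[OF z]], where c=c])
             (simp add: distrib_left sum_distrib_left mult_ac)
        finally show "u (upd z i (?c s)) * ?c s / (?c s - z $ i) = \<dots>" .
      qed
      also have "\<dots> = z $ i ^ c * q z + (\<Sum>b<c. z $ i ^ b * r b z)"
      proof -
        have i1: "(\<lambda>s. u (upd z i (?c s)) * (?c s / (?c s ^ c * (?c s - z $ i)))) integrable_on {0..1}"
          by (intro integrable_continuous_real continuous_intros sl) (use c0 cy nth z in auto)
        have i2: "(\<lambda>s. u (upd z i (?c s)) * (1 / ?c s ^ b)) integrable_on {0..1}" for b
          by (intro integrable_continuous_real continuous_intros sl) (use c0 in auto)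
        have "((\<lambda>s. z $ i ^ c * (u (upd z i (?c s)) * (?c s / (?c s ^ c * (?c s - z $ i))))
            + (\<Sum>b<c. z $ i ^ b * (u (upd z i (?c s)) * (1 / ?c s ^ b))))
            has_integral z $ i ^ c * q z + (\<Sum>b<c. z $ i ^ b * r b z)) {0..1}"
          unfolding q_def r_def
          by (intro has_integral_add has_integral_mult_right integrable_integral i1 has_integral_lincomb i2) auto
        then show ?thesis by (rule integral_unique)
      qed
      finally show "u z = z $ i ^ c * q z + (\<Sum>b<c. z $ i ^ b * r b z)" .
    qed (use \<delta> in auto)
    show "r b (upd z i w) = r b z" for b z w unfolding r_def by simp
    show "q (upd z j w) = q z \<and> r b (upd z j w) = r b z"
      if "j \<noteq> i" "\<And>z w. u (upd z j w) = u z" for j b z w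
    proof -
      have "upd (upd z j w) i v = upd (upd z i v) j w" for v
        using that(1) by (simp add: vec_eq_iff upd_nth)
      then have "u (upd (upd z j w) i v) = u (upd z i v)" for v by (simp add: that(2))
      then show ?thesis using that(1) by (simp add: q_def r_def upd_nth)
    qed
    show "flat (N - b) (r b)" if fl: "flat N u" and b: "b \<le> N" for N b
    proof -
      obtain C \<epsilon>' where C: "C \<ge> 0" "\<epsilon>' > 0" "\<And>z. z \<noteq> 0 \<Longrightarrow> norm z < \<epsilon>' \<Longrightarrow> norm (u z) \<le> C * norm z ^ N"
        using fl by (rule flatE) blast
      show ?thesis
      proof (rule flatI[of "min (\<epsilon>' / 2) \<delta>" _ "C * 2 ^ N"])
        fix z :: "complex^'n" assume z: "z \<noteq> 0" "norm z < min (\<epsilon>' / 2) \<delta>"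
        then have z': "norm z < \<delta>" by simp
        note sl = slice_circle[OF \<delta> z', of i]
        \<comment> \<open>A remainder is a Taylor coefficient of the slice at 0, so an estimate on
          the circle of radius \<open>norm z\<close> costs exactly \<open>b\<close> orders.\<close>
        have "r b z = (deriv ^^ b) (\<lambda>w. u (upd z i w)) 0 / fact b"
          using cauchy_mean[OF sl(1,2), of 0 b] \<delta>(1) c0 by (simp add: r_def)
        moreover have "norm ((deriv ^^ b) (\<lambda>w. u (upd z i w)) 0) \<le> fact b * (C * (2 * norm z) ^ N) / norm z ^ b"
        proof (rule Cauchy_inequality)
          show "(\<lambda>w. u (upd z i w)) holomorphic_on ball 0 (norm z)"
            by (rule holomorphic_on_subset[OF sl(2)]) (use z in auto)
          show "continuous_on (cball 0 (norm z)) (\<lambda>w. u (upd z i w))"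
            by (rule continuous_on_subset[OF sl(1)]) (use z in auto)
          show "norm z > 0" using z by simp
          fix w :: complex assume "norm (0 - w) = norm z"
          then have w: "norm w = norm z" by simp
          have "upd z i w $ i \<noteq> 0" using w z by (auto simp: upd_nth)
          then have "upd z i w \<noteq> 0" by auto
          moreover have n: "norm (upd z i w) \<le> 2 * norm z" using norm_upd[of z i w] w by simp
          ultimately have "norm (u (upd z i w)) \<le> C * norm (upd z i w) ^ N"
            using C(3) z by auto
          also have "\<dots> \<le> C * (2 * norm z) ^ N" using C(1) n by (intro mult_left_mono power_mono) auto
          finally show "norm (u (upd z i w)) \<le> C * (2 * norm z) ^ N" .
        qed
        ultimately have "norm (r b z) \<le> C * (2 * norm z) ^ N / norm z ^ b"
          by (simp add: norm_divide divide_le_eq mult.commute)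
        also have "\<dots> = C * 2 ^ N * norm z ^ (N - b)"
          using z b by (simp add: power_mult_distrib power_diff)
        finally show "norm (r b z) \<le> C * 2 ^ N * norm z ^ (N - b)" .
      qed (use C \<delta> in auto)
    qed
  qed
qed

text \<open>Factoring \<open>w ^ m - y ^ m\<close> by \<open>w - y\<close> makes the Cauchy kernel a
  polynomial in \<open>y\<close> of degree below \<open>m\<close> whose coefficients depend on
  \<open>y\<close> only through \<open>y ^ m\<close>.\<close>

lemma root_kernel_sum:
  fixes w y :: complex
  assumes "m > 0" "w ^ m \<noteq> y ^ m"
  shows "w / (w - y) = (\<Sum>j<m. y ^ j * (w ^ (m - j) / (w ^ m - y ^ m)))"
proof -
  obtain k where m: "m = Suc k" using assms(1) gr0_implies_Suc by blast
  have "w ^ m - y ^ m = (w - y) * (\<Sum>j<m. w ^ (k - j) * y ^ j)"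
    unfolding m by (subst diff_power_eq_sum, subst sum.nat_diff_reindex[symmetric]) (simp add: mult.commute)
  moreover from this have "(\<Sum>j<m. w ^ (k - j) * y ^ j) \<noteq> 0" using assms(2) by auto
  ultimately have "w / (w - y) = w * (\<Sum>j<m. w ^ (k - j) * y ^ j) / (w ^ m - y ^ m)"
    by simp
  also have "\<dots> = (\<Sum>j<m. y ^ j * (w ^ (m - j) / (w ^ m - y ^ m)))"
    unfolding sum_distrib_left sum_divide_distrib
    by (rule sum.cong) (simp_all add: m Suc_diff_le mult_ac)
  finally show ?thesis .
qed

text \<open>Powers of coordinate \<open>i\<close> are sorted by exponent modulo \<open>m\<close>.
  This is the preparation theorem for the map raising that coordinate to the power \<open>m\<close>,
  made explicit by the kernel. The denominator of \<open>K j\<close> stays away from 0 when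
  coordinate \<open>i\<close> is below \<open>\<delta> ^ m\<close>, hence the second radius.\<close>

lemma root_splitting:
  fixes u :: "complex^'n \<Rightarrow> complex"
  assumes "cgerm u" "m > 0"
  obtains K where "\<And>j. cgerm (K j)"
    "\<forall>\<^sub>F z in nhds 0. u z = (\<Sum>j<m. z $ i ^ j * K j (upd z i (z $ i ^ m)))"
proof -
  obtain \<epsilon> where \<epsilon>: "\<epsilon> > 0" "\<And>z. norm z < \<epsilon> \<Longrightarrow> chol_at u z"
    using assms(1) by (rule cgermE) blast
  define \<delta> where "\<delta> = \<epsilon> / 2"
  have \<delta>: "\<delta> > 0" "\<And>z. norm z < 2 * \<delta> \<Longrightarrow> chol_at u z" using \<epsilon> by (auto simp: \<delta>_def)
  let ?c = "circlepath 0 \<delta>"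
  have cy: "?c s ^ m \<noteq> y" if "norm y < \<delta> ^ m" for s y
    using norm_circlepath[of \<delta> s] \<delta>(1) that by (auto simp: norm_power)
  define K where "K j z = integral {0..1} (\<lambda>s. u (upd z i (?c s)) * (?c s ^ (m - j) / (?c s ^ m - z $ i)))" for j z
  have nth: "norm (z $ i) < \<delta>" if "norm z < \<delta>" for z :: "complex^'n"
    using Finite_Cartesian_Product.norm_nth_le[of z i] that by linarith
  have cyc: "continuous_on A (\<lambda>x. ?c (snd x))" for A :: "(complex \<times> real) set"
    by (intro continuous_intros)
  show thesis
  proof (rule that[of K])
    show "cgerm (K j)" for j
    proof (rule cgermI[of "min \<delta> (\<delta> ^ m)"])
      fix z :: "complex^'n" assume z: "norm z < min \<delta> (\<delta> ^ m)"
      show "chol_at (K j) z" unfolding K_def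
      proof (rule chol_at_kernel[of \<delta> u "\<delta> ^ m" "\<lambda>y s. ?c s ^ (m - j) / (?c s ^ m - y)", OF \<delta>(2,1)])
        show "continuous_on (ball 0 (\<delta> ^ m) \<times> {0..1}) (\<lambda>(y, s). ?c s ^ (m - j) / (?c s ^ m - y))"
          unfolding split_beta by (intro continuous_intros cyc) (use cy in auto)
        show "(\<lambda>y. ?c s ^ (m - j) / (?c s ^ m - y)) field_differentiable at y" if "norm y < \<delta> ^ m" for y s
          by (intro derivative_intros) (use cy that in auto)
        show "norm (z $ i) < \<delta> ^ m" using Finite_Cartesian_Product.norm_nth_le[of z i] z by linarith
      qed (use z in auto)
    qed (use \<delta> in auto)
    show "\<forall>\<^sub>F z in nhds 0. u z = (\<Sum>j<m. z $ i ^ j * K j (upd z i (z $ i ^ m)))"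
      unfolding eventually_nhds_metric
    proof (intro exI[of _ \<delta>] conjI allI impI)
      fix z :: "complex^'n" assume "dist z 0 < \<delta>"
      then have z: "norm z < \<delta>" by simp
      note sl = slice_circle[OF \<delta> z, of i]
      have zm: "norm (z $ i ^ m) < \<delta> ^ m"
        using nth[OF z] assms(2) by (simp add: norm_power power_strict_mono)
      have "u z = integral {0..1} (\<lambda>s. u (upd z i (?c s)) * ?c s / (?c s - z $ i))"
        using cauchy_mean_value[OF sl(1,2) nth[OF z]] by simp
      also have "\<dots> = integral {0..1} (\<lambda>s. \<Sum>j<m. z $ i ^ j * (u (upd z i (?c s)) * (?c s ^ (m - j) / (?c s ^ m - z $ i ^ m))))"
      proof (rule integral_cong)
        fix s
        have "u (upd z i (?c s)) * ?c s / (?c s - z $ i) = u (upd z i (?c s)) * (?c s / (?c s - z $ i))" by simp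
        also have "\<dots> = (\<Sum>j<m. z $ i ^ j * (u (upd z i (?c s)) * (?c s ^ (m - j) / (?c s ^ m - z $ i ^ m))))"
          by (subst root_kernel_sum[OF assms(2) cy[OF zm]])
             (simp add: sum_distrib_left mult_ac)
        finally show "u (upd z i (?c s)) * ?c s / (?c s - z $ i) = \<dots>" .
      qed
      also have "\<dots> = (\<Sum>j<m. z $ i ^ j * K j (upd z i (z $ i ^ m)))"
      proof -
        have i1: "(\<lambda>s. u (upd z i (?c s)) * (?c s ^ (m - j) / (?c s ^ m - z $ i ^ m))) integrable_on {0..1}" for j
          by (intro integrable_continuous_real continuous_intros sl) (use cy zm in auto)
        have "((\<lambda>s. \<Sum>j<m. z $ i ^ j * (u (upd z i (?c s)) * (?c s ^ (m - j) / (?c s ^ m - z $ i ^ m))))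
            has_integral (\<Sum>j<m. z $ i ^ j * K j (upd z i (z $ i ^ m)))) {0..1}"
          unfolding K_def upd_upd by (simp only: upd_nth if_True refl) (intro has_integral_lincomb i1, simp)
        then show ?thesis by (rule integral_unique)
      qed
      finally show "u z = (\<Sum>j<m. z $ i ^ j * K j (upd z i (z $ i ^ m)))" .
    qed (use \<delta> in auto)
  qed
qed

section \<open>Hadamard division and jets\<close>

lemma indep_all_const:
  fixes u :: "complex^'n \<Rightarrow> 'b"
  assumes "\<And>j z w. u (upd z j w) = u z"
  shows "u z = u 0"
proof -
  have "u (\<chi> j. if j \<in> T then z $ j else 0) = u 0" if "finite T" for T
    using that
  proof (induction T rule: finite_induct)
    case (insert i T)
    have "(\<chi> j. if j \<in> insert i T then z $ j else 0) = upd (\<chi> j. if j \<in> T then z $ j else 0) i (z $ i)"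
      by (simp add: vec_eq_iff upd_nth)
    then show ?case using insert assms by metis
  qed (simp add: zero_vec_def)
  from this[of UNIV] show ?thesis by simp
qed

text \<open>A monomial of degree above the sum of the \<open>d i\<close> is divisible by some
  \<open>z $ i ^ d i\<close>. The analytic version divides by one coordinate at a time: the
  remainders no longer involve the coordinate used, and each loses fewer than \<open>d i\<close>
  orders of vanishing, so the hypothesis for the smaller set holds.\<close>

lemma hadamard_division:
  fixes u :: "complex^'n \<Rightarrow> complex" and d :: "'n \<Rightarrow> nat"
  assumes "finite S" "cgerm u" "\<forall>j z w. j \<notin> S \<longrightarrow> u (upd z j w) = u z" "flat (Suc (\<Sum>i\<in>S. d i)) u"
  shows "\<exists>q. (\<forall>i\<in>S. cgerm (q i) \<and> (\<forall>j z w. j \<notin> S \<longrightarrow> q i (upd z j w) = q i z)) \<and>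
    (\<forall>\<^sub>F z in nhds 0. u z = (\<Sum>i\<in>S. z $ i ^ d i * q i z))"
  using assms
proof (induction S arbitrary: u rule: finite_induct)
  case empty
  \<comment> \<open>With no coordinate left \<open>u\<close> is constant, and flatness forces the
    constant to be 0.\<close>
  have "u 0 = 0" using flat_zero[OF empty(3) cgerm_isCont[OF empty(1)]] .
  then have "u z = 0" for z using indep_all_const[of u z] empty(2) by auto
  then show ?case by simp
next
  case (insert i S)
  obtain q r where q: "cgerm q" and r: "\<And>b. cgerm (r b)"
    and u: "\<forall>\<^sub>F z in nhds 0. u z = z $ i ^ d i * q z + (\<Sum>b<d i. z $ i ^ b * r b z)"
    and ri: "\<And>b z w. r b (upd z i w) = r b z"
    and ind: "\<And>j b z w. j \<noteq> i \<Longrightarrow> (\<And>z w. u (upd z j w) = u z) \<Longrightarrow> q (upd z j w) = q z \<and> r b (upd z j w) = r b z"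
    and fl: "\<And>N b. flat N u \<Longrightarrow> b \<le> N \<Longrightarrow> flat (N - b) (r b)"
    by (rule weierstrass_division[OF insert.prems(1), where i=i and c="d i"]) blast
  have ind': "q (upd z j w) = q z \<and> r b (upd z j w) = r b z" if "j \<notin> insert i S" for j b z w
    by (rule ind) (use that insert.prems(2) in auto)
  have "\<exists>Q. (\<forall>k\<in>S. cgerm (Q k) \<and> (\<forall>j z w. j \<notin> S \<longrightarrow> Q k (upd z j w) = Q k z)) \<and>
      (\<forall>\<^sub>F z in nhds 0. r b z = (\<Sum>k\<in>S. z $ k ^ d k * Q k z))" if b: "b < d i" for b
  proof (rule insert.IH)
    show "\<forall>j z w. j \<notin> S \<longrightarrow> r b (upd z j w) = r b z"
      using ri ind' by (metis insert_iff)
    have s: "(\<Sum>k\<in>insert i S. d k) = d i + (\<Sum>k\<in>S. d k)" using insert.hyps by simp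
    show "flat (Suc (\<Sum>k\<in>S. d k)) (r b)"
      by (rule flat_mono[OF fl[OF insert.prems(3)]]) (use s b in auto)
  qed (rule r)
  then have "\<forall>b. \<exists>Q. b < d i \<longrightarrow> (\<forall>k\<in>S. cgerm (Q k) \<and> (\<forall>j z w. j \<notin> S \<longrightarrow> Q k (upd z j w) = Q k z)) \<and>
      (\<forall>\<^sub>F z in nhds 0. r b z = (\<Sum>k\<in>S. z $ k ^ d k * Q k z))" by blast
  from choice[OF this] obtain Q where Q0: "\<forall>b. b < d i \<longrightarrow> (\<forall>k\<in>S. cgerm (Q b k) \<and> (\<forall>j z w. j \<notin> S \<longrightarrow> Q b k (upd z j w) = Q b k z)) \<and>
      (\<forall>\<^sub>F z in nhds 0. r b z = (\<Sum>k\<in>S. z $ k ^ d k * Q b k z))" ..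
  have Q: "\<And>b k. b < d i \<Longrightarrow> k \<in> S \<Longrightarrow> cgerm (Q b k)"
    "\<And>b k j z w. b < d i \<Longrightarrow> k \<in> S \<Longrightarrow> j \<notin> S \<Longrightarrow> Q b k (upd z j w) = Q b k z"
    "\<And>b. b < d i \<Longrightarrow> \<forall>\<^sub>F z in nhds 0. r b z = (\<Sum>k\<in>S. z $ k ^ d k * Q b k z)"
    using Q0 by auto
  define q' where "q' k = (if k = i then q else (\<lambda>z. \<Sum>b<d i. z $ i ^ b * Q b k z))" for k
  have ev: "\<forall>\<^sub>F z in nhds 0. \<forall>b\<in>{..<d i}. \<forall>k\<in>S. chol_at (Q b k) z"
    using Q(1) insert.hyps by (intro eventually_ball_finite ballI) auto
  have 1: "cgerm (q' k)" if "k \<in> insert i S" for k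
  proof (cases "k = i")
    case False
    then have "k \<in> S" using that by auto
    from ev show ?thesis
    proof eventually_elim
      case (elim z)
      show ?case using False \<open>k \<in> S\<close> elim unfolding q'_def
        by (auto intro!: chol_at_sum chol_at_mult chol_at_power)
    qed
  qed (use q in \<open>simp add: q'_def\<close>)
  have 2: "q' k (upd z j w) = q' k z" if "k \<in> insert i S" "j \<notin> insert i S" for k j z w
    using that ind' Q(2) by (auto simp: q'_def upd_nth)
  have "\<forall>\<^sub>F z in nhds 0. \<forall>b\<in>{..<d i}. r b z = (\<Sum>k\<in>S. z $ k ^ d k * Q b k z)"
    using Q(3) by (intro eventually_ball_finite ballI) auto
  with u have "\<forall>\<^sub>F z in nhds 0. u z = (\<Sum>k\<in>insert i S. z $ k ^ d k * q' k z)"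
  proof eventually_elim
    case (elim z)
    have "(\<Sum>k\<in>S. z $ k ^ d k * q' k z) = (\<Sum>k\<in>S. \<Sum>b<d i. z $ i ^ b * (z $ k ^ d k * Q b k z))"
      using insert.hyps by (intro sum.cong) (auto simp: q'_def sum_distrib_left mult_ac)
    also have "\<dots> = (\<Sum>b<d i. z $ i ^ b * r b z)"
      using elim(2) by (subst sum.swap) (simp add: sum_distrib_left)
    finally show ?case using elim(1) insert.hyps by (simp add: q'_def)
  qed
  with 1 2 show ?case by (intro exI[of _ q']) auto
qed

section \<open>Iterated partial derivatives and order of vanishing\<close>

lemma tendsto_add_axis: "((\<lambda>t. z + axis i t :: complex^'n) \<longlongrightarrow> z) (nhds 0)"
proof -
  have "isCont (\<lambda>t. z + axis i t :: complex^'n) 0"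
    using has_derivative_add_axis by (rule has_derivative_continuous)
  then show ?thesis using tendsto_at_iff_tendsto_nhds[of "\<lambda>t. z + axis i t :: complex^'n" 0] by (simp add: isCont_def)
qed

lemma partial_deriv_cong:
  assumes "\<forall>\<^sub>F w in nhds z. u w = v w"
  shows "partial_deriv i u z = partial_deriv i v z"
  unfolding partial_deriv_def
  by (rule deriv_cong_ev) (use filterlim_iff[THEN iffD1, OF tendsto_add_axis, rule_format, OF assms] in simp_all)

lemma partial_deriv_diff:
  assumes "chol_at u z" "chol_at v z"
  shows "partial_deriv i (\<lambda>z. u z - v z) z = partial_deriv i u z - partial_deriv i v z"
proof -
  have "(\<lambda>t. w (z + axis i t)) field_differentiable at 0" if "chol_at w z" for w
    using that unfolding field_differentiable_def
    by (elim chol_atE) (intro exI, rule axis_slice_has_field_derivative, auto)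
  with assms show ?thesis unfolding partial_deriv_def by simp
qed

lemma cgerm_foldr_partial: "cgerm u \<Longrightarrow> cgerm (foldr partial_deriv is u)"
  by (induction "is") (auto intro: cgerm_partial)

lemma foldr_partial_diff:
  assumes "cgerm u" "cgerm v"
  shows "\<forall>\<^sub>F z in nhds 0. foldr partial_deriv is (\<lambda>z. u z - v z) z = foldr partial_deriv is u z - foldr partial_deriv is v z"
proof (induction "is")
  case (Cons i "is")
  have "\<forall>\<^sub>F z in nhds 0. \<forall>\<^sub>F w in nhds z. foldr partial_deriv is (\<lambda>z. u z - v z) w = foldr partial_deriv is u w - foldr partial_deriv is v w"
    using Cons by (simp add: eventually_eventually)
  then show ?case
    using cgerm_foldr_partial[OF assms(1), of "is"] cgerm_foldr_partial[OF assms(2), of "is"]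
    by eventually_elim (simp add: partial_deriv_cong partial_deriv_diff)
qed simp

text \<open>Cauchy's estimate on a circle of radius \<open>norm z\<close> around \<open>z\<close>:
  the values are bounded by a multiple of \<open>(2 * norm z) ^ Suc k\<close>, and dividing by the
  radius costs one order.\<close>

lemma flat_partial:
  assumes "cgerm u" "flat (Suc k) u"
  shows "flat k (partial_deriv i u)"
proof -
  obtain C \<epsilon> where C: "C \<ge> 0" "\<epsilon> > 0" "\<And>z. norm z < \<epsilon> \<Longrightarrow> norm (u z) \<le> C * norm z ^ Suc k"
    using flatE_nhds[OF assms(2) cgerm_isCont[OF assms(1)]] by blast
  obtain \<delta> where \<delta>: "\<delta> > 0" "\<And>z. norm z < \<delta> \<Longrightarrow> chol_at u z"
    using assms(1) by (rule cgermE) blast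
  show ?thesis
  proof (rule flatI[of "min \<epsilon> \<delta> / 2" _ "C * 2 ^ Suc k"])
    fix z :: "complex^'a" assume z: "z \<noteq> 0" "norm z < min \<epsilon> \<delta> / 2"
    let ?f = "\<lambda>w. u (z + axis i w)"
    have n: "norm (z + axis i w) \<le> 2 * norm z" if "norm w \<le> norm z" for w
      using norm_triangle_ineq[of z "axis i w"] that by simp
    have d: "?f field_differentiable at w" if "norm w \<le> norm z" for w
    proof -
      have "chol_at u (z + axis i w)" using \<delta>(2) n[OF that] z(2) by auto
      then show ?thesis unfolding field_differentiable_def
        by (elim chol_atE) (blast intro: axis_slice_has_field_derivative)
    qed
    have "norm ((deriv ^^ 1) ?f 0) \<le> fact 1 * (C * (2 * norm z) ^ Suc k) / norm z ^ 1"
    proof (rule Cauchy_inequality)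
      show "?f holomorphic_on ball 0 (norm z)"
        by (rule holomorphic_onI_at) (use d in simp)
      show "continuous_on (cball 0 (norm z)) ?f"
        by (intro continuous_at_imp_continuous_on ballI field_differentiable_imp_continuous_at d) simp
      show "0 < norm z" using z by simp
      fix w :: complex assume "norm (0 - w) = norm z"
      then have w: "norm w \<le> norm z" by simp
      have "norm (u (z + axis i w)) \<le> C * norm (z + axis i w) ^ Suc k"
        using C(3) n[OF w] z(2) by auto
      also have "\<dots> \<le> C * (2 * norm z) ^ Suc k"
        using C(1) n[OF w] by (intro mult_left_mono power_mono) auto
      finally show "norm (u (z + axis i w)) \<le> C * (2 * norm z) ^ Suc k" .
    qed
    then show "norm (partial_deriv i u z) \<le> C * 2 ^ Suc k * norm z ^ k"
      using z(1) by (simp add: partial_deriv_def power_mult_distrib mult_ac)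
  qed (use C \<delta> in auto)
qed

lemma flat_imp_jet_zero:
  assumes "cgerm u" "flat (Suc r) u" "length is \<le> r"
  shows "foldr partial_deriv is u 0 = 0"
proof -
  have "length is \<le> r \<Longrightarrow> flat (Suc r - length is) (foldr partial_deriv is u)"
  proof (induction "is")
    case (Cons i "is")
    then have "flat (Suc (Suc r - length (i # is))) (foldr partial_deriv is u)"
      by (simp add: Suc_diff_le)
    from flat_partial[OF cgerm_foldr_partial[OF assms(1)] this] show ?case by simp
  qed (use assms in simp)
  then have "flat (Suc (r - length is)) (foldr partial_deriv is u)"
    using assms(3) by (simp add: Suc_diff_le)
  then show ?thesis by (rule flat_zero[OF _ cgerm_isCont[OF cgerm_foldr_partial[OF assms(1)]]])
qed

lemma partial_deriv_bound:
  fixes u :: "complex^'n \<Rightarrow> complex" and B :: real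
  assumes "convex S" "\<And>x. x \<in> S \<Longrightarrow> chol_at u x"
    and B: "\<And>x. x \<in> S \<Longrightarrow> (\<Sum>i\<in>UNIV. norm (partial_deriv i u x)) \<le> B" and "z \<in> S" "w \<in> S"
  shows "norm (u z - u w) \<le> B * norm (z - w)"
proof (rule differentiable_bound[OF assms(1) _ _ assms(4,5)])
  fix x assume x: "x \<in> S"
  show "(u has_derivative (\<lambda>h. \<Sum>i\<in>UNIV. partial_deriv i u x * h $ i)) (at x within S)"
    by (rule has_derivative_at_withinI[OF chol_at_partial_deriv[OF assms(2)[OF x]]])
  show "onorm (\<lambda>h. \<Sum>i\<in>UNIV. partial_deriv i u x * h $ i) \<le> B"
  proof (rule onorm_bound)
    show "0 \<le> B" by (rule order_trans[OF sum_nonneg B[OF x]]) simp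
    fix h :: "complex^'n"
    have "norm (\<Sum>i\<in>UNIV. partial_deriv i u x * h $ i) \<le> (\<Sum>i\<in>UNIV. norm (partial_deriv i u x) * norm h)"
      by (rule sum_norm_le) (simp add: norm_mult mult_left_mono Finite_Cartesian_Product.norm_nth_le)
    also have "\<dots> \<le> B * norm h"
      unfolding sum_distrib_right[symmetric] by (intro mult_right_mono B[OF x]) simp
    finally show "norm (\<Sum>i\<in>UNIV. partial_deriv i u x * h $ i) \<le> B * norm h" .
  qed
qed

lemma isCont_partial_norms:
  "cgerm u \<Longrightarrow> isCont (\<lambda>z. \<Sum>i\<in>UNIV. norm (partial_deriv i u z)) 0"
  by (intro continuous_intros cgerm_isCont cgerm_partial)

text \<open>Integration order by order: flatness of the first partial derivatives is known by
  induction, and the mean value bound on the ball of radius \<open>norm z\<close> adds one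
  order.\<close>

lemma jet_zero_imp_flat:
  assumes "cgerm u" "\<And>is. length is \<le> r \<Longrightarrow> foldr partial_deriv is u 0 = 0"
  shows "flat (Suc r) u"
  using assms
proof (induction r arbitrary: u)
  case (0 u)
  have u0: "u 0 = 0" using 0(2)[of "[]"] by simp
  obtain D where D: "(u has_derivative D) (at 0)" "\<forall>a h. D (a *s h) = a * D h"
    using eventually_nhds_x_imp_x[OF 0(1)] by (rule chol_atE)
  obtain \<delta> where \<delta>: "\<delta> > 0" "\<And>z. norm z < \<delta> \<Longrightarrow> norm (u z - u 0 - D (z - 0)) \<le> 1 * norm (z - 0)"
    using D(1) unfolding has_derivative_at_alt by (metis diff_zero zero_less_one)
  obtain K where K: "\<And>z. norm (D z) \<le> norm z * K"
    using bounded_linear.bounded[OF has_derivative_bounded_linear[OF D(1)]] by blast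
  show ?case
  proof (rule flatI[OF \<delta>(1), of _ "1 + K"])
    fix z :: "complex^'a" assume "norm z < \<delta>"
    then have "norm (u z - D z) \<le> norm z" using \<delta>(2)[of z] u0 by simp
    then show "norm (u z) \<le> (1 + K) * norm z ^ Suc 0"
      using norm_triangle_sub[of "u z" "D z"] K[of z] by (simp add: algebra_simps)
  qed
next
  case (Suc r u)
  have u0: "u 0 = 0" using Suc(3)[of "[]"] by simp
  have "flat (Suc r) (partial_deriv i u)" for i
  proof (rule Suc.IH[OF cgerm_partial[OF Suc.prems(1)]])
    \<comment> \<open>\<open>foldr\<close> applies the last list entry first, so the derivative
      already taken is appended at the end of the list.\<close>
    show "foldr partial_deriv is (partial_deriv i u) 0 = 0" if "length is \<le> r" for "is"
      using Suc.prems(2)[of "is @ [i]"] that by simp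
  qed
  then have "flat (Suc r) (\<lambda>z. \<Sum>i\<in>UNIV. norm (partial_deriv i u z))"
    by (intro flat_sum flat_norm)
  from flatE_nhds[OF this isCont_partial_norms[OF Suc.prems(1)]] obtain C \<epsilon> where C: "C \<ge> 0" "\<epsilon> > 0"
    "\<And>z. norm z < \<epsilon> \<Longrightarrow> norm (\<Sum>i\<in>UNIV. norm (partial_deriv i u z)) \<le> C * norm z ^ Suc r" by blast
  obtain \<delta> where \<delta>: "\<delta> > 0" "\<And>z. norm z < \<delta> \<Longrightarrow> chol_at u z"
    using Suc.prems(1) by (rule cgermE) blast
  show ?case
  proof (rule flatI[of "min \<epsilon> \<delta>" _ C])
    fix z :: "complex^'a" assume z: "norm z < min \<epsilon> \<delta>"
    have "norm (u z - u 0) \<le> C * norm z ^ Suc r * norm (z - 0)"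
    proof (rule partial_deriv_bound[of "cball 0 (norm z)"])
      fix w :: "complex^'a" assume "w \<in> cball 0 (norm z)"
      then have w: "norm w \<le> norm z" by simp
      show "chol_at u w" using w z \<delta>(2) by simp
      have "(\<Sum>i\<in>UNIV. norm (partial_deriv i u w)) \<le> C * norm w ^ Suc r"
        using C(3)[of w] w z by simp
      also have "\<dots> \<le> C * norm z ^ Suc r" using w C(1) by (intro mult_left_mono power_mono) auto
      finally show "(\<Sum>i\<in>UNIV. norm (partial_deriv i u w)) \<le> C * norm z ^ Suc r" .
    qed auto
    then show "norm (u z) \<le> C * norm z ^ Suc (Suc r)" using u0 by (simp add: mult_ac)
  qed (use C \<delta> in auto)
qed

section \<open>Germs of biholomorphisms and left determinacy\<close>

lemma partial_deriv_nth: "partial_deriv i (\<lambda>z. z $ j) z = (if i = j then 1 else 0)"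
proof -
  have "((\<lambda>t. (z + axis i t) $ j) has_field_derivative (if i = j then 1 else 0)) (at 0)"
    by (cases "i = j") (auto simp: axis_def intro!: derivative_eq_intros)
  then show ?thesis unfolding partial_deriv_def by (rule DERIV_imp_deriv)
qed

lemma inverse_linear_smult:
  assumes "bij L" "\<And>a h. L (a *s h) = a *s L h"
  shows "inv L (a *s h) = a *s inv L h"
  using assms(1)
  by (intro inv_f_eq) (simp_all add: bij_is_inj assms(2) bij_is_surj surj_f_inv_f)

text \<open>Flatness of order 2 makes the derivative at 0 the identity. The real inverse function
  theorem then supplies a differentiable inverse, which is holomorphic because the inverse of a
  complex-linear bijection is complex-linear.\<close>

lemma biholo_germ_near_id:
  fixes \<Psi> :: "complex^'n \<Rightarrow> complex^'n"
  assumes hol: "holo_germ \<Psi>" and fl: "\<And>j. flat 2 (\<lambda>z. \<Psi> z $ j - z $ j)"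
  shows "biholo_germ \<Psi>"
proof -
  have "\<forall>\<^sub>F z in nhds 0. \<forall>j. chol_at (\<lambda>z. \<Psi> z $ j) z" and \<Psi>0: "\<Psi> 0 = 0"
    using hol by (simp_all add: holo_germ_iff eventually_all_iff)
  then obtain S where S: "open S" "0 \<in> S" "\<And>z j. z \<in> S \<Longrightarrow> chol_at (\<lambda>z. \<Psi> z $ j) z"
    unfolding eventually_nhds by blast
  define P where "P j i = partial_deriv i (\<lambda>z. \<Psi> z $ j)" for j i
  define f' where "f' z = Blinfun (\<lambda>h::complex^'n. \<chi> j. \<Sum>i\<in>UNIV. P j i z * h $ i)" for z
  have der: "(\<Psi> has_derivative (\<lambda>h. \<chi> j. \<Sum>i\<in>UNIV. P j i z * h $ i)) (at z)" if "z \<in> S" for z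
    unfolding P_def by (rule has_derivative_vecI) (rule chol_at_partial_deriv[OF S(3)[OF that]])
  have lin: "linear (\<lambda>h::complex^'n. (\<chi> j. \<Sum>i\<in>UNIV. P j i z * h $ i) :: complex^'n)" for z
    by (rule linearI) (simp_all add: vec_eq_iff algebra_simps sum.distrib scaleR_sum_right)
  have f': "blinfun_apply (f' z) = (\<lambda>h. \<chi> j. \<Sum>i\<in>UNIV. P j i z * h $ i)" for z
    unfolding f'_def by (rule bounded_linear_Blinfun_apply) (use lin in \<open>simp add: linear_conv_bounded_linear\<close>)
  have contP: "continuous_on S (P j i)" for j i
    unfolding P_def
    by (intro continuous_at_imp_continuous_on ballI chol_at_continuous chol_at_partial[OF S(1)] S(3))
  have contf: "continuous_on S f'"
    by (rule continuous_on_blinfun_componentwise, unfold f')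
      (intro continuous_on_vec_lambda continuous_on_sum continuous_on_mult contP continuous_on_const)
  have P0: "P j i 0 = (if i = j then 1 else 0)" for i j
  proof -
    have c: "cgerm (\<lambda>z. \<Psi> z $ j)" using hol by (simp add: holo_germ_iff)
    then have c': "cgerm (\<lambda>z. \<Psi> z $ j - z $ j)"
      by eventually_elim (intro chol_at_diff chol_at_nth)
    have "flat (Suc 1) (\<lambda>z. \<Psi> z $ j - z $ j)" using fl[of j] by (simp add: numeral_2_eq_2)
    from flat_imp_jet_zero[OF c' this, of "[i]"]
    have "partial_deriv i (\<lambda>z. \<Psi> z $ j - z $ j) 0 = 0" by simp
    then show ?thesis
      using partial_deriv_diff[OF eventually_nhds_x_imp_x[OF c] chol_at_nth, of i j]
      by (simp add: P_def partial_deriv_nth)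
  qed
  have id: "id_blinfun o\<^sub>L f' 0 = id_blinfun"
    by (rule blinfun_eqI) (simp add: f' P0 vec_eq_iff if_distrib[of "\<lambda>x. x * _"] sum.delta cong: if_cong)
  obtain U' V g g' where g: "open U'" "U' \<subseteq> S" "0 \<in> U'" "open V" "\<Psi> 0 \<in> V" "homeomorphism U' V \<Psi> g"
    "\<And>y. y \<in> V \<Longrightarrow> (g has_derivative (g' y)) (at y)"
    "\<And>y. y \<in> V \<Longrightarrow> g' y = inv (blinfun_apply (f' (g y)))"
    "\<And>y. y \<in> V \<Longrightarrow> bij (blinfun_apply (f' (g y)))"
  proof (rule inverse_function_theorem[OF S(1) _ contf S(2) id])
    show "(\<Psi> has_derivative blinfun_apply (f' x)) (at x)" if "x \<in> S" for x
      using der[OF that] by (simp add: f')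
  qed blast
  have g0: "g 0 = 0" using g(3,6) \<Psi>0 by (metis homeomorphism_apply1)
  have "chol_at (\<lambda>z. g z $ j) y" if "y \<in> V" for y j
  proof (rule chol_atI)
    show "((\<lambda>z. g z $ j) has_derivative (\<lambda>h. g' y h $ j)) (at y)"
      by (rule bounded_linear.has_derivative[OF bounded_linear_vec_nth g(7)[OF that]])
    fix a h
    have "g' y (a *s h) = a *s g' y h"
      unfolding g(8)[OF that] 
      by (rule inverse_linear_smult[OF g(9)[OF that]])
         (simp add: f' vec_eq_iff sum_distrib_left mult.left_commute)
    then show "g' y (a *s h) $ j = a * g' y h $ j" by simp
  qed
  then have "holo_germ g"
    using g(4,5) g0 \<Psi>0 by (auto simp: holo_germ_iff eventually_nhds)
  moreover have "\<forall>\<^sub>F z in nhds 0. g (\<Psi> z) = z"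
    using g(1,3,6) by (auto simp: eventually_nhds homeomorphism_def)
  moreover have "\<forall>\<^sub>F z in nhds 0. \<Psi> (g z) = z"
    using g(4,5,6) \<Psi>0 by (auto simp: eventually_nhds homeomorphism_def)
  ultimately show ?thesis using hol unfolding biholo_germ_def inverse_germs_def by blast
qed

lemma holo_germ_isCont:
  fixes f :: "complex^'n \<Rightarrow> complex^'p"
  assumes "holo_germ f" shows "isCont f 0"
proof -
  have "\<exists>J :: complex^'n^'p. (f has_derivative (\<lambda>h. J *v h)) (at 0)"
    using assms eventually_nhds_x_imp_x unfolding holo_germ_def by fast
  then show ?thesis by (elim exE) (rule has_derivative_continuous)
qed

lemma holo_germ_tendsto:
  fixes f :: "complex^'n \<Rightarrow> complex^'p"
  assumes "holo_germ f" shows "(f \<longlongrightarrow> 0) (nhds 0)"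
proof -
  have "isCont f 0" by (rule holo_germ_isCont[OF assms])
  then show ?thesis
    using assms tendsto_at_iff_tendsto_nhds[of f 0] by (simp add: isCont_def holo_germ_def)
qed

lemma holo_germ_eventually:
  assumes "holo_germ f" "\<forall>\<^sub>F w in nhds 0. P w"
  shows "\<forall>\<^sub>F z in nhds 0. P (f z)"
  using filterlim_iff[THEN iffD1, OF holo_germ_tendsto[OF assms(1)]] assms(2) by blast

lemma cgerm_compose:
  assumes "holo_germ f" "cgerm u" shows "cgerm (\<lambda>z. u (f z))"
proof -
  have "\<forall>\<^sub>F z in nhds 0. \<forall>j. chol_at (\<lambda>z. f z $ j) z"
    using assms(1) by (simp add: holo_germ_iff eventually_all_iff)
  with holo_germ_eventually[OF assms] show ?thesis
    by eventually_elim (rule chol_at_compose, auto)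
qed

lemma holo_germ_compose:
  assumes "holo_germ f" "holo_germ g" shows "holo_germ (\<lambda>z. g (f z))"
  using assms cgerm_compose[OF assms(1)] by (auto simp: holo_germ_iff)

lemma inverse_germs_sym: "inverse_germs \<rho> \<sigma> \<Longrightarrow> inverse_germs \<sigma> \<rho>"
  by (auto simp: inverse_germs_def)

lemma inverse_germs_id: "inverse_germs (\<lambda>z. z) (\<lambda>z. z)"
  by (simp add: inverse_germs_def holo_germ_iff)

lemma inverse_germs_compose:
  assumes "inverse_germs \<phi> \<phi>'" "inverse_germs \<psi> \<psi>'"
  shows "inverse_germs (\<lambda>z. \<psi> (\<phi> z)) (\<lambda>z. \<phi>' (\<psi>' z))"
proof -
  have h: "holo_germ \<phi>" "holo_germ \<phi>'" "holo_germ \<psi>" "holo_germ \<psi>'"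
    and e: "\<forall>\<^sub>F z in nhds 0. \<phi>' (\<phi> z) = z" "\<forall>\<^sub>F z in nhds 0. \<phi> (\<phi>' z) = z"
      "\<forall>\<^sub>F z in nhds 0. \<psi>' (\<psi> z) = z" "\<forall>\<^sub>F z in nhds 0. \<psi> (\<psi>' z) = z"
    using assms by (auto simp: inverse_germs_def)
  have "\<forall>\<^sub>F z in nhds 0. \<phi>' (\<psi>' (\<psi> (\<phi> z))) = z"
    using e(1) holo_germ_eventually[OF h(1) e(3)] by eventually_elim simp
  moreover have "\<forall>\<^sub>F z in nhds 0. \<psi> (\<phi> (\<phi>' (\<psi>' z))) = z"
    using e(4) holo_germ_eventually[OF h(4) e(2)] by eventually_elim simp
  ultimately show ?thesis
    using h by (auto simp: inverse_germs_def intro: holo_germ_compose)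
qed

lemma biholo_germ_compose:
  "biholo_germ \<phi> \<Longrightarrow> biholo_germ \<psi> \<Longrightarrow> biholo_germ (\<lambda>z. \<psi> (\<phi> z))"
  unfolding biholo_germ_def by (blast intro: inverse_germs_compose)

lemma norm_vec_le_sum: "norm (x :: complex^'n) \<le> (\<Sum>i\<in>UNIV. norm (x $ i))"
  unfolding norm_vec_def by (rule L2_set_le_sum) simp

lemma eventually_norm_less:
  "e > 0 \<Longrightarrow> \<forall>\<^sub>F z in nhds (0::'a::real_normed_vector). norm z < e"
  unfolding eventually_nhds_metric by (auto simp: dist_norm)

lemma cgerm_lipschitz:
  fixes u :: "complex^'n \<Rightarrow> complex"
  assumes "cgerm u"
  shows "\<exists>L. \<forall>\<^sub>F p in nhds 0 \<times>\<^sub>F nhds 0. norm (u (fst p) - u (snd p)) \<le> L * norm (fst p - snd p)"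
proof -
  define b where "b z = (\<Sum>i\<in>UNIV. norm (partial_deriv i u z))" for z
  have "(b \<longlongrightarrow> b 0) (nhds 0)"
    using isCont_partial_norms[OF assms] tendsto_at_iff_tendsto_nhds[of b 0]
    by (simp add: isCont_def b_def[abs_def])
  then have "\<forall>\<^sub>F z in nhds 0. b z < b 0 + 1" by (rule order_tendstoD) simp
  with assms have "\<forall>\<^sub>F z in nhds 0. chol_at u z \<and> b z < b 0 + 1" by eventually_elim simp
  then obtain \<epsilon> where \<epsilon>: "\<epsilon> > 0" "\<And>z. norm z < \<epsilon> \<Longrightarrow> chol_at u z \<and> b z < b 0 + 1"
    unfolding eventually_nhds_metric by (auto simp: dist_norm)
  have "norm (u z - u w) \<le> (b 0 + 1) * norm (z - w)" if "norm z < \<epsilon>" "norm w < \<epsilon>" for z w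
  proof (rule partial_deriv_bound[of "ball 0 \<epsilon>"])
    fix x :: "complex^'n" assume "x \<in> ball 0 \<epsilon>"
    then show "chol_at u x" "(\<Sum>i\<in>UNIV. norm (partial_deriv i u x)) \<le> b 0 + 1"
      using \<epsilon>(2)[of x] by (simp_all add: b_def)
  qed (use that in auto)
  then show ?thesis
    using eventually_norm_less[OF \<epsilon>(1), where 'a="complex^'n"]
    by (intro exI[of _ "b 0 + 1"]) (auto simp: eventually_prod_filter)
qed

lemma holo_germ_lipschitz:
  fixes f :: "complex^'n \<Rightarrow> complex^'p"
  assumes "holo_germ f"
  obtains L where "L \<ge> 0"
    "\<forall>\<^sub>F p in nhds 0 \<times>\<^sub>F nhds 0. norm (f (fst p) - f (snd p)) \<le> L * norm (fst p - snd p)"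
proof -
  have "\<forall>j. \<exists>L. \<forall>\<^sub>F p in nhds 0 \<times>\<^sub>F nhds 0. norm (f (fst p) $ j - f (snd p) $ j) \<le> L * norm (fst p - snd p)"
    using assms by (intro allI cgerm_lipschitz) (simp add: holo_germ_iff)
  from choice[OF this] obtain L
    where "\<forall>\<^sub>F p in nhds 0 \<times>\<^sub>F nhds 0. \<forall>j. norm (f (fst p) $ j - f (snd p) $ j) \<le> L j * norm (fst p - snd p)"
    unfolding eventually_all_iff ..
  then have "\<forall>\<^sub>F p in nhds 0 \<times>\<^sub>F nhds 0. norm (f (fst p) - f (snd p)) \<le> \<bar>\<Sum>j\<in>UNIV. L j\<bar> * norm (fst p - snd p)"
  proof eventually_elim
    case (elim p)
    have "norm (f (fst p) - f (snd p)) \<le> (\<Sum>j\<in>UNIV. L j * norm (fst p - snd p))"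
      by (rule order_trans[OF norm_vec_le_sum sum_mono]) (use elim in simp)
    also have "\<dots> \<le> \<bar>\<Sum>j\<in>UNIV. L j\<bar> * norm (fst p - snd p)"
      unfolding sum_distrib_right[symmetric] by (intro mult_right_mono) auto
    finally show ?case .
  qed
  then show thesis by (rule that[rotated]) simp
qed

text \<open>The order 2 demanded of \<open>H\<close> is what makes the identity plus
  \<open>H\<close> invertible; \<open>N\<close> is uniform in \<open>h\<close>, as finite
  determinacy requires.\<close>

definition left_determined :: "(complex^'n \<Rightarrow> complex^'p) \<Rightarrow> bool" where
  "left_determined F \<longleftrightarrow> (\<exists>N. \<forall>h. cgerm h \<longrightarrow> flat (Suc N) h \<longrightarrow>
     (\<exists>H. cgerm H \<and> flat 2 H \<and> (\<forall>\<^sub>F z in nhds 0. h z = H (F z))))"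

lemma flat_vec:
  fixes u :: "complex^'n \<Rightarrow> complex^'p"
  assumes "\<And>j. flat N (\<lambda>z. u z $ j)"
  shows "flat N u"
proof (rule flat_le[OF flat_sum])
  show "flat N (\<lambda>z. norm (u z $ j))" for j by (rule flat_norm[OF assms])
  show "norm (u z) \<le> norm (\<Sum>j\<in>UNIV. norm (u z $ j))" for z
    by (rule order_trans[OF norm_vec_le_sum]) simp
qed

lemma same_jet_flat:
  assumes "holo_germ f" "holo_germ g" "same_jet r f g"
  shows "flat (Suc r) (\<lambda>z. g z - f z)"
proof (rule flat_vec)
  fix j
  have c: "cgerm (\<lambda>z. g z $ j)" "cgerm (\<lambda>z. f z $ j)"
    using assms(1,2) by (simp_all add: holo_germ_iff)
  have "flat (Suc r) (\<lambda>z. g z $ j - f z $ j)"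
  proof (rule jet_zero_imp_flat)
    show "cgerm (\<lambda>z. g z $ j - f z $ j)"
      using c by eventually_elim (rule chol_at_diff)
    show "foldr partial_deriv is (\<lambda>z. g z $ j - f z $ j) 0 = 0" if "length is \<le> r" for "is"
      using eventually_nhds_x_imp_x[OF foldr_partial_diff[OF c, of "is"]] assms(3) that
      by (simp add: same_jet_def)
  qed
  then show "flat (Suc r) (\<lambda>z. (g z - f z) $ j)" by simp
qed

text \<open>Lipschitz bounds for \<open>\<psi>\<close> and \<open>\<sigma>\<close> carry the order
  of contact through changes of coordinates without a chain rule for higher jets.\<close>

lemma flat_sandwich:
  fixes f g :: "complex^'n \<Rightarrow> complex^'p" and \<psi> :: "complex^'p \<Rightarrow> complex^'q"
    and \<sigma> :: "complex^'m \<Rightarrow> complex^'n"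
  assumes "holo_germ f" "holo_germ g" "holo_germ \<psi>" "holo_germ \<sigma>" "flat (Suc r) (\<lambda>z. g z - f z)"
  shows "flat (Suc r) (\<lambda>z. \<psi> (g (\<sigma> z)) - \<psi> (f (\<sigma> z)))"
proof -
  have "isCont (\<lambda>z. g z - f z) 0"
    using holo_germ_isCont[OF assms(1)] holo_germ_isCont[OF assms(2)] by (intro continuous_intros)
  from flatE_nhds[OF assms(5) this] obtain C \<epsilon> where C: "C \<ge> 0" "\<epsilon> > 0"
    "\<And>z. norm z < \<epsilon> \<Longrightarrow> norm (g z - f z) \<le> C * norm z ^ Suc r" by blast
  obtain L where L: "L \<ge> 0" "\<forall>\<^sub>F p in nhds 0 \<times>\<^sub>F nhds 0. norm (\<psi> (fst p) - \<psi> (snd p)) \<le> L * norm (fst p - snd p)"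
    using assms(3) by (rule holo_germ_lipschitz)
  obtain K where K: "K \<ge> 0" "\<forall>\<^sub>F p in nhds 0 \<times>\<^sub>F nhds 0. norm (\<sigma> (fst p) - \<sigma> (snd p)) \<le> K * norm (fst p - snd p)"
    using assms(4) by (rule holo_germ_lipschitz)
  note lim = holo_germ_tendsto[OF holo_germ_compose[OF assms(4,2)]] holo_germ_tendsto[OF holo_germ_compose[OF assms(4,1)]]
  have "\<forall>\<^sub>F z in nhds 0. norm (\<sigma> z - \<sigma> 0) \<le> K * norm (z - 0)"
    using eventually_compose_filterlim[OF K(2) filterlim_Pair[OF filterlim_ident tendsto_const]] by simp
  moreover have "\<forall>\<^sub>F z in nhds 0. norm (\<psi> (g (\<sigma> z)) - \<psi> (f (\<sigma> z))) \<le> L * norm (g (\<sigma> z) - f (\<sigma> z))"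
    using eventually_compose_filterlim[OF L(2) filterlim_Pair[OF lim]] by simp
  ultimately have "\<forall>\<^sub>F z in nhds 0. norm (\<psi> (g (\<sigma> z)) - \<psi> (f (\<sigma> z))) \<le> L * (C * K ^ Suc r) * norm z ^ Suc r"
    using holo_germ_eventually[OF assms(4) eventually_norm_less[OF C(2)]]
  proof eventually_elim
    case (elim z)
    have \<sigma>: "norm (\<sigma> z) \<le> K * norm z" using elim(1) assms(4) by (simp add: holo_germ_def)
    note elim(2)
    also have "L * norm (g (\<sigma> z) - f (\<sigma> z)) \<le> L * (C * norm (\<sigma> z) ^ Suc r)"
      using C(3) elim L(1) by (intro mult_left_mono) auto
    also have "\<dots> \<le> L * (C * (K * norm z) ^ Suc r)"
      using \<sigma> L(1) C(1) by (intro mult_left_mono power_mono) auto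
    finally show ?case by (simp add: power_mult_distrib mult_ac)
  qed
  then show ?thesis unfolding flat_def
    by (intro exI[of _ "L * (C * K ^ Suc r)"]) (simp add: eventually_at_filter eventually_mono)
qed

text \<open>After the coordinate changes that turn \<open>f\<close> into \<open>F\<close>, a germ
  with the same jet becomes \<open>F\<close> plus a flat germ. Writing the latter componentwise as
  \<open>H\<close> after \<open>F\<close> turns the sum into one biholomorphism applied to
  \<open>F\<close>. The given source change then cancels, so the equivalence of \<open>g\<close> and
  \<open>f\<close> is witnessed with the identity in the source.\<close>

lemma left_determined_imp_A_finite:
  fixes f F :: "complex^'n \<Rightarrow> complex^'p"
  assumes "holo_germ f" "A_equivalent f F" "left_determined F"
  shows "A_finite f"
proof -
  obtain \<rho> \<sigma> \<psi> \<psi>' where \<rho>: "inverse_germs \<rho> \<sigma>" and \<psi>: "inverse_germs \<psi> \<psi>'"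
    and F: "\<forall>\<^sub>F z in nhds 0. F z = \<psi> (f (\<sigma> z))"
    using assms(2) unfolding A_equivalent_def biholo_germ_def by blast
  have hol: "holo_germ \<rho>" "holo_germ \<sigma>" "holo_germ \<psi>" "holo_germ \<psi>'"
    using \<rho> \<psi> by (auto simp: inverse_germs_def)
  obtain N where N: "\<And>h. cgerm h \<Longrightarrow> flat (Suc N) h \<Longrightarrow>
      \<exists>H. cgerm H \<and> flat 2 H \<and> (\<forall>\<^sub>F z in nhds 0. h z = H (F z))"
    using assms(3) unfolding left_determined_def by blast
  have "A_equivalent g f" if g: "holo_germ g" "same_jet N f g" for g
  proof -
    define h where "h j z = \<psi> (g (\<sigma> z)) $ j - \<psi> (f (\<sigma> z)) $ j" for j z
    have "\<exists>H. cgerm H \<and> flat 2 H \<and> (\<forall>\<^sub>F z in nhds 0. h j z = H (F z))" for j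
    proof (rule N)
      have "holo_germ (\<lambda>z. \<psi> (k (\<sigma> z)))" if "holo_germ k" for k
        using holo_germ_compose[OF holo_germ_compose[OF hol(2) that] hol(3)] .
      then have "cgerm (\<lambda>z. \<psi> (g (\<sigma> z)) $ j)" "cgerm (\<lambda>z. \<psi> (f (\<sigma> z)) $ j)"
        using g(1) assms(1) by (simp_all add: holo_germ_iff)
      then show "cgerm (h j)" unfolding h_def by eventually_elim (rule chol_at_diff)
      obtain C \<epsilon> where C: "C \<ge> 0" "\<epsilon> > 0" "\<And>z. z \<noteq> 0 \<Longrightarrow> norm z < \<epsilon> \<Longrightarrow>
          norm (\<psi> (g (\<sigma> z)) - \<psi> (f (\<sigma> z))) \<le> C * norm z ^ Suc N"
        using flat_sandwich[OF assms(1) g(1) hol(3,2) same_jet_flat[OF assms(1) g]] by (rule flatE) blast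
      show "flat (Suc N) (h j)"
      proof (rule flatI[OF C(2)])
        fix z :: "complex^'n" assume "z \<noteq> 0" "norm z < \<epsilon>"
        then show "norm (h j z) \<le> C * norm z ^ Suc N"
          using C(3)[of z] Finite_Cartesian_Product.norm_nth_le[of "\<psi> (g (\<sigma> z)) - \<psi> (f (\<sigma> z))" j]
          by (simp add: h_def)
      qed
    qed
    then obtain H where H: "\<And>j. cgerm (H j)" "\<And>j. flat 2 (H j)"
      "\<And>j. \<forall>\<^sub>F z in nhds 0. h j z = H j (F z)" by metis
    define \<Psi> where "\<Psi> W = (\<chi> j. W $ j + H j W)" for W
    have "H j 0 = 0" for j
      using flat_zero[of 1 "H j"] H(2)[of j] cgerm_isCont[OF H(1)] by (simp add: numeral_2_eq_2)
    then have \<Psi>h: "holo_germ \<Psi>"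
      unfolding holo_germ_iff \<Psi>_def
      by (auto simp: vec_eq_iff intro!: chol_at_add chol_at_nth eventually_mono[OF H(1)])
    have "biholo_germ \<Psi>"
      by (rule biholo_germ_near_id[OF \<Psi>h]) (simp add: \<Psi>_def H(2))
    then obtain \<Psi>' where \<Psi>': "inverse_germs \<Psi> \<Psi>'" unfolding biholo_germ_def by blast
    have "\<forall>\<^sub>F z in nhds 0. \<forall>j. h j z = H j (F z)" using H(3) by (simp add: eventually_all_iff)
    with F have "\<forall>\<^sub>F z in nhds 0. \<psi> (g (\<sigma> z)) = \<Psi> (\<psi> (f (\<sigma> z)))"
    proof eventually_elim
      case (elim z)
      have "\<psi> (g (\<sigma> z)) $ j = \<Psi> (F z) $ j" for j
        using elim(2)[rule_format, of j] by (simp add: h_def \<Psi>_def diff_eq_eq flip: elim(1))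
      then show ?case by (simp add: vec_eq_iff flip: elim(1))
    qed
    from holo_germ_eventually[OF hol(1) this]
    have "\<forall>\<^sub>F z in nhds 0. \<psi> (g z) = \<Psi> (\<psi> (f z))"
      using \<rho> unfolding inverse_germs_def by (auto elim: eventually_elim2)
    moreover have "\<forall>\<^sub>F z in nhds 0. \<psi>' (\<psi> (f z)) = f z"
      using holo_germ_eventually[OF assms(1)] \<psi> unfolding inverse_germs_def by blast
    moreover have "\<forall>\<^sub>F z in nhds 0. \<Psi>' (\<Psi> (\<psi> (f z))) = \<psi> (f z)"
      using holo_germ_eventually[OF holo_germ_compose[OF assms(1) hol(3)]] \<Psi>'
      unfolding inverse_germs_def by blast
    ultimately have "\<forall>\<^sub>F z in nhds 0. f z = \<psi>' (\<Psi>' (\<psi> (g z)))"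
      by eventually_elim simp
    moreover have "biholo_germ (\<lambda>z. \<psi>' (\<Psi>' (\<psi> z)))"
      using inverse_germs_compose[OF inverse_germs_compose[OF \<psi> inverse_germs_sym[OF \<Psi>']] inverse_germs_sym[OF \<psi>]]
      unfolding biholo_germ_def by blast
    ultimately show ?thesis
      unfolding A_equivalent_def using inverse_germs_id by blast
  qed
  then show ?thesis unfolding A_finite_def by blast
qed

section \<open>Determinacy of the normal forms\<close>

lemma flat_mult:
  fixes u v :: "complex^'n \<Rightarrow> complex"
  assumes "flat M u" "flat N v" shows "flat (M + N) (\<lambda>z. u z * v z)"
proof -
  obtain C D where "\<forall>\<^sub>F z in at 0. norm (u z) \<le> C * norm z ^ M" "\<forall>\<^sub>F z in at 0. norm (v z) \<le> D * norm z ^ N"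
    using assms unfolding flat_def by blast
  then have "\<forall>\<^sub>F z in at 0. norm (u z * v z) \<le> (C * D) * norm z ^ (M + N)"
  proof eventually_elim
    case (elim z)
    have "norm (u z) * norm (v z) \<le> (C * norm z ^ M) * (D * norm z ^ N)"
      using elim by (intro mult_mono) (auto intro: order_trans[OF norm_ge_zero])
    then show ?case by (simp add: norm_mult power_add mult_ac)
  qed
  then show ?thesis unfolding flat_def by blast
qed

lemma flat_nth_power: "flat k (\<lambda>z::complex^'n. z $ i ^ k)"
  by (rule flatI[of 1 _ 1])
     (auto simp: norm_power intro!: power_mono Finite_Cartesian_Product.norm_nth_le)

lemma flat_0_cgerm: "cgerm u \<Longrightarrow> flat 0 u"
proof -
  assume "cgerm u"
  then have "((\<lambda>z. norm (u z)) \<longlongrightarrow> norm (u 0)) (at 0)"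
    using cgerm_isCont[of u] by (intro tendsto_norm) (simp add: isCont_def)
  then have "\<forall>\<^sub>F z in at 0. norm (u z) < norm (u 0) + 1" by (rule order_tendstoD) simp
  then show ?thesis unfolding flat_def
    by (intro exI[of _ "norm (u 0) + 1"]) (auto elim: eventually_mono)
qed

lemma coord_vec_nth:
  "inj_on t {1..N} \<Longrightarrow> k \<in> {1..N} \<Longrightarrow> coord_vec N t c $ t k = c k"
  by (simp add: coord_vec_def the_inv_into_f_f)

lemma holo_germ_select: "holo_germ (\<lambda>W. \<chi> i. W $ \<tau> i)"
  by (simp add: holo_germ_iff vec_eq_iff)

lemma flat_select:
  fixes h :: "complex^'n \<Rightarrow> complex" and \<tau> :: "'n \<Rightarrow> 'p::finite"
  assumes "cgerm h" "flat (Suc N) h"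
  shows "flat (Suc N) (\<lambda>W. h (\<chi> i. W $ \<tau> i))"
proof -
  obtain C \<epsilon> where C: "C \<ge> 0" "\<epsilon> > 0" "\<And>z. norm z < \<epsilon> \<Longrightarrow> norm (h z) \<le> C * norm z ^ Suc N"
    using flatE_nhds[OF assms(2) cgerm_isCont[OF assms(1)]] by blast
  have "\<forall>\<^sub>F W in nhds 0. norm (h (\<chi> i. W $ \<tau> i)) \<le> C * real CARD('n) ^ Suc N * norm W ^ Suc N"
    using holo_germ_eventually[OF holo_germ_select[of \<tau>] eventually_norm_less[OF C(2)]]
  proof eventually_elim
    case (elim W)
    have "norm (\<chi> i. W $ \<tau> i :: complex^'n) \<le> real CARD('n) * norm W"
      by (rule order_trans[OF norm_vec_le_sum sum_bounded_above])
        (simp add: Finite_Cartesian_Product.norm_nth_le)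
    then have "C * norm (\<chi> i. W $ \<tau> i :: complex^'n) ^ Suc N \<le> C * (real CARD('n) * norm W) ^ Suc N"
      using C(1) by (intro mult_left_mono power_mono) auto
    then show ?case using C(3)[OF elim] by (simp add: power_mult_distrib mult_ac)
  qed
  then show ?thesis unfolding flat_def
    by (intro exI[of _ "C * real CARD('n) ^ Suc N"]) (simp add: eventually_at_filter eventually_mono)
qed

lemma the_inv_into_bij_betw:
  assumes "bij_betw s A UNIV"
  shows "the_inv_into A s i \<in> A" "s (the_inv_into A s i) = i"
  using the_inv_into_into[of s A i A] f_the_inv_into_f[of s A i] assms
  by (auto simp: bij_betw_def)

text \<open>Selecting \<open>n\<close> target coordinates inverts the immersion on its image, so
  \<open>h\<close> factors through itself after the selection; order 2 of \<open>h\<close> is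
  already order 2 of \<open>H\<close>, whence the bound 1.\<close>

lemma left_determined_immersion:
  fixes s :: "nat \<Rightarrow> 'n::finite" and t :: "nat \<Rightarrow> 'p::finite"
  assumes "bij_betw s {1..n} UNIV" "bij_betw t {1..2 * n} UNIV"
  shows "left_determined (immersion_form n s t)"
  unfolding left_determined_def
proof (intro exI[of _ 1] allI impI)
  fix h :: "complex^'n \<Rightarrow> complex" assume h: "cgerm h" "flat (Suc 1) h"
  define idx where "idx = the_inv_into {1..n} s"
  have idx: "idx i \<in> {1..n}" "s (idx i) = i" for i
    unfolding idx_def by (rule the_inv_into_bij_betw[OF assms(1)])+
  define H where "H = (\<lambda>W. h (\<chi> i. W $ t (idx i)))"
  have "(\<chi> i. immersion_form n s t z $ t (idx i)) = z" for z
  proof -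
    have "immersion_form n s t z $ t (idx i) = z $ i" for i
      unfolding immersion_form_def
      using idx[of i] by (subst coord_vec_nth[OF bij_betw_imp_inj_on[OF assms(2)]]) auto
    then show ?thesis by (simp add: vec_eq_iff)
  qed
  then have "h z = H (immersion_form n s t z)" for z by (simp add: H_def)
  moreover have "cgerm H" unfolding H_def by (rule cgerm_compose[OF holo_germ_select h(1)])
  moreover have "flat 2 H" unfolding H_def using flat_select[OF h] by (simp add: numeral_2_eq_2)
  ultimately show "\<exists>H. cgerm H \<and> flat 2 H \<and> (\<forall>\<^sub>F z in nhds 0. h z = H (immersion_form n s t z))"
    by auto
qed

text \<open>\<open>x\<close> inverts \<open>m2\<close> modulo \<open>m1\<close>, so \<open>q\<close>
  makes \<open>q * m2\<close> congruent to \<open>N\<close>; being below \<open>m1\<close>, it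
  leaves a nonnegative multiple of \<open>m1\<close>. The product bound is cruder than the Frobenius
  bound but sufficient.\<close>

lemma coprime_semigroup:
  fixes m1 m2 N :: nat
  assumes "coprime m1 m2" "m1 > 0" "m2 > 0" "N \<ge> m1 * m2"
  obtains p q where "N = p * m1 + q * m2"
proof -
  obtain x y where x: "m2 * x = m1 * y + 1"
    using bezout_nat[of m2 m1] assms(1,3) by (auto simp: gcd.commute)
  define q where "q = (N * x) mod m1"
  have "q < m1" using assms(2) by (simp add: q_def)
  then have "q * m2 \<le> m1 * m2" by simp
  then have le: "q * m2 \<le> N" using assms(4) by linarith
  have "q * m2 mod m1 = N * (m2 * x) mod m1"
    unfolding q_def using mod_mult_left_eq[of "N * x" m1 m2] by (simp only: mult_ac)
  also have "\<dots> = N mod m1" unfolding x using mod_mult_self2[of N m1 "N * y"] by (simp add: distrib_left mult.left_commute)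
  finally have "m1 dvd N - q * m2"
    using le mod_eq_dvd_iff_nat[of "q * m2" N m1] by simp
  then obtain p where "N - q * m2 = m1 * p" by blast
  then have "N = p * m1 + q * m2" using le by (simp add: mult.commute)
  then show thesis by (rule that)
qed

text \<open>The identity behind the remainder is
  \<open>x ^ (l * b) * y ^ b = (x ^ l * y) ^ b\<close>: a coefficient of \<open>y ^ b\<close>
  divisible by a high enough power of some \<open>x\<close> can trade \<open>y\<close> for the
  corresponding mixed component. The quotient is first split by exponents modulo \<open>m1\<close>,
  because the projection \<open>pr\<close> of \<open>F\<close> sees \<open>y\<close> only as
  \<open>y ^ m1\<close>.\<close>

lemma left_determined_singular:
  fixes s :: "nat \<Rightarrow> 'n::finite" and t :: "nat \<Rightarrow> 'p::finite"
  assumes n: "n \<ge> 2" and s: "bij_betw s {1..n} UNIV" and t: "bij_betw t {1..2 * n} UNIV"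
    and m: "m1 > 0" "m2 > 0" "coprime m1 m2"
  shows "left_determined (singular_form n s t m1 m2 l)"
proof -
  define idx where "idx = the_inv_into {1..n} s"
  have idx: "idx i \<in> {1..n}" "s (idx i) = i" for i
    unfolding idx_def by (rule the_inv_into_bij_betw[OF s])+
  define y where "y = s n"
  have idxy: "idx y = n"
    using s n by (auto simp: idx_def y_def bij_betw_def intro!: the_inv_into_f_f)
  have idx_less: "idx i < n" if "i \<noteq> y" for i
    using idx[of i] that by (auto simp: y_def intro: le_neq_trans)
  let ?F = "singular_form n s t m1 m2 l"
  have F: "?F z $ t k = (if k < n then z $ s k else if k = n then z $ y ^ m1
      else if k = n + 1 then z $ y ^ m2
      else z $ s (k - (n + 1)) ^ l (k - (n + 1)) * z $ y)" if "k \<in> {1..2 * n}" for k z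
    unfolding singular_form_def y_def
    by (rule coord_vec_nth[OF bij_betw_imp_inj_on[OF t] that])
  define pr :: "complex^'p \<Rightarrow> complex^'n" where "pr W = (\<chi> i. W $ t (idx i))" for W
  have pr: "holo_germ pr" unfolding pr_def by (rule holo_germ_select)
  have prF: "pr (?F z) = upd z y (z $ y ^ m1)" for z
  proof -
    have "?F z $ t (idx i) = (if i = y then z $ y ^ m1 else z $ i)" for i
      using idx[of i] idxy idx_less[of i] n by (subst F) auto
    then show ?thesis by (simp add: pr_def vec_eq_iff upd_nth)
  qed
  define V where "V i = t (n + 1 + idx i)" for i
  have FV: "?F z $ V i = z $ i ^ l (idx i) * z $ y" if "i \<noteq> y" for z i
    unfolding V_def using idx[of i] idx_less[OF that] by (subst F) auto
  have F1: "?F z $ t n = z $ y ^ m1" and F2: "?F z $ t (n + 1) = z $ y ^ m2" for z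
    using n by (subst F; simp)+
  \<comment> \<open>From \<open>m1 * m2\<close> on every exponent lies in the semigroup; the extra
    \<open>2 * m1\<close> contributes two further factors, so that each term has order at least 2 in
    the target coordinates.\<close>
  define c where "c = m1 * m2 + 2 * m1"
  have "\<exists>p q. c + j = p * m1 + q * m2 \<and> p + q \<ge> 2" for j
  proof -
    obtain p q where "m1 * m2 + j = p * m1 + q * m2"
      using coprime_semigroup[OF m(3,1,2), of "m1 * m2 + j"] by auto
    then have "c + j = (p + 2) * m1 + q * m2" by (simp add: c_def algebra_simps)
    then show ?thesis by (intro exI[of _ "p + 2"] exI[of _ q]) auto
  qed
  then obtain p q where pq: "\<And>j. c + j = p j * m1 + q j * m2" "\<And>j. p j + q j \<ge> 2" by metis
  \<comment> \<open>\<open>l (idx i) * b\<close> converts \<open>y ^ b\<close> into a power of the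
    mixed component; the 2 left over supplies order 2 even for \<open>b = 0\<close>.\<close>
  define d where "d b i = l (idx i) * b + 2" for b i
  \<comment> \<open>The remainders lose fewer than \<open>c\<close> orders in the division by
    \<open>y ^ c\<close>, and \<open>d c i\<close> bounds \<open>d b i\<close> for every
    \<open>b\<close> below \<open>c\<close>.\<close>
  define N where "N = c + (\<Sum>i\<in>UNIV - {y}. d c i)"
  show ?thesis
    unfolding left_determined_def
  proof (intro exI[of _ N] allI impI)
    fix h :: "complex^'n \<Rightarrow> complex" assume h: "cgerm h" "flat (Suc N) h"
    obtain k r where k: "cgerm k" and r: "\<And>b. cgerm (r b)"
      and hk: "\<forall>\<^sub>F z in nhds 0. h z = z $ y ^ c * k z + (\<Sum>b<c. z $ y ^ b * r b z)"
      and ri: "\<And>b z w. r b (upd z y w) = r b z"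
      and fl: "\<And>N b. flat N h \<Longrightarrow> b \<le> N \<Longrightarrow> flat (N - b) (r b)"
      by (rule weierstrass_division[OF h(1), where i=y and c=c]) blast
    have "\<exists>Q. (\<forall>i\<in>UNIV - {y}. cgerm (Q i) \<and> (\<forall>j z w. j \<notin> UNIV - {y} \<longrightarrow> Q i (upd z j w) = Q i z)) \<and>
        (\<forall>\<^sub>F z in nhds 0. r b z = (\<Sum>i\<in>UNIV - {y}. z $ i ^ d b i * Q i z))" if b: "b < c" for b
    proof (rule hadamard_division)
      show "\<forall>j z w. j \<notin> UNIV - {y} \<longrightarrow> r b (upd z j w) = r b z" using ri by auto
      have "(\<Sum>i\<in>UNIV - {y}. d b i) \<le> (\<Sum>i\<in>UNIV - {y}. d c i)"
        using b by (intro sum_mono) (simp add: d_def)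
      then show "flat (Suc (\<Sum>i\<in>UNIV - {y}. d b i)) (r b)"
        using b by (intro flat_mono[OF fl[OF h(2)]]) (auto simp: N_def)
    qed (use r in auto)
    then have "\<forall>b. \<exists>Q. b < c \<longrightarrow> (\<forall>i\<in>UNIV - {y}. cgerm (Q i) \<and> (\<forall>j z w. j \<notin> UNIV - {y} \<longrightarrow> Q i (upd z j w) = Q i z)) \<and>
        (\<forall>\<^sub>F z in nhds 0. r b z = (\<Sum>i\<in>UNIV - {y}. z $ i ^ d b i * Q i z))" by blast
    from choice[OF this] obtain Q where Q0: "\<forall>b. b < c \<longrightarrow> (\<forall>i\<in>UNIV - {y}. cgerm (Q b i) \<and> (\<forall>j z w. j \<notin> UNIV - {y} \<longrightarrow> Q b i (upd z j w) = Q b i z)) \<and>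
        (\<forall>\<^sub>F z in nhds 0. r b z = (\<Sum>i\<in>UNIV - {y}. z $ i ^ d b i * Q b i z))" ..
    have Q: "\<And>b i. b < c \<Longrightarrow> i \<noteq> y \<Longrightarrow> cgerm (Q b i)"
      "\<And>b i z w. b < c \<Longrightarrow> i \<noteq> y \<Longrightarrow> Q b i (upd z y w) = Q b i z"
      "\<And>b. b < c \<Longrightarrow> \<forall>\<^sub>F z in nhds 0. r b z = (\<Sum>i\<in>UNIV - {y}. z $ i ^ d b i * Q b i z)"
      using Q0 by auto
    obtain K where K: "\<And>j. cgerm (K j)"
      "\<forall>\<^sub>F z in nhds 0. k z = (\<Sum>j<m1. z $ y ^ j * K j (upd z y (z $ y ^ m1)))"
      by (rule root_splitting[OF k m(1), where i=y]) blast
    define A where "A j W = W $ t n ^ p j * W $ t (n + 1) ^ q j * K j (pr W)" for j W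
    define B where "B b i W = W $ t (idx i) ^ 2 * W $ V i ^ b * Q b i (pr W)" for b i W
    define H where "H W = (\<Sum>j<m1. A j W) + (\<Sum>b<c. \<Sum>i\<in>UNIV - {y}. B b i W)" for W
    have cA: "cgerm (A j)" for j
      using cgerm_compose[OF pr K(1)[of j]] unfolding A_def
      by eventually_elim (intro chol_at_mult chol_at_power chol_at_nth)
    have cB: "cgerm (B b i)" if "b < c" "i \<noteq> y" for b i
      using cgerm_compose[OF pr Q(1)[OF that]] unfolding B_def
      by eventually_elim (intro chol_at_mult chol_at_power chol_at_nth)
    have "flat (p j + q j + 0) (A j)" for j
      unfolding A_def by (intro flat_mult flat_nth_power flat_0_cgerm cgerm_compose[OF pr K(1)])
    then have fA: "flat 2 (A j)" for j using pq(2)[of j] by (auto intro: flat_mono)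
    have "flat (2 + b + 0) (B b i)" if "b < c" "i \<noteq> y" for b i
      unfolding B_def by (intro flat_mult flat_nth_power flat_0_cgerm cgerm_compose[OF pr Q(1)[OF that]])
    then have fB: "flat 2 (B b i)" if "b < c" "i \<noteq> y" for b i by (rule flat_mono) (use that in auto)
    have "\<forall>\<^sub>F W in nhds 0. (\<forall>j\<in>{..<m1}. chol_at (A j) W) \<and> (\<forall>b\<in>{..<c}. \<forall>i\<in>UNIV - {y}. chol_at (B b i) W)"
      using cA cB by (intro eventually_conj eventually_ball_finite ballI) auto
    then have "cgerm H" unfolding H_def
      by eventually_elim (intro chol_at_add chol_at_sum, auto)
    moreover have "flat 2 H" unfolding H_def
      by (intro flat_add flat_sum fA fB) auto
    moreover have "\<forall>\<^sub>F z in nhds 0. \<forall>b\<in>{..<c}. r b z = (\<Sum>i\<in>UNIV - {y}. z $ i ^ d b i * Q b i z)"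
      using Q(3) by (intro eventually_ball_finite ballI) auto
    with hk K(2) have "\<forall>\<^sub>F z in nhds 0. h z = H (?F z)"
    proof eventually_elim
      case (elim z)
      have "A j (?F z) = z $ y ^ c * (z $ y ^ j * K j (upd z y (z $ y ^ m1)))" for j
      proof -
        have "(z $ y ^ m1) ^ p j * (z $ y ^ m2) ^ q j = z $ y ^ (p j * m1 + q j * m2)"
          by (simp add: power_add power_mult mult.commute)
        also have "\<dots> = z $ y ^ c * z $ y ^ j" by (simp add: power_add flip: pq(1))
        finally show ?thesis by (simp add: A_def F1 F2[unfolded Suc_eq_plus1[symmetric]] F2 prF mult.assoc)
      qed
      moreover have "B b i (?F z) = z $ y ^ b * (z $ i ^ d b i * Q b i z)" if "b < c" "i \<noteq> y" for b i
      proof -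
        have "?F z $ t (idx i) = z $ i" using idx[of i] idx_less[OF that(2)] by (subst F) auto
        moreover have "z $ i ^ d b i = (z $ i ^ l (idx i)) ^ b * z $ i ^ 2"
          by (simp only: d_def power_add power_mult)
        ultimately show ?thesis
          using that by (simp add: B_def FV prF Q(2) power_mult_distrib mult_ac)
      qed
      ultimately have "H (?F z) = z $ y ^ c * (\<Sum>j<m1. z $ y ^ j * K j (upd z y (z $ y ^ m1)))
          + (\<Sum>b<c. z $ y ^ b * (\<Sum>i\<in>UNIV - {y}. z $ i ^ d b i * Q b i z))"
        by (simp add: H_def sum_distrib_left)
      then show ?case using elim by simp
    qed
    ultimately show "\<exists>H. cgerm H \<and> flat 2 H \<and> (\<forall>\<^sub>F z in nhds 0. h z = H (?F z))" by blast
  qed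
qed

section \<open>Algebraic independence\<close>

text \<open>Polynomials are coefficient functions on exponent vectors bounded by \<open>D\<close> in
  each variable; extensionality of the vectors makes distinct indices distinct monomials.\<close>

definition alg_indep :: "'j set \<Rightarrow> ('j \<Rightarrow> complex) \<Rightarrow> bool" where
  "alg_indep J p \<longleftrightarrow> (\<forall>D. \<forall>c::('j \<Rightarrow> nat) \<Rightarrow> rat.
     (\<Sum>e\<in>J \<rightarrow>\<^sub>E {..D}. of_rat (c e) * (\<Prod>a\<in>J. p a ^ e a)) = 0 \<longrightarrow> (\<forall>e\<in>J \<rightarrow>\<^sub>E {..D}. c e = 0))"

text \<open>There are countably many rational coefficient families, each nonzero polynomial in the
  new variable has finitely many roots, and a disc is uncountable. If the polynomial is identically
  0, independence of the old values kills all its coefficients.\<close>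

lemma alg_indep_insert:
  assumes "finite J" "j \<notin> J" "alg_indep J p"
  obtains x where "alg_indep (insert j J) (p(j := x))"
proof -
  define E where "E D = J \<rightarrow>\<^sub>E {..D::nat}" for D
  define E' where "E' D = insert j J \<rightarrow>\<^sub>E {..D::nat}" for D
  define coef where "coef D c k = (\<Sum>g\<in>E D. of_rat (c (g(j := k))) * (\<Prod>a\<in>J. p a ^ g a))"
    for D k and c :: "('a \<Rightarrow> nat) \<Rightarrow> rat"
  define P where "P D c = (\<Sum>k\<le>D. monom (coef D c k) k)" for D c
  define Bad where "Bad = (\<Union>D. \<Union>c\<in>(E' D \<rightarrow>\<^sub>E UNIV) \<inter> {c. P D c \<noteq> 0}. {x. poly (P D c) x = 0})"
  have 1: "countable ((E' D \<rightarrow>\<^sub>E (UNIV :: rat set)) \<inter> {c. P D c \<noteq> 0})" for D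
  proof -
    have "finite (E' D)" using assms(1) by (simp add: E'_def finite_PiE)
    then have "countable (E' D \<rightarrow>\<^sub>E (UNIV :: rat set))" by (intro countable_PiE) auto
    then show ?thesis by (rule countable_Int1)
  qed
  have 2: "countable {x. poly (P D c) x = 0}" if "c \<in> (E' D \<rightarrow>\<^sub>E UNIV) \<inter> {c. P D c \<noteq> 0}" for D c
    using that by (intro countable_finite poly_roots_finite) auto
  have "countable Bad" unfolding Bad_def by (intro countable_UN 1 2) auto
  moreover have "uncountable (ball (0::complex) 1)" by (rule uncountable_ball) auto
  ultimately have "\<not> ball 0 1 \<subseteq> Bad" using countable_subset by blast
  then obtain x where x: "x \<notin> Bad" by auto
  have "alg_indep (insert j J) (p(j := x))"
    unfolding alg_indep_def
  proof (intro allI impI ballI)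
    fix D and c :: "('a \<Rightarrow> nat) \<Rightarrow> rat" and e
    assume 0: "(\<Sum>e\<in>insert j J \<rightarrow>\<^sub>E {..D}. of_rat (c e) * (\<Prod>a\<in>insert j J. (p(j := x)) a ^ e a)) = 0"
      and e: "e \<in> insert j J \<rightarrow>\<^sub>E {..D}"
    \<comment> \<open>\<open>c\<close> is arbitrary outside the index set; only its restriction
      ranges over a countable set.\<close>
    define c' where "c' = restrict c (E' D)"
    have upd: "g(j := k) \<in> E' D" if "g \<in> E D" "k \<le> D" for g k
      using that assms(2) by (auto simp: E_def E'_def PiE_iff extensional_def)
    have "(\<Sum>e\<in>insert j J \<rightarrow>\<^sub>E {..D}. of_rat (c e) * (\<Prod>a\<in>insert j J. (p(j := x)) a ^ e a)) =
        (\<Sum>(k, g)\<in>{..D} \<times> E D. of_rat (c (g(j := k))) * (\<Prod>a\<in>insert j J. (p(j := x)) a ^ (g(j := k)) a))"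
      unfolding PiE_insert_eq E_def
      by (subst sum.reindex[OF inj_combinator[OF assms(2)]]) (simp add: case_prod_unfold)
    also have "\<dots> = (\<Sum>(k, g)\<in>{..D} \<times> E D. x ^ k * (of_rat (c' (g(j := k))) * (\<Prod>a\<in>J. p a ^ g a)))"
    proof -
      have *: "of_rat (c (g(j := k))) * (\<Prod>a\<in>insert j J. (p(j := x)) a ^ (g(j := k)) a) =
          x ^ k * (of_rat (c' (g(j := k))) * (\<Prod>a\<in>J. p a ^ g a))" if kg: "k \<le> D" "g \<in> E D" for k g
      proof -
        have "(\<Prod>a\<in>J. (p(j := x)) a ^ (g(j := k)) a) = (\<Prod>a\<in>J. p a ^ g a)"
          using assms(2) by (intro prod.cong) auto
        then show ?thesis using assms(1,2) upd[of g k] kg by (simp add: c'_def)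
      qed
      show ?thesis unfolding case_prod_unfold by (intro sum.cong refl *) auto
    qed
    also have "\<dots> = (\<Sum>k\<le>D. x ^ k * coef D c' k)"
      by (simp add: sum.cartesian_product[symmetric] coef_def sum_distrib_left)
    also have "\<dots> = poly (P D c') x"
      by (simp add: P_def poly_sum poly_monom mult.commute)
    finally have "poly (P D c') x = 0" using 0 by simp
    moreover have "c' \<in> E' D \<rightarrow>\<^sub>E UNIV" by (simp add: c'_def)
    ultimately have "P D c' = 0" using x unfolding Bad_def by blast
    define g where "g = restrict e J"
    have g: "g \<in> E D" "e j \<le> D" "g(j := e j) = e"
      using e assms(2) by (auto simp: E_def g_def PiE_iff extensional_def fun_eq_iff)
    have "coeff (P D c') k = coef D c' k" if "k \<le> D" for k
      using that by (simp add: P_def coeff_sum)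
    then have "coef D c' (e j) = 0" using \<open>P D c' = 0\<close> g(2) by simp
    then have "\<forall>g\<in>E D. c' (g(j := e j)) = 0"
      using assms(3)[unfolded alg_indep_def, rule_format, of "\<lambda>g. c' (g(j := e j))" D]
      unfolding coef_def E_def by blast
    then have "c' e = 0" using g by metis
    then show "c e = 0" using e by (simp add: c'_def E'_def)
  qed
  then show thesis by (rule that)
qed

lemma alg_indep_exists:
  assumes "finite J" shows "\<exists>p. alg_indep J p"
  using assms
proof (induction J rule: finite_induct)
  case empty
  then show ?case by (simp add: alg_indep_def)
next
  case (insert j J)
  then show ?case by (metis alg_indep_insert)
qed

section \<open>Rational polynomials of bounded degree in finitely many numbers\<close>

interpretation rat_space: vector_space "\<lambda>(q::rat) (z::complex). of_rat q * z"
  by unfold_locales (simp_all add: algebra_simps of_rat_add of_rat_mult)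

text \<open>The degree is bounded in each variable separately, so the count is at most a pure power
  of \<open>Suc d\<close>, which suits the comparison of growth rates.\<close>

definition monomials :: "complex set \<Rightarrow> nat \<Rightarrow> complex set" where
  "monomials X d = (\<lambda>\<beta>. \<Prod>x\<in>X. x ^ \<beta> x) ` (X \<rightarrow>\<^sub>E {..d})"

definition rat_polys :: "complex set \<Rightarrow> nat \<Rightarrow> complex set" where
  "rat_polys X d = rat_space.span (monomials X d)"

lemma finite_monomials: "finite X \<Longrightarrow> finite (monomials X d)"
  by (simp add: monomials_def finite_PiE)

lemma card_monomials: "finite X \<Longrightarrow> card (monomials X d) \<le> Suc d ^ card X"
  unfolding monomials_def
  by (rule order_trans[OF card_image_le]) (simp_all add: finite_PiE card_PiE)

lemma monomials_mono: "d \<le> d' \<Longrightarrow> monomials X d \<subseteq> monomials X d'"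
  unfolding monomials_def by (intro image_mono PiE_mono) auto

lemma rat_polys_mono: "d \<le> d' \<Longrightarrow> rat_polys X d \<subseteq> rat_polys X d'"
  unfolding rat_polys_def by (intro rat_space.span_mono monomials_mono)

lemma monomials_mult:
  assumes "a \<in> monomials X d" "b \<in> monomials X d'"
  shows "a * b \<in> monomials X (d + d')"
proof -
  obtain \<alpha> \<beta> where *: "\<alpha> \<in> X \<rightarrow>\<^sub>E {..d}" "a = (\<Prod>x\<in>X. x ^ \<alpha> x)" "\<beta> \<in> X \<rightarrow>\<^sub>E {..d'}" "b = (\<Prod>x\<in>X. x ^ \<beta> x)"
    using assms by (auto simp: monomials_def)
  have "a * b = (\<Prod>x\<in>X. x ^ restrict (\<lambda>x. \<alpha> x + \<beta> x) X x)"
    unfolding * prod.distrib[symmetric] by (intro prod.cong) (simp_all add: power_add)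
  moreover have "restrict (\<lambda>x. \<alpha> x + \<beta> x) X \<in> X \<rightarrow>\<^sub>E {..d + d'}"
    using * by (auto simp: PiE_iff intro: add_mono)
  ultimately show ?thesis unfolding monomials_def by blast
qed

lemma rat_polys_mult:
  assumes "a \<in> rat_polys X d" "b \<in> rat_polys X d'"
  shows "a * b \<in> rat_polys X (d + d')"
proof -
  have 1: "m * b \<in> rat_polys X (d + d')" if m: "m \<in> monomials X d" for m
    using assms(2) unfolding rat_polys_def
  proof (induction rule: rat_space.span_induct_alt)
    case (step c x y)
    have "m * (of_rat c * x + y) = of_rat c * (m * x) + m * y" by (simp add: algebra_simps)
    then show ?case
      using rat_space.span_add[OF rat_space.span_scale[OF rat_space.span_base[OF monomials_mult[OF m step(1)]], of c] step(2)]
      by simp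
  qed (simp add: rat_space.span_zero)
  show ?thesis
    using assms(1) unfolding rat_polys_def
  proof (induction rule: rat_space.span_induct_alt)
    case (step c x y)
    have "(of_rat c * x + y) * b = of_rat c * (x * b) + y * b" by (simp add: algebra_simps)
    then show ?case
      using rat_space.span_add[OF rat_space.span_scale[OF 1[OF step(1), unfolded rat_polys_def], of c] step(2)]
      by simp
  qed (simp add: rat_space.span_zero)
qed

lemma one_rat_polys: "1 \<in> rat_polys X d"
proof -
  have "restrict (\<lambda>_. 0) X \<in> X \<rightarrow>\<^sub>E {..d}" by simp
  then have "(\<Prod>x\<in>X. x ^ restrict (\<lambda>_. 0) X x) \<in> monomials X d" unfolding monomials_def by blast
  moreover have "(\<Prod>x\<in>X. x ^ restrict (\<lambda>_. 0) X x) = 1" by (intro prod.neutral) simp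
  ultimately show ?thesis unfolding rat_polys_def by (auto intro: rat_space.span_base)
qed

lemma rat_polys_power: "a \<in> rat_polys X d \<Longrightarrow> a ^ k \<in> rat_polys X (k * d)"
  by (induction k) (auto intro: one_rat_polys rat_polys_mult)

lemma rat_polys_prod:
  assumes "finite J" "\<And>j. j \<in> J \<Longrightarrow> a j \<in> rat_polys X d"
  shows "(\<Prod>j\<in>J. a j) \<in> rat_polys X (card J * d)"
  using assms by (induction J rule: finite_induct) (auto intro: one_rat_polys rat_polys_mult)

text \<open>Perron's counting argument: the products of the \<open>p a\<close> with exponents at most \<open>D\<close> number
  \<open>(D + 1) ^ card J\<close>, but they lie in a rational vector space whose dimension grows only like
  \<open>D ^ card X\<close>.\<close>

lemma alg_indep_card_le:
  assumes fin: "finite X" "finite J" and ind: "alg_indep J p"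
    and p: "\<And>a. a \<in> J \<Longrightarrow> \<exists>d. p a \<in> rat_polys X d"
  shows "card J \<le> card X"
proof (rule ccontr)
  assume "\<not> card J \<le> card X"
  then have less: "card X < card J" by simp
  obtain d where d: "\<And>a. a \<in> J \<Longrightarrow> p a \<in> rat_polys X (d a)" using p by metis
  define \<delta> where "\<delta> = (\<Sum>a\<in>J. d a)"
  have \<delta>: "p a \<in> rat_polys X \<delta>" if "a \<in> J" for a
    using d[OF that] rat_polys_mono[of "d a" \<delta> X] member_le_sum[of a J d] that fin(2)
    by (auto simp: \<delta>_def)
  define K where "K = Suc (card J * \<delta>)"
  \<comment> \<open>One more than the degree is at most \<open>K * Suc D\<close>, so the spanning
    set has at most \<open>(K * Suc D) ^ card X\<close> elements. This choice turns
    \<open>K ^ card X\<close> into \<open>D\<close>, which keeps the bound below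
    \<open>Suc D ^ Suc (card X)\<close>.\<close>
  define D where "D = K ^ card X"
  define m where "m e = (\<Prod>a\<in>J. p a ^ e a)" for e
  let ?E = "J \<rightarrow>\<^sub>E {..D}"
  have finE: "finite ?E" using fin by (simp add: finite_PiE)
  have m: "m e \<in> rat_polys X (card J * (D * \<delta>))" if "e \<in> ?E" for e
    unfolding m_def
  proof (rule rat_polys_prod[OF fin(2)])
    fix a assume "a \<in> J"
    then have "e a \<le> D" using that by (auto simp: PiE_iff)
    then show "p a ^ e a \<in> rat_polys X (D * \<delta>)"
      using rat_polys_power[OF \<delta>[OF \<open>a \<in> J\<close>], of "e a"] rat_polys_mono[of "e a * \<delta>" "D * \<delta>" X] by auto
  qed
  have ind': "\<And>c. (\<Sum>e\<in>?E. of_rat (c e) * m e) = 0 \<Longrightarrow> \<forall>e\<in>?E. c e = 0"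
    using ind unfolding alg_indep_def m_def by blast
  have inj: "inj_on m ?E"
  proof (rule inj_onI, rule ccontr)
    fix e e' assume e: "e \<in> ?E" "e' \<in> ?E" "m e = m e'" "e \<noteq> e'"
    define c where "c x = (if x = e then 1 else if x = e' then -1 else (0::rat))" for x
    have "(\<Sum>x\<in>?E. of_rat (c x) * m x) = (\<Sum>x\<in>{e, e'}. of_rat (c x) * m x)"
      using e by (intro sum.mono_neutral_right finE) (auto simp: c_def)
    also have "\<dots> = 0" using e by (simp add: c_def of_rat_minus)
    finally show False using ind'[of c] e(1) by (auto simp: c_def)
  qed
  have "rat_space.independent (m ` ?E)"
  proof (rule rat_space.independent_if_scalars_zero)
    fix c x assume c: "(\<Sum>x\<in>m ` ?E. of_rat (c x) * x) = 0" and x: "x \<in> m ` ?E"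
    have "(\<Sum>e\<in>?E. of_rat (c (m e)) * m e) = 0"
      using c by (simp add: sum.reindex[OF inj])
    from ind'[OF this] show "c x = 0" using x by blast
  qed (simp add: finE)
  moreover have "m ` ?E \<subseteq> rat_space.span (monomials X (card J * (D * \<delta>)))"
    using m unfolding rat_polys_def by blast
  ultimately have "card (m ` ?E) \<le> card (monomials X (card J * (D * \<delta>)))"
    using rat_space.independent_span_bound[OF finite_monomials[OF fin(1)]] by blast
  then have "Suc D ^ card J \<le> Suc (card J * (D * \<delta>)) ^ card X"
    using card_monomials[OF fin(1), of "card J * (D * \<delta>)"] fin(2)
    by (simp add: card_image[OF inj] card_PiE)
  also have "\<dots> \<le> (K * Suc D) ^ card X"
    by (intro power_mono) (auto simp: K_def algebra_simps)
  also have "\<dots> = D * Suc D ^ card X"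
    unfolding power_mult_distrib by (simp only: D_def)
  also have "Suc D ^ card J = Suc D ^ (card J - card X) * Suc D ^ card X"
    using less by (simp only: power_add[symmetric]) simp
  finally have "Suc D ^ (card J - card X) \<le> D" by (simp del: power_Suc)
  moreover have "Suc D ^ 1 \<le> Suc D ^ (card J - card X)"
    using less by (intro power_increasing) auto
  ultimately show False by simp
qed

text \<open>Closure hides the degree bookkeeping; the instance used is the union of the
  \<open>rat_polys X d\<close>. It provides inverses of integers only, so any other inverse must be
  listed among the generators.\<close>

definition rat_algebra :: "complex set \<Rightarrow> bool" where
  "rat_algebra R \<longleftrightarrow> (\<forall>q. of_rat q \<in> R) \<and> (\<forall>a\<in>R. \<forall>b\<in>R. a + b \<in> R \<and> a * b \<in> R)"

lemma rat_algebra_closed: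
  assumes "rat_algebra R"
  shows "0 \<in> R" "1 \<in> R" "of_nat k \<in> R" "a \<in> R \<Longrightarrow> b \<in> R \<Longrightarrow> a + b \<in> R" "a \<in> R \<Longrightarrow> b \<in> R \<Longrightarrow> a * b \<in> R"
    "a \<in> R \<Longrightarrow> - a \<in> R" "(\<And>i. i \<in> A \<Longrightarrow> g i \<in> R) \<Longrightarrow> (\<Sum>i\<in>A. g i) \<in> R" "a \<in> R \<Longrightarrow> a ^ k \<in> R"
    "inverse (of_nat k) \<in> R"
proof -
  have q: "of_rat q \<in> R" for q using assms by (simp add: rat_algebra_def)
  show 0: "0 \<in> R" and 1: "1 \<in> R" and "of_nat k \<in> R" and "inverse (of_nat k) \<in> R"
    using q[of 0] q[of 1] q[of "of_nat k"] q[of "inverse (of_nat k)"] by (simp_all add: of_rat_inverse)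
  show add: "a \<in> R \<Longrightarrow> b \<in> R \<Longrightarrow> a + b \<in> R" and mult: "a \<in> R \<Longrightarrow> b \<in> R \<Longrightarrow> a * b \<in> R" for a b
    using assms by (auto simp: rat_algebra_def)
  show "a \<in> R \<Longrightarrow> - a \<in> R" using mult[OF q[of "-1"], of a] by (simp add: of_rat_minus)
  show "a \<in> R \<Longrightarrow> a ^ k \<in> R" by (induction k) (auto intro: 1 mult)
  show "(\<And>i. i \<in> A \<Longrightarrow> g i \<in> R) \<Longrightarrow> (\<Sum>i\<in>A. g i) \<in> R"
    by (induction A rule: infinite_finite_induct) (auto intro: 0 add)
qed

lemma rat_algebra_rat_polys:
  assumes "finite X"
  shows "rat_algebra (\<Union>d. rat_polys X d)" "X \<subseteq> (\<Union>d. rat_polys X d)"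
proof -
  have "of_rat q * 1 \<in> rat_polys X 0" for q
    using one_rat_polys[of X 0] unfolding rat_polys_def by (rule rat_space.span_scale)
  moreover have "a + b \<in> (\<Union>d. rat_polys X d)" if "a \<in> rat_polys X d" "b \<in> rat_polys X d'" for a b d d'
    using that rat_polys_mono[of d "d + d'" X] rat_polys_mono[of d' "d + d'" X]
      rat_space.span_add[of a "monomials X (d + d')" b]
    unfolding rat_polys_def by auto
  ultimately show "rat_algebra (\<Union>d. rat_polys X d)"
    unfolding rat_algebra_def using rat_polys_mult by fastforce
  show "X \<subseteq> (\<Union>d. rat_polys X d)"
  proof
    fix x assume x: "x \<in> X"
    define \<beta> where "\<beta> = restrict (\<lambda>z. if z = x then 1 else 0::nat) X"
    have "(\<Prod>z\<in>X. z ^ \<beta> z) = (\<Prod>z\<in>X. if z = x then z else 1)"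
      by (intro prod.cong) (auto simp: \<beta>_def)
    also have "\<dots> = x" using x assms by (simp add: prod.delta)
    finally have "x = (\<Prod>z\<in>X. z ^ \<beta> z)" by simp
    moreover have "\<beta> \<in> X \<rightarrow>\<^sub>E {..1}" by (auto simp: \<beta>_def)
    ultimately have "x \<in> monomials X 1" unfolding monomials_def by blast
    then show "x \<in> (\<Union>d. rat_polys X d)"
      unfolding rat_polys_def using rat_space.span_base by blast
  qed
qed

text \<open>Truncated at \<open>K\<close> because only finitely many coefficients of a curve can
  serve as generators; the coefficients of a product up to degree \<open>K\<close> involve no
  others.\<close>

definition coeffs_in :: "complex set \<Rightarrow> nat \<Rightarrow> complex fps \<Rightarrow> bool" where
  "coeffs_in R K F \<longleftrightarrow> (\<forall>e\<le>K. fps_nth F e \<in> R)"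

lemma coeffs_in_closed:
  assumes "rat_algebra R"
  shows "c \<in> R \<Longrightarrow> coeffs_in R K (fps_const c)" "coeffs_in R K 1" "coeffs_in R K 0"
    "coeffs_in R K F \<Longrightarrow> coeffs_in R K G \<Longrightarrow> coeffs_in R K (F + G)"
    "coeffs_in R K F \<Longrightarrow> coeffs_in R K G \<Longrightarrow> coeffs_in R K (F * G)"
    "coeffs_in R K F \<Longrightarrow> coeffs_in R K (F ^ k)"
    "(\<And>i. i \<in> A \<Longrightarrow> coeffs_in R K (g i)) \<Longrightarrow> coeffs_in R K (\<Sum>i\<in>A. g i)"
    "(\<And>i. i \<in> A \<Longrightarrow> coeffs_in R K (g i)) \<Longrightarrow> coeffs_in R K (\<Prod>i\<in>A. g i)"
proof -
  note R = rat_algebra_closed[OF assms]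
  show "c \<in> R \<Longrightarrow> coeffs_in R K (fps_const c)" and 1: "coeffs_in R K 1" and 0: "coeffs_in R K 0"
    using R(1,2) by (simp_all add: coeffs_in_def)
  show add: "coeffs_in R K F \<Longrightarrow> coeffs_in R K G \<Longrightarrow> coeffs_in R K (F + G)"
    and mult: "coeffs_in R K F \<Longrightarrow> coeffs_in R K G \<Longrightarrow> coeffs_in R K (F * G)" for F G
    using R(4,5) by (auto simp: coeffs_in_def fps_mult_nth intro!: R(7))
  show "coeffs_in R K F \<Longrightarrow> coeffs_in R K (F ^ k)" by (induction k) (auto intro: 1 mult)
  show "(\<And>i. i \<in> A \<Longrightarrow> coeffs_in R K (g i)) \<Longrightarrow> coeffs_in R K (\<Sum>i\<in>A. g i)"
    by (induction A rule: infinite_finite_induct) (auto intro: 0 add)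
  show "(\<And>i. i \<in> A \<Longrightarrow> coeffs_in R K (g i)) \<Longrightarrow> coeffs_in R K (\<Prod>i\<in>A. g i)"
    by (induction A rule: infinite_finite_induct) (auto intro: 1 mult)
qed

text \<open>\<open>W\<close> has order exactly 1 and \<open>V\<close> is a unit, so
  \<open>W ^ (e - 1) * V\<close> starts in degree \<open>e - 1\<close>: the coefficient there
  contains \<open>a e\<close> with a factor invertible in \<open>R\<close>, and otherwise only
  \<open>a e'\<close> of smaller index. Indices outside \<open>E0\<close> carry no equation and are
  supplied by hypothesis.\<close>

lemma triangular_solve:
  fixes P W V :: "complex fps" and a :: "nat \<Rightarrow> complex"
  assumes R: "rat_algebra R" and c: "coeffs_in R K P" "coeffs_in R K W" "coeffs_in R K V"
    and W: "fps_nth W 0 = 0" "fps_nth W 1 \<noteq> 0" "inverse (fps_nth W 1) \<in> R"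
    and V: "fps_nth V 0 \<noteq> 0" "inverse (fps_nth V 0) \<in> R"
    and E: "finite E" "E \<subseteq> {1..K}" "\<And>e. e \<in> E - E0 \<Longrightarrow> a e \<in> R"
    and eq: "\<And>e. e \<in> E0 \<Longrightarrow> fps_nth (P + (\<Sum>e'\<in>E. fps_const (a e' * of_nat e') * W ^ (e' - 1) * V)) (e - 1) = 0"
    and e: "e \<in> E"
  shows "a e \<in> R"
  using e
proof (induction e rule: less_induct)
  case (less e)
  note Rc = rat_algebra_closed[OF R]
  show ?case
  proof (cases "e \<in> E0")
    case True
    have e1: "e \<ge> 1" "e \<le> K" using less.prems E(2) by auto
    let ?T = "\<lambda>e'. fps_nth (W ^ (e' - 1) * V) (e - 1)"
    have T0: "?T e' = 0" if "e' > e" for e'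
      using startsby_zero_power_prefix[OF W(1), of "e' - 1"] that e1
      by (auto simp: fps_mult_nth intro!: sum.neutral)
    have Te: "?T e = fps_nth W 1 ^ (e - 1) * fps_nth V 0"
    proof -
      have "?T e = (\<Sum>i\<in>{0..e - 1}. fps_nth (W ^ (e - 1)) i * fps_nth V (e - 1 - i))"
        by (rule fps_mult_nth)
      also have "\<dots> = (\<Sum>i\<in>{e - 1}. fps_nth (W ^ (e - 1)) i * fps_nth V (e - 1 - i))"
        using startsby_zero_power_prefix[OF W(1), of "e - 1"] by (intro sum.mono_neutral_right) auto
      finally show ?thesis using startsby_zero_power_nth_same[OF W(1), of "e - 1"] by simp
    qed
    have "0 = fps_nth P (e - 1) + (\<Sum>e'\<in>E. a e' * of_nat e' * ?T e')"
      using eq[OF True] by (simp add: fps_sum_nth mult.assoc)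
    also have "(\<Sum>e'\<in>E. a e' * of_nat e' * ?T e') = (\<Sum>e'\<in>{e'\<in>E. e' \<le> e}. a e' * of_nat e' * ?T e')"
    proof (rule sum.mono_neutral_right[OF E(1)])
      show "\<forall>e'\<in>E - {e'\<in>E. e' \<le> e}. a e' * of_nat e' * ?T e' = 0"
      proof
        fix e' assume "e' \<in> E - {e'\<in>E. e' \<le> e}"
        then show "a e' * of_nat e' * ?T e' = 0" by (subst T0) auto
      qed
    qed auto
    also have "{e'\<in>E. e' \<le> e} = insert e {e'\<in>E. e' < e}" using less.prems by auto
    also have "(\<Sum>e'\<in>\<dots>. a e' * of_nat e' * ?T e') = a e * of_nat e * ?T e + (\<Sum>e'\<in>{e'\<in>E. e' < e}. a e' * of_nat e' * ?T e')"
      using E(1) by simp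
    finally have *: "a e * (of_nat e * fps_nth W 1 ^ (e - 1) * fps_nth V 0)
        = - (fps_nth P (e - 1) + (\<Sum>e'\<in>{e'\<in>E. e' < e}. a e' * of_nat e' * ?T e'))"
      unfolding Te by (simp add: algebra_simps eq_neg_iff_add_eq_0)
    have nz: "of_nat e * fps_nth W 1 ^ (e - 1) * fps_nth V 0 \<noteq> 0" using W V e1 by simp
    have "a e = a e * (of_nat e * fps_nth W 1 ^ (e - 1) * fps_nth V 0)
        * (inverse (of_nat e) * inverse (fps_nth W 1) ^ (e - 1) * inverse (fps_nth V 0))"
      using nz by (simp add: power_inverse field_simps)
    then have "a e = - (fps_nth P (e - 1) + (\<Sum>e'\<in>{e'\<in>E. e' < e}. a e' * of_nat e' * ?T e'))
        * (inverse (of_nat e) * inverse (fps_nth W 1) ^ (e - 1) * inverse (fps_nth V 0))"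
      unfolding * .
    moreover have "?T e' \<in> R" for e'
    proof -
      have "coeffs_in R K (W ^ (e' - 1) * V)" by (intro coeffs_in_closed[OF R] c)
      then show ?thesis using e1 by (simp add: coeffs_in_def)
    qed
    moreover have "fps_nth P (e - 1) \<in> R" using c(1) e1 by (simp add: coeffs_in_def)
    moreover have "a e' \<in> R" if "e' \<in> E" "e' < e" for e' using less.IH that by blast
    ultimately show ?thesis
      using W(3) V(2) by (metis (no_types, lifting) Rc(3-9) mem_Collect_eq)
  qed (use E(3) less.prems in auto)
qed

section \<open>Generic perturbations of high order\<close>

lemma has_fps_expansion_unique_ev:
  fixes u w :: "complex \<Rightarrow> complex"
  assumes "u has_fps_expansion U" "w has_fps_expansion W" "\<forall>\<^sub>F t in nhds 0. u t = w t"
  shows "U = W"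
proof -
  have "w has_fps_expansion U" using assms(1) has_fps_expansion_cong[OF assms(3) refl, of U] by blast
  then show ?thesis using assms(2) by (intro fps_ext) (simp add: fps_nth_fps_expansion)
qed

lemma axis_tendsto: "((\<lambda>t. axis i t :: complex^'n) \<longlongrightarrow> 0) (nhds 0)"
  using tendsto_add_axis[of 0 i] by simp

lemma eventually_axis:
  "\<forall>\<^sub>F z in nhds (0::complex^'n). P z \<Longrightarrow> \<forall>\<^sub>F t in nhds 0. P (axis i t)"
  using filterlim_iff[THEN iffD1, OF axis_tendsto] by blast

lemma axis_curve_analytic:
  fixes u :: "complex^'n \<Rightarrow> complex"
  assumes "cgerm u" shows "(\<lambda>t. u (axis i t)) analytic_on {0}"
proof -
  obtain \<epsilon> where \<epsilon>: "\<epsilon> > 0" "\<And>z. norm z < \<epsilon> \<Longrightarrow> chol_at u z"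
    using assms by (rule cgermE) blast
  have d: "(\<lambda>t. u (axis i t)) field_differentiable at t" if "norm t < \<epsilon>" for t
    using \<epsilon>(2)[of "axis i t"] that axis_slice_has_field_derivative[of u _ 0 i t]
    unfolding field_differentiable_def by (auto elim!: chol_atE)
  have "(\<lambda>t. u (axis i t)) holomorphic_on ball 0 \<epsilon>"
    by (rule holomorphic_onI_at) (use d in simp)
  then show ?thesis using \<epsilon>(1) unfolding analytic_at_ball by blast
qed

lemma axis_curve_expansion:
  fixes u :: "complex^'n \<Rightarrow> complex"
  assumes "cgerm u"
  obtains U where "(\<lambda>t. u (axis i t)) has_fps_expansion U" "fps_nth U 0 = u 0" "fps_nth U 1 = partial_deriv i u 0"
proof -
  have *: "(\<lambda>t. u (axis i t)) has_fps_expansion fps_expansion (\<lambda>t. u (axis i t)) 0"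
    by (rule analytic_at_imp_has_fps_expansion_0[OF axis_curve_analytic[OF assms]])
  show thesis
    by (rule that[OF *]) (simp_all add: fps_nth_fps_expansion[OF *] partial_deriv_def)
qed

text \<open>By the chain rule the derivative of \<open>\<rho>\<close> inverts that of
  \<open>\<sigma>\<close> at 0, so no column of the Jacobian can vanish. This supplies the nonzero
  speed of a curve and the nonzero direction along it.\<close>

lemma inverse_germs_partial_nonzero:
  fixes \<rho> \<sigma> :: "complex^'n \<Rightarrow> complex^'n"
  assumes "inverse_germs \<rho> \<sigma>"
  shows "\<exists>q. partial_deriv i (\<lambda>z. \<sigma> z $ q) 0 \<noteq> 0"
proof (rule ccontr)
  assume "\<not> ?thesis"
  then have 0: "partial_deriv i (\<lambda>z. \<sigma> z $ q) 0 = 0" for q by blast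
  have h: "holo_germ \<sigma>" "holo_germ \<rho>" and e: "\<forall>\<^sub>F z in nhds 0. \<rho> (\<sigma> z) = z"
    using assms by (auto simp: inverse_germs_def)
  have \<sigma>0: "\<sigma> 0 = 0" using h by (simp add: holo_germ_def)
  have c: "chol_at (\<lambda>z. \<sigma> z $ q) 0" for q
    using h(1) by (auto simp: holo_germ_iff dest: eventually_nhds_x_imp_x)
  have "(\<sigma> has_derivative (\<lambda>h. \<chi> q. \<Sum>i\<in>UNIV. partial_deriv i (\<lambda>z. \<sigma> z $ q) 0 * h $ i)) (at 0)"
    by (rule has_derivative_vecI) (rule chol_at_partial_deriv[OF c])
  moreover obtain D where D: "(\<rho> has_derivative D) (at (\<sigma> 0))"
    using h(2) \<sigma>0 eventually_nhds_x_imp_x[of "\<lambda>z. \<exists>J::complex^'n^'n. (\<rho> has_derivative (*v) J) (at z)" 0]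
    by (auto simp: holo_germ_def)
  ultimately have "((\<lambda>z. \<rho> (\<sigma> z)) has_derivative (\<lambda>h. D (\<chi> q. \<Sum>i\<in>UNIV. partial_deriv i (\<lambda>z. \<sigma> z $ q) 0 * h $ i))) (at 0)"
    by (rule has_derivative_compose)
  moreover have "((\<lambda>z. \<rho> (\<sigma> z)) has_derivative (\<lambda>h. h)) (at 0)"
  proof (rule has_derivative_transform_eventually[of "\<lambda>z. z"])
    show "\<forall>\<^sub>F z in at 0. z = \<rho> (\<sigma> z)" using e by (simp add: eventually_at_filter eventually_mono)
    show "0 = \<rho> (\<sigma> 0)" using eventually_nhds_x_imp_x[OF e] by simp
  qed auto
  ultimately have "(\<lambda>h. D (\<chi> q. \<Sum>i\<in>UNIV. partial_deriv i (\<lambda>z. \<sigma> z $ q) 0 * h $ i)) = (\<lambda>h. h)"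
    by (rule has_derivative_unique)
  from fun_cong[OF this, of "axis i 1"]
  have "D (\<chi> q. \<Sum>i'\<in>UNIV. partial_deriv i' (\<lambda>z. \<sigma> z $ q) 0 * axis i 1 $ i') = axis i 1" .
  moreover have "(\<Sum>i'\<in>UNIV. partial_deriv i' (\<lambda>z. \<sigma> z $ q) 0 * axis i (1::complex) $ i') = 0" for q
    using 0[of q] by (intro sum.neutral) (simp add: axis_def)
  ultimately have "D 0 = axis i 1" by (simp add: zero_vec_def)
  then show False
    using bounded_linear.linear[OF has_derivative_bounded_linear[OF D], THEN linear_0]
    by (metis axis_eq_0_iff zero_neq_one)
qed

text \<open>The index pairs, equal ones included, are linear forms in at most two coordinates.
  Single coordinates would not do, since the speed of a curve and a direction along it may be
  supported on different coordinates.\<close>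

definition perturbation :: "nat set \<Rightarrow> ('p \<times> ('n \<times> 'n) \<times> nat \<Rightarrow> complex) \<Rightarrow> complex^'n \<Rightarrow> complex^'p" where
  "perturbation E a z = (\<chi> k. \<Sum>c\<in>UNIV. \<Sum>e\<in>E. a (k, c, e) * (z $ fst c + z $ snd c) ^ e)"

lemma chol_at_perturbation: "chol_at (\<lambda>z. perturbation E a z $ k) z"
  unfolding perturbation_def vec_lambda_beta
  by (intro chol_at_sum chol_at_mult chol_at_power chol_at_add chol_at_const chol_at_nth)

lemma flat_power:
  fixes u :: "complex^'n \<Rightarrow> complex"
  assumes "flat N u" shows "flat (k * N) (\<lambda>z. u z ^ k)"
proof (induction k)
  case 0
  have "flat 0 (\<lambda>z::complex^'n. 1::complex)" by (intro flat_0_cgerm) simp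
  then show ?case by simp
next
  case (Suc k)
  from flat_mult[OF assms Suc] show ?case by simp
qed

lemma flat_perturbation:
  assumes "\<And>e. e \<in> E \<Longrightarrow> N \<le> e"
  shows "flat N (\<lambda>z. perturbation E a z $ k)"
  unfolding perturbation_def vec_lambda_beta
proof (intro flat_sum)
  fix c :: "'a \<times> 'a" and e assume "e \<in> E"
  have "flat 1 (\<lambda>z::complex^'a. z $ fst c + z $ snd c)"
    using flat_nth_power[of 1] by (intro flat_add) simp_all
  from flat_power[OF this, of e] have "flat e (\<lambda>z::complex^'a. (z $ fst c + z $ snd c) ^ e)" by simp
  moreover have "flat 0 (\<lambda>z::complex^'a. a (k, c, e))" by (intro flat_0_cgerm) simp
  ultimately have "flat (0 + e) (\<lambda>z. a (k, c, e) * (z $ fst c + z $ snd c) ^ e)" by (intro flat_mult)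
  then show "flat N (\<lambda>z. a (k, c, e) * (z $ fst c + z $ snd c) ^ e)"
    by (rule flat_mono) (use assms[OF \<open>e \<in> E\<close>] in simp)
qed

text \<open>The target change is undone and moved to the right-hand side: the perturbed germ along
  the image of a curve under \<open>\<sigma>\<close> is a function of \<open>f\<close> along the
  curve itself, so degeneracies of \<open>f\<close> on an axis reappear in the perturbed
  germ.\<close>

lemma A_finite_perturbation:
  fixes f :: "complex^'n \<Rightarrow> complex^'p"
  assumes "A_finite f" "holo_germ f"
  obtains r where "\<And>E a. (\<And>e. e \<in> E \<Longrightarrow> r < e) \<Longrightarrow>
    \<exists>\<rho> \<sigma> \<psi>'. inverse_germs \<rho> \<sigma> \<and> holo_germ \<psi>' \<and>
      (\<forall>\<^sub>F z in nhds 0. f (\<sigma> z) + perturbation E a (\<sigma> z) = \<psi>' (f z))"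
proof -
  obtain r where r: "\<And>g. holo_germ g \<Longrightarrow> same_jet r f g \<Longrightarrow> A_equivalent g f"
    using assms(1) unfolding A_finite_def by blast
  show thesis
  proof (rule that[of r])
    fix E and a :: "'p \<times> ('n \<times> 'n) \<times> nat \<Rightarrow> complex"
    assume E: "\<And>e. e \<in> E \<Longrightarrow> r < e"
    define g where "g z = f z + perturbation E a z" for z
    have fl: "flat (Suc r) (\<lambda>z. perturbation E a z $ k)" for k
      by (rule flat_perturbation) (use E in \<open>simp add: Suc_le_eq\<close>)
    have cf: "cgerm (\<lambda>z. f z $ k)" for k using assms(2) by (simp add: holo_germ_iff)
    have cg: "cgerm (\<lambda>z. g z $ k)" for k
      using cf[of k] unfolding g_def vector_add_component
      by eventually_elim (intro chol_at_add chol_at_perturbation)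
    have "perturbation E a 0 $ k = 0" for k
      using flat_zero[OF fl[of k] chol_at_continuous[OF chol_at_perturbation]] .
    then have g: "holo_germ g"
      using cg assms(2) by (simp add: holo_germ_iff g_def vec_eq_iff)
    moreover have "same_jet r f g"
      unfolding same_jet_def
    proof (intro allI impI)
      fix k and "is" :: "'n list" assume len: "length is \<le> r"
      have "foldr partial_deriv is (\<lambda>z. g z $ k - f z $ k) 0 = 0"
        by (rule flat_imp_jet_zero[OF _ _ len]) (use fl[of k] in \<open>simp_all add: g_def chol_at_perturbation\<close>)
      then show "foldr partial_deriv is (\<lambda>z. f z $ k) 0 = foldr partial_deriv is (\<lambda>z. g z $ k) 0"
        using eventually_nhds_x_imp_x[OF foldr_partial_diff[OF cg[of k] cf[of k], of "is"]] by simp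
    qed
    ultimately have "A_equivalent g f" by (rule r)
    then obtain \<rho> \<sigma> \<psi> \<psi>' where \<rho>: "inverse_germs \<rho> \<sigma>" and \<psi>: "inverse_germs \<psi> \<psi>'"
      and f: "\<forall>\<^sub>F z in nhds 0. f z = \<psi> (g (\<sigma> z))"
      unfolding A_equivalent_def biholo_germ_def by blast
    have h: "holo_germ \<sigma>" "holo_germ \<psi>'" using \<rho> \<psi> by (auto simp: inverse_germs_def)
    have "\<forall>\<^sub>F z in nhds 0. \<psi>' (\<psi> (g (\<sigma> z))) = g (\<sigma> z)"
      using holo_germ_eventually[OF holo_germ_compose[OF h(1) g]] \<psi>
      unfolding inverse_germs_def by blast
    with f have "\<forall>\<^sub>F z in nhds 0. f (\<sigma> z) + perturbation E a (\<sigma> z) = \<psi>' (f z)"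
      by eventually_elim (simp add: g_def)
    then show "\<exists>\<rho> \<sigma> \<psi>'. inverse_germs \<rho> \<sigma> \<and> holo_germ \<psi>' \<and>
      (\<forall>\<^sub>F z in nhds 0. f (\<sigma> z) + perturbation E a (\<sigma> z) = \<psi>' (f z))"
      using \<rho> h(2) by blast
  qed
qed

text \<open>The parameters in \<open>J0\<close> are recovered from \<open>X0\<close> and the other
  parameters, so \<open>card J\<close> independent numbers lie in an algebra on at most
  \<open>card X0 + card J - card J0\<close> generators. \<open>W\<close> and \<open>V\<close> are
  the same for all components \<open>k\<close>, hence the equations of all components share the cost
  \<open>X0\<close>.\<close>

lemma parameter_bound:
  fixes a :: "'p::finite \<times> 'c::finite \<times> nat \<Rightarrow> complex" and P :: "'p \<Rightarrow> complex fps"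
  assumes ind: "alg_indep (UNIV \<times> UNIV \<times> E) a" and E: "finite E" "E \<subseteq> {1..K}" "E0 \<subseteq> E"
    and X0: "finite X0"
    and WV: "\<And>R. rat_algebra R \<Longrightarrow> X0 \<subseteq> R \<Longrightarrow> coeffs_in R K W \<and> coeffs_in R K V \<and>
      inverse (fps_nth W 1) \<in> R \<and> inverse (fps_nth V 0) \<in> R"
    and P: "\<And>R k. rat_algebra R \<Longrightarrow> X0 \<subseteq> R \<Longrightarrow> (\<And>c' e. c' \<noteq> c \<Longrightarrow> e \<in> E \<Longrightarrow> a (k, c', e) \<in> R) \<Longrightarrow> coeffs_in R K (P k)"
    and W: "fps_nth W 0 = 0" "fps_nth W 1 \<noteq> 0" and V: "fps_nth V 0 \<noteq> 0"
    and eq: "\<And>k e. e \<in> E0 \<Longrightarrow>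
      fps_nth (P k + (\<Sum>e'\<in>E. fps_const (a (k, c, e') * of_nat e') * W ^ (e' - 1) * V)) (e - 1) = 0"
  shows "CARD('p) * card E0 \<le> card X0"
proof -
  define J where "J = (UNIV :: 'p set) \<times> (UNIV :: 'c set) \<times> E"
  define J0 where "J0 = (UNIV :: 'p set) \<times> {c} \<times> E0"
  define X where "X = X0 \<union> a ` (J - J0)"
  define R where "R = (\<Union>d. rat_polys X d)"
  have fin: "finite J" "finite X" using E X0 by (simp_all add: J_def X_def)
  have J0: "J0 \<subseteq> J" using E by (auto simp: J_def J0_def)
  have R: "rat_algebra R" "X \<subseteq> R" unfolding R_def using rat_algebra_rat_polys[OF fin(2)] by auto
  then have X0R: "X0 \<subseteq> R" and aR: "\<And>j. j \<in> J - J0 \<Longrightarrow> a j \<in> R" by (auto simp: X_def)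
  have "a j \<in> R" if j: "j \<in> J" for j
  proof (cases "j \<in> J0")
    case True
    then obtain k e where j_eq: "j = (k, c, e)" and e: "e \<in> E0" by (auto simp: J0_def)
    have "a (k, c, e) \<in> R"
    proof (rule triangular_solve[OF R(1), where a="\<lambda>e. a (k, c, e)" and E=E and ?E0.0=E0])
      show "coeffs_in R K (P k)"
        by (rule P[OF R(1) X0R], rule aR) (auto simp: J_def J0_def)
      show "coeffs_in R K W" "coeffs_in R K V" "inverse (fps_nth W 1) \<in> R" "inverse (fps_nth V 0) \<in> R"
        using WV[OF R(1) X0R] by auto
      show "a (k, c, e) \<in> R" if "e \<in> E - E0" for e
        by (rule aR) (use that in \<open>auto simp: J_def J0_def\<close>)
      show "e \<in> E" using e E(3) by auto
    qed (use W V E eq in auto)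
    then show ?thesis by (simp add: j_eq)
  qed (use aR j in auto)
  then have "\<exists>d. a j \<in> rat_polys X d" if "j \<in> J" for j using that by (auto simp: R_def)
  then have "card J \<le> card X"
    using alg_indep_card_le[OF fin(2,1)] ind unfolding J_def by blast
  also have "card X \<le> card X0 + card (J - J0)"
    unfolding X_def by (rule order_trans[OF card_Un_le]) (simp add: card_image_le fin(1))
  also have "card (J - J0) = card J - card J0"
    by (rule card_Diff_subset[OF finite_subset[OF J0 fin(1)] J0])
  finally have "card J0 \<le> card X0" using card_mono[OF fin(1) J0] by linarith
  then show ?thesis by (simp add: J0_def card_cartesian_product)
qed

section \<open>Immersivity along the coordinate axes\<close>

definition mono_fun :: "('n \<Rightarrow> nat) option \<Rightarrow> complex^'n \<Rightarrow> complex" where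
  "mono_fun A z = (case A of None \<Rightarrow> 0 | Some a \<Rightarrow> \<Prod>q\<in>UNIV. z $ q ^ a q)"

text \<open>Formal partial derivative over any commutative ring, so one formula serves for values
  and for power series. For \<open>a q = 0\<close> the truncated exponent is harmless because the
  factor \<open>of_nat (a q)\<close> is 0.\<close>

definition mono_partial :: "('n::finite \<Rightarrow> nat) option \<Rightarrow> ('n \<Rightarrow> 'r) \<Rightarrow> 'n \<Rightarrow> 'r::comm_ring_1" where
  "mono_partial A x q = (case A of None \<Rightarrow> 0
     | Some a \<Rightarrow> of_nat (a q) * x q ^ (a q - 1) * (\<Prod>q'\<in>UNIV - {q}. x q' ^ a q'))"

lemma mono_fun_has_field_derivative:
  assumes "\<And>q. ((\<lambda>s. c s $ q) has_field_derivative v q) (at x)"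
  shows "((\<lambda>s. mono_fun A (c s)) has_field_derivative (\<Sum>q\<in>UNIV. v q * mono_partial A (($) (c x)) q)) (at x)"
proof (cases A)
  case (Some a)
  have "((\<lambda>s. (c s $ q) ^ a q) has_field_derivative of_nat (a q) * (v q * (c x $ q) ^ (a q - Suc 0))) (at x)" for q
    by (rule DERIV_power[OF assms])
  from has_field_derivative_prod[where A=UNIV, OF this]
  show ?thesis by (simp add: Some mono_fun_def mono_partial_def mult_ac)
qed (simp add: mono_fun_def mono_partial_def)

lemma perturbation_has_field_derivative:
  assumes "\<And>q. ((\<lambda>s. c s $ q) has_field_derivative v q) (at x)"
  shows "((\<lambda>s. perturbation E a (c s) $ k) has_field_derivative
    (\<Sum>p\<in>UNIV. \<Sum>e\<in>E. a (k, p, e) * (of_nat e * ((v (fst p) + v (snd p)) * (c x $ fst p + c x $ snd p) ^ (e - 1))))) (at x)"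
  unfolding perturbation_def vec_lambda_beta
  by (intro DERIV_sum DERIV_cmult) (use DERIV_power[OF DERIV_add[OF assms assms]] in simp)

lemma chol_at_axis_derivative:
  assumes "chol_at u z"
  shows "((\<lambda>s. u (z + axis j s)) has_field_derivative partial_deriv j u z) (at 0)"
proof -
  obtain D where "(u has_derivative D) (at z)" "\<forall>a h. D (a *s h) = a * D h"
    using assms by (rule chol_atE)
  then have "((\<lambda>s. u (z + axis j s)) has_field_derivative D (axis j 1)) (at 0)"
    by (intro axis_slice_has_field_derivative) simp_all
  then show ?thesis by (simp add: partial_deriv_def DERIV_imp_deriv)
qed

text \<open>On the axis every coordinate but \<open>i\<close> is 0, so the derivative in direction
  \<open>j\<close> survives only if \<open>j\<close> occurs to the first power and no third
  coordinate occurs.\<close>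

lemma mono_fun_axis_derivative:
  assumes "i \<noteq> j" "\<And>a. A = Some a \<Longrightarrow> \<not> (a j = 1 \<and> (\<forall>q. q \<noteq> i \<longrightarrow> q \<noteq> j \<longrightarrow> a q = 0))"
  shows "((\<lambda>s. mono_fun A (axis i t + axis j s)) has_field_derivative 0) (at 0)"
proof -
  have "((\<lambda>s. (axis i t + axis j s) $ q) has_field_derivative (if q = j then 1 else 0)) (at 0)" for q
    by (cases "q = j") (auto simp: axis_def intro!: derivative_eq_intros)
  from mono_fun_has_field_derivative[OF this, of A]
  have "((\<lambda>s. mono_fun A (axis i t + axis j s)) has_field_derivative mono_partial A (($) (axis i t)) j) (at 0)"
    by (simp add: if_distrib[of "\<lambda>x. x * _"] cong: if_cong)
  moreover have "mono_partial A (($) (axis i t)) j = 0"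
  proof (cases A)
    case (Some a)
    consider "a j = 0" | "a j \<ge> 2" | "a j = 1" by linarith
    then show ?thesis
    proof cases
      case 2
      then show ?thesis using assms(1) by (simp add: Some mono_partial_def axis_def)
    next
      case 3
      then obtain q where "q \<noteq> i" "q \<noteq> j" "a q \<noteq> 0" using assms(2)[OF Some] by blast
      then have "(\<Prod>q'\<in>UNIV - {j}. axis i t $ q' ^ a q') = 0"
        by (intro prod_zero) (auto intro!: bexI[of _ q] simp: axis_def)
      then show ?thesis by (simp add: Some mono_partial_def)
    qed (simp add: Some mono_partial_def)
  qed (simp add: mono_partial_def)
  ultimately show ?thesis by simp
qed

lemma has_fps_expansion_mono_partial:
  fixes c :: "complex \<Rightarrow> complex^'n"
  assumes "\<And>q. (\<lambda>t. c t $ q) has_fps_expansion \<gamma> q"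
  shows "(\<lambda>t. mono_partial A (($) (c t)) q) has_fps_expansion mono_partial A \<gamma> q"
proof (cases A)
  case (Some a)
  have "(\<lambda>t. complex_of_nat (a q) * c t $ q ^ (a q - 1) * (\<Prod>q'\<in>UNIV - {q}. c t $ q' ^ a q'))
      has_fps_expansion fps_const (of_nat (a q)) * \<gamma> q ^ (a q - 1) * (\<Prod>q'\<in>UNIV - {q}. \<gamma> q' ^ a q')"
    by (intro has_fps_expansion_mult has_fps_expansion_prod has_fps_expansion_power assms has_fps_expansion_const)
  then show ?thesis by (simp add: Some mono_partial_def fps_of_nat)
qed (simp add: mono_partial_def)

lemma chol_at_mono_fun: "chol_at (mono_fun A) z"
  unfolding mono_fun_def by (cases A) (auto intro!: chol_at_prod chol_at_power)

lemma A_finite_monomial_perturbation: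
  fixes f :: "complex^'n \<Rightarrow> complex^'p"
  assumes f: "A_finite f" "holo_germ f" and mono: "\<And>k. \<forall>\<^sub>F z in nhds 0. f z $ k = mono_fun (A k) z"
  obtains r where "holo_germ (\<lambda>z. \<chi> k. mono_fun (A k) z)"
    "\<And>M. \<exists>a \<rho> \<sigma> \<psi>'. alg_indep (UNIV \<times> UNIV \<times> {r + 1..r + M}) a \<and> inverse_germs \<rho> \<sigma> \<and> holo_germ \<psi>' \<and>
      (\<forall>\<^sub>F z in nhds 0. (\<chi> k. mono_fun (A k) (\<sigma> z)) + perturbation {r + 1..r + M} a (\<sigma> z)
        = \<psi>' (\<chi> k. mono_fun (A k) z))"
proof -
  have "\<forall>\<^sub>F z in nhds 0. \<forall>k. f z $ k = mono_fun (A k) z"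
    using mono by (simp add: eventually_all_iff)
  then have monoE: "\<forall>\<^sub>F z in nhds 0. f z = (\<chi> k. mono_fun (A k) z)"
    by eventually_elim (simp add: vec_eq_iff)
  obtain r where r: "\<And>E a. (\<And>e. e \<in> E \<Longrightarrow> r < e) \<Longrightarrow>
    \<exists>\<rho> \<sigma> \<psi>'. inverse_germs \<rho> \<sigma> \<and> holo_germ \<psi>' \<and>
      (\<forall>\<^sub>F z in nhds 0. f (\<sigma> z) + perturbation E a (\<sigma> z) = \<psi>' (f z))"
    using A_finite_perturbation[OF f] by blast
  show thesis
  proof (rule that[of r])
    show "holo_germ (\<lambda>z. \<chi> k. mono_fun (A k) z)"
      using eventually_nhds_x_imp_x[OF monoE] f(2) by (simp add: holo_germ_iff chol_at_mono_fun)
    fix M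
    let ?E = "{r + 1..r + M}"
    obtain a :: "'p \<times> ('n \<times> 'n) \<times> nat \<Rightarrow> complex" where a: "alg_indep (UNIV \<times> UNIV \<times> ?E) a"
      using alg_indep_exists[of "(UNIV :: 'p set) \<times> (UNIV :: ('n \<times> 'n) set) \<times> ?E"] by auto
    obtain \<rho> \<sigma> \<psi>' where *: "inverse_germs \<rho> \<sigma>" "holo_germ \<psi>'"
      "\<forall>\<^sub>F z in nhds 0. f (\<sigma> z) + perturbation ?E a (\<sigma> z) = \<psi>' (f z)"
      using r[of ?E a] by auto
    have "holo_germ \<sigma>" using *(1) by (simp add: inverse_germs_def)
    from *(3) monoE holo_germ_eventually[OF this monoE]
    have "\<forall>\<^sub>F z in nhds 0. (\<chi> k. mono_fun (A k) (\<sigma> z)) + perturbation ?E a (\<sigma> z) = \<psi>' (\<chi> k. mono_fun (A k) z)"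
      by eventually_elim simp
    with a * show "\<exists>a \<rho> \<sigma> \<psi>'. alg_indep (UNIV \<times> UNIV \<times> ?E) a \<and> inverse_germs \<rho> \<sigma> \<and> holo_germ \<psi>' \<and>
      (\<forall>\<^sub>F z in nhds 0. (\<chi> k. mono_fun (A k) (\<sigma> z)) + perturbation ?E a (\<sigma> z) = \<psi>' (\<chi> k. mono_fun (A k) z))"
      by blast
  qed
qed

lemma axis_curve_expansions:
  assumes "holo_germ \<sigma>"
  obtains \<gamma> where "\<And>q. (\<lambda>t. \<sigma> (axis i t) $ q) has_fps_expansion \<gamma> q" "\<And>q. fps_nth (\<gamma> q) 0 = 0"
    "\<And>q. fps_nth (\<gamma> q) 1 = partial_deriv i (\<lambda>z. \<sigma> z $ q) 0"
proof -
  have "\<exists>\<gamma>. (\<lambda>t. \<sigma> (axis i t) $ q) has_fps_expansion \<gamma> \<and> fps_nth \<gamma> 0 = 0 \<and>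
      fps_nth \<gamma> 1 = partial_deriv i (\<lambda>z. \<sigma> z $ q) 0" for q
    using axis_curve_expansion[of "\<lambda>z. \<sigma> z $ q" i] assms unfolding holo_germ_iff by (metis zero_index)
  then show thesis using that by metis
qed

lemma coeffs_in_mono_partial:
  assumes "rat_algebra R" "\<And>q. coeffs_in R K (\<gamma> q)"
  shows "coeffs_in R K (mono_partial A \<gamma> q)"
proof (cases A)
  case (Some a)
  have "coeffs_in R K (fps_const (of_nat (a q)) * \<gamma> q ^ (a q - 1) * (\<Prod>q'\<in>UNIV - {q}. \<gamma> q' ^ a q'))"
    by (intro coeffs_in_closed[OF assms(1)] assms(2) rat_algebra_closed(3)[OF assms(1)])
  then show ?thesis by (simp add: Some mono_partial_def fps_of_nat)
qed (simp add: mono_partial_def coeffs_in_closed[OF assms(1)])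

lemma card_coeff_family:
  fixes G :: "'q::finite \<Rightarrow> complex fps"
  shows "finite ((\<lambda>(q, e). fps_nth (G q) e) ` (S \<times> {..K}))"
    "card ((\<lambda>(q, e). fps_nth (G q) e) ` (S \<times> {..K})) \<le> card S * Suc K"
  using card_image_le[of "S \<times> {..K}" "\<lambda>(q, e). fps_nth (G q) e"]
  by (simp_all add: card_cartesian_product)

text \<open>Otherwise the derivative of \<open>f\<close> in direction \<open>j\<close> vanishes
  along the axis of \<open>i\<close>, and so does that of the perturbed germ along the curve
  \<open>\<gamma>\<close> in the direction \<open>\<nu>\<close>, the image of direction
  \<open>j\<close> under the derivative of \<open>\<sigma>\<close>. These are \<open>2 * n\<close>
  power series identities, from which the coefficients of one linear form can be eliminated.\<close>

lemma A_finite_imp_immersive_monomial: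
  fixes f :: "complex^'n \<Rightarrow> complex^'p" and A :: "'p \<Rightarrow> ('n \<Rightarrow> nat) option"
  assumes card: "CARD('p) = 2 * CARD('n)" and f: "A_finite f" "holo_germ f"
    and mono: "\<And>k. \<forall>\<^sub>F z in nhds 0. f z $ k = mono_fun (A k) z" and ij: "i \<noteq> j"
  shows "\<exists>k a. A k = Some a \<and> a j = 1 \<and> (\<forall>q. q \<noteq> i \<longrightarrow> q \<noteq> j \<longrightarrow> a q = 0)"
proof (rule ccontr)
  assume "\<not> ?thesis"
  then have no: "\<not> (a j = 1 \<and> (\<forall>q. q \<noteq> i \<longrightarrow> q \<noteq> j \<longrightarrow> a q = 0))" if "A k = Some a" for k a
    using that by blast
  obtain r where F: "holo_germ (\<lambda>z. \<chi> k. mono_fun (A k) z)" and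
    r: "\<And>M. \<exists>a \<rho> \<sigma> \<psi>'. alg_indep (UNIV \<times> UNIV \<times> {r + 1..r + M}) a \<and> inverse_germs \<rho> \<sigma> \<and> holo_germ \<psi>' \<and>
      (\<forall>\<^sub>F z in nhds 0. (\<chi> k. mono_fun (A k) (\<sigma> z)) + perturbation {r + 1..r + M} a (\<sigma> z)
        = \<psi>' (\<chi> k. mono_fun (A k) z))"
    using A_finite_monomial_perturbation[OF f mono] by blast
  define n where "n = CARD('n)"
  have n: "n \<ge> 1" by (simp add: n_def Suc_leI)
  \<comment> \<open>The final count gives \<open>M \<le> (2 * n - 1) * (r + 1) + 2\<close>, which
    this value exceeds.\<close>
  define M where "M = 2 * n * (r + 3) + 3"
  define K where "K = r + M"
  define E where "E = {r + 1..r + M}"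
  have E: "finite E" "E \<subseteq> {1..K}" "card E = M" by (auto simp: E_def K_def)
  obtain a :: "'p \<times> ('n \<times> 'n) \<times> nat \<Rightarrow> complex" and \<rho> \<sigma> \<psi>'
    where a: "alg_indep (UNIV \<times> UNIV \<times> E) a" and \<rho>: "inverse_germs \<rho> \<sigma>" and \<psi>': "holo_germ \<psi>'"
    and eq: "\<forall>\<^sub>F z in nhds 0. (\<chi> k. mono_fun (A k) (\<sigma> z)) + perturbation E a (\<sigma> z) = \<psi>' (\<chi> k. mono_fun (A k) z)"
    using r[of M] unfolding E_def by blast
  have \<sigma>: "holo_germ \<sigma>" using \<rho> by (simp add: inverse_germs_def)
  then have \<sigma>c: "cgerm (\<lambda>z. \<sigma> z $ q)" for q by (simp add: holo_germ_iff)
  define v where "v q z = partial_deriv j (\<lambda>z. \<sigma> z $ q) z" for q z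
  \<comment> \<open>Derivative in direction \<open>j\<close> of component \<open>k\<close> of the
    perturbed germ after \<open>\<sigma>\<close>, kept as a formula so that \<open>Sf\<close> can
    repeat it with power series.\<close>
  define S where "S k z = (\<Sum>q\<in>UNIV. v q z * mono_partial (A k) (($) (\<sigma> z)) q)
    + (\<Sum>p\<in>UNIV. \<Sum>e\<in>E. a (k, p, e) * (of_nat e * ((v (fst p) z + v (snd p) z) * (\<sigma> z $ fst p + \<sigma> z $ snd p) ^ (e - 1))))" for k z
  define g where "g z = (\<chi> k. mono_fun (A k) (\<sigma> z)) + perturbation E a (\<sigma> z)" for z
  have g_eq: "\<forall>\<^sub>F z in nhds 0. g z = \<psi>' (\<chi> k. mono_fun (A k) z)"
    using eq by (simp add: g_def)
  have "\<forall>\<^sub>F z in nhds 0. \<forall>\<^sub>F s in nhds 0. g (z + axis j s) = \<psi>' (\<chi> k. mono_fun (A k) (z + axis j s))"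
    using g_eq[THEN eventually_eventually[THEN iffD2]]
    by eventually_elim (use filterlim_iff[THEN iffD1, OF tendsto_add_axis] in blast)
  then have 1: "\<forall>\<^sub>F t in nhds 0. \<forall>\<^sub>F s in nhds 0. g (axis i t + axis j s) = \<psi>' (\<chi> k. mono_fun (A k) (axis i t + axis j s))"
    by (rule eventually_axis)
  have 2: "\<forall>\<^sub>F t in nhds 0. \<forall>q. chol_at (\<lambda>z. \<sigma> z $ q) (axis i t)"
    by (rule eventually_axis) (use \<sigma>c in \<open>simp add: eventually_all_iff\<close>)
  have "\<forall>\<^sub>F z in nhds 0. \<exists>D. (\<psi>' has_derivative D) (at (\<chi> k. mono_fun (A k) z))"
    by (rule holo_germ_eventually[OF F]) (use \<psi>' in \<open>auto simp: holo_germ_def elim: eventually_mono\<close>)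
  then have 3: "\<forall>\<^sub>F t in nhds 0. \<exists>D. (\<psi>' has_derivative D) (at (\<chi> k. mono_fun (A k) (axis i t)))"
    by (rule eventually_axis)
  have "\<forall>\<^sub>F t in nhds 0. \<forall>k. S k (axis i t) = 0"
    using 1 2 3
  proof eventually_elim
    case (elim t)
    show ?case
    proof
    fix k
    obtain D where D: "(\<psi>' has_derivative D) (at (\<chi> k. mono_fun (A k) (axis i t + axis j 0)))"
      using elim(3) by auto
    have "((\<lambda>s. mono_fun (A k) (axis i t + axis j s)) has_derivative (\<lambda>_. 0)) (at 0)" for k
      using mono_fun_axis_derivative[OF ij no, where A="A k" and t=t] by (simp add: has_field_derivative_def mult_zero_left[abs_def])
    then have "((\<lambda>s. \<chi> k. mono_fun (A k) (axis i t + axis j s)) has_derivative (\<lambda>h. \<chi> k. 0)) (at 0)"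
      by (intro has_derivative_vecI) simp
    from has_derivative_compose[OF this D]
    have "((\<lambda>s. \<psi>' (\<chi> k. mono_fun (A k) (axis i t + axis j s))) has_derivative (\<lambda>h. 0)) (at 0)"
      using linear_0[OF bounded_linear.linear[OF has_derivative_bounded_linear[OF D]]]
      by (simp add: zero_vec_def[symmetric])
    then have "((\<lambda>s. g (axis i t + axis j s)) has_derivative (\<lambda>h. 0)) (at 0)"
      by (rule has_derivative_transform_eventually)
         (use elim(1) eventually_nhds_x_imp_x[OF elim(1)] in \<open>auto simp: eventually_at_filter elim: eventually_mono\<close>)
    from bounded_linear.has_derivative[OF bounded_linear_vec_nth this, of k]
    have "((\<lambda>s. g (axis i t + axis j s) $ k) has_field_derivative 0) (at 0)"
      by (simp add: has_field_derivative_def mult_zero_left[abs_def])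
    moreover have "((\<lambda>s. g (axis i t + axis j s) $ k) has_field_derivative S k (axis i t)) (at 0)"
    proof -
      have "((\<lambda>s. \<sigma> (axis i t + axis j s) $ q) has_field_derivative v q (axis i t)) (at 0)" for q
        unfolding v_def by (rule chol_at_axis_derivative) (use elim(2) in blast)
      from DERIV_add[OF mono_fun_has_field_derivative[OF this] perturbation_has_field_derivative[OF this]]
      show ?thesis by (simp add: g_def S_def)
    qed
    ultimately show "S k (axis i t) = 0" by (rule DERIV_unique[symmetric])
    qed
  qed
  then have S0: "\<forall>\<^sub>F t in nhds 0. S k (axis i t) = 0" for k by (auto elim: eventually_mono)
  obtain \<gamma> where \<gamma>: "\<And>q. (\<lambda>t. \<sigma> (axis i t) $ q) has_fps_expansion \<gamma> q"
    "\<And>q. fps_nth (\<gamma> q) 0 = 0" "\<And>q. fps_nth (\<gamma> q) 1 = partial_deriv i (\<lambda>z. \<sigma> z $ q) 0"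
    using axis_curve_expansions[OF \<sigma>] by blast
  have "\<exists>\<nu>. (\<lambda>t. v q (axis i t)) has_fps_expansion \<nu> \<and> fps_nth \<nu> 0 = partial_deriv j (\<lambda>z. \<sigma> z $ q) 0" for q
    using axis_curve_expansion[OF cgerm_partial[OF \<sigma>c[of q]], of j i] unfolding v_def by metis
  then obtain \<nu> where \<nu>: "\<And>q. (\<lambda>t. v q (axis i t)) has_fps_expansion \<nu> q"
    "\<And>q. fps_nth (\<nu> q) 0 = partial_deriv j (\<lambda>z. \<sigma> z $ q) 0" by metis
  define Sf where "Sf k = (\<Sum>q\<in>UNIV. \<nu> q * mono_partial (A k) \<gamma> q)
    + (\<Sum>p\<in>UNIV. \<Sum>e\<in>E. fps_const (a (k, p, e)) * (fps_const (of_nat e) *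
        ((\<nu> (fst p) + \<nu> (snd p)) * (\<gamma> (fst p) + \<gamma> (snd p)) ^ (e - 1))))" for k
  have "(\<lambda>t. S k (axis i t)) has_fps_expansion Sf k" for k
    unfolding S_def Sf_def
    by (intro has_fps_expansion_add has_fps_expansion_sum has_fps_expansion_mult has_fps_expansion_power
        has_fps_expansion_const has_fps_expansion_mono_partial \<gamma>(1) \<nu>(1))
  from has_fps_expansion_unique_ev[OF this has_fps_expansion_0 S0] have Sf0: "Sf k = 0" for k .
  obtain m0 where m0: "fps_nth (\<nu> m0) 0 \<noteq> 0"
    using inverse_germs_partial_nonzero[OF \<rho>, of j] \<nu>(2) by auto
  obtain l0 where l0: "fps_nth (\<gamma> l0) 1 \<noteq> 0"
    using inverse_germs_partial_nonzero[OF \<rho>, of i] \<gamma>(3) by auto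
  \<comment> \<open>If neither repeated index works, the speed vanishes at \<open>m0\<close> and the
    direction at \<open>l0\<close>, so nothing can cancel for the pair
    \<open>(l0, m0)\<close>.\<close>
  obtain l m where lm: "fps_nth (\<gamma> l) 1 + fps_nth (\<gamma> m) 1 \<noteq> 0" "fps_nth (\<nu> l) 0 + fps_nth (\<nu> m) 0 \<noteq> 0"
  proof (cases "fps_nth (\<nu> l0) 0 = 0")
    case False
    then show ?thesis using that[of l0 l0] l0 by simp
  next
    case True
    show ?thesis
    proof (cases "fps_nth (\<gamma> m0) 1 = 0")
      case True
      then show ?thesis using that[of l0 m0] l0 m0 \<open>fps_nth (\<nu> l0) 0 = 0\<close> by simp
    next
      case False
      then show ?thesis using that[of m0 m0] m0 by simp
    qed
  qed
  \<comment> \<open>The identities are linear in \<open>\<nu>\<close>, so a unit entry can be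
    divided out to become 1. This saves one of the \<open>2 * n\<close> unknown series; without the
    saving the count proves nothing.\<close>
  define \<iota> where "\<iota> = inverse (\<nu> m0)"
  define \<nu>' where "\<nu>' q = \<nu> q * \<iota>" for q
  have \<nu>'m0: "\<nu>' m0 = 1" using m0 by (simp add: \<nu>'_def \<iota>_def inverse_mult_eq_1')
  define W where "W = \<gamma> l + \<gamma> m"
  define V where "V = \<nu>' l + \<nu>' m"
  define P where "P k = (\<Sum>q\<in>UNIV. \<nu>' q * mono_partial (A k) \<gamma> q)
    + (\<Sum>p\<in>UNIV - {(l, m)}. \<Sum>e\<in>E. fps_const (a (k, p, e)) * (fps_const (of_nat e) *
        ((\<nu>' (fst p) + \<nu>' (snd p)) * (\<gamma> (fst p) + \<gamma> (snd p)) ^ (e - 1))))" for k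
  have PWV: "P k + (\<Sum>e\<in>E. fps_const (a (k, (l, m), e) * of_nat e) * W ^ (e - 1) * V) = 0" for k
  proof -
    have "0 = Sf k * \<iota>" by (simp add: Sf0)
    also have "\<dots> = (\<Sum>q\<in>UNIV. \<nu>' q * mono_partial (A k) \<gamma> q)
      + (\<Sum>p\<in>UNIV. \<Sum>e\<in>E. fps_const (a (k, p, e)) * (fps_const (of_nat e) *
        ((\<nu>' (fst p) + \<nu>' (snd p)) * (\<gamma> (fst p) + \<gamma> (snd p)) ^ (e - 1))))"
      unfolding Sf_def \<nu>'_def distrib_right[of _ _ \<iota>] sum_distrib_right
      by (intro arg_cong2[where f="(+)"] sum.cong refl) (simp_all add: algebra_simps)
    also have "(\<Sum>p\<in>UNIV. \<Sum>e\<in>E. fps_const (a (k, p, e)) * (fps_const (of_nat e) *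
        ((\<nu>' (fst p) + \<nu>' (snd p)) * (\<gamma> (fst p) + \<gamma> (snd p)) ^ (e - 1)))) =
        (\<Sum>e\<in>E. fps_const (a (k, (l, m), e)) * (fps_const (of_nat e) * (V * W ^ (e - 1)))) +
        (\<Sum>p\<in>UNIV - {(l, m)}. \<Sum>e\<in>E. fps_const (a (k, p, e)) * (fps_const (of_nat e) *
        ((\<nu>' (fst p) + \<nu>' (snd p)) * (\<gamma> (fst p) + \<gamma> (snd p)) ^ (e - 1))))"
      by (subst sum.remove[of UNIV "(l, m)"]) (simp_all add: V_def W_def)
    finally show ?thesis by (simp add: P_def mult_ac add_ac flip: fps_const_mult)
  qed
  define X1 where "X1 = (\<lambda>(q, e). fps_nth (\<gamma> q) e) ` (UNIV \<times> {..K})"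
  define X2 where "X2 = (\<lambda>(q, e). fps_nth (\<nu>' q) e) ` ((UNIV - {m0}) \<times> {..K})"
  \<comment> \<open>The two pivots enter by their inverses, which an algebra generated by the
    coefficients need not contain; they account for the 2 in the count.\<close>
  define X0 where "X0 = X1 \<union> X2 \<union> {inverse (fps_nth W 1), inverse (fps_nth V 0)}"
  have W: "fps_nth W 0 = 0" "fps_nth W 1 \<noteq> 0" using \<gamma>(2) lm(1) by (simp_all add: W_def)
  have V: "fps_nth V 0 \<noteq> 0"
    using lm(2) m0 by (simp add: V_def \<nu>'_def \<iota>_def flip: distrib_right)
  have cin: "coeffs_in R K (\<gamma> q)" "coeffs_in R K (\<nu>' q)" if "rat_algebra R" "X0 \<subseteq> R" for R q
  proof -
    show "coeffs_in R K (\<gamma> q)" unfolding coeffs_in_def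
      using that(2) by (force simp: X0_def X1_def)
    show "coeffs_in R K (\<nu>' q)"
    proof (cases "q = m0")
      case False
      then show ?thesis unfolding coeffs_in_def using that(2) by (force simp: X0_def X2_def)
    qed (use \<nu>'m0 coeffs_in_closed(2)[OF that(1)] in simp)
  qed
  have "CARD('p) * card E \<le> card X0"
  proof (rule parameter_bound[OF a E(1,2) order_refl, where W=W and V=V and P=P and c="(l, m)"])
    show "finite X0" unfolding X0_def X1_def X2_def by (intro finite_UnI card_coeff_family) auto
    show "coeffs_in R K W \<and> coeffs_in R K V \<and> inverse (fps_nth W 1) \<in> R \<and> inverse (fps_nth V 0) \<in> R"
      if "rat_algebra R" "X0 \<subseteq> R" for R
      using cin[OF that] coeffs_in_closed(4)[OF that(1)] that(2) by (auto simp: X0_def W_def V_def)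
    show "coeffs_in R K (P k)" if "rat_algebra R" "X0 \<subseteq> R" "\<And>c' e. c' \<noteq> (l, m) \<Longrightarrow> e \<in> E \<Longrightarrow> a (k, c', e) \<in> R" for R k
      unfolding P_def
      by (intro coeffs_in_closed[OF that(1)] coeffs_in_mono_partial that(1) cin[OF that(1,2)]
          rat_algebra_closed(3)[OF that(1)] that(3)) auto
  qed (use W V PWV in simp_all)
  also have "card X0 \<le> (card X1 + card X2) + card {inverse (fps_nth W 1), inverse (fps_nth V 0)}"
    unfolding X0_def by (rule order_trans[OF card_Un_le add_right_mono[OF card_Un_le]])
  also have "\<dots> \<le> (n * Suc K + (n - 1) * Suc K) + 2"
    using card_coeff_family(2)[of \<gamma> UNIV K] card_coeff_family(2)[of \<nu>' "UNIV - {m0}" K]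
      card_insert_le_m1[of 2 "{inverse (fps_nth V 0)}" "inverse (fps_nth W 1)"]
    unfolding X1_def X2_def n_def by (intro add_mono) (simp_all add: card_Diff_singleton)
  finally have "2 * n * M \<le> n * Suc K + (n - 1) * Suc K + 2"
    by (simp add: card E(3) n_def)
  moreover obtain n' where "n = Suc n'" using n by (cases n) auto
  ultimately show False by (simp add: M_def K_def algebra_simps)
qed

section \<open>Injectivity along the coordinate axes\<close>

definition root1 :: "nat \<Rightarrow> complex" where
  "root1 d = exp (2 * of_real pi * \<i> / of_nat d)"

lemma root1_power_eq_1: "d \<ge> 1 \<Longrightarrow> root1 d ^ e = 1 \<longleftrightarrow> d dvd e"
  using complex_root_unity_eq_1[of d e]
  by (simp add: root1_def flip: exp_of_nat_mult) (simp add: mult_ac)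

lemma root1_power_eq:
  assumes "d \<ge> 1" "root1 d ^ e = root1 d ^ i" shows "e mod d = i mod d"
proof -
  have *: "e mod d = i mod d" if "i \<le> e" "root1 d ^ e = root1 d ^ i" for e i
  proof -
    have "root1 d ^ (e - i) * root1 d ^ i = root1 d ^ i"
      using that by (simp flip: power_add)
    then have "root1 d ^ (e - i) = 1" by (simp add: root1_def)
    then have "d dvd e - i" using root1_power_eq_1[OF assms(1)] by simp
    then show ?thesis using that(1) by (simp add: mod_eq_dvd_iff_nat)
  qed
  show ?thesis using *[of i e] *[of e i] assms(2) by (cases "i \<le> e") auto
qed

lemma fps_compose_root1:
  fixes F :: "complex fps"
  shows "fps_nth (F oo fps_const c * fps_X) e = c ^ e * fps_nth F e"
  by (simp add: fps_compose_linear)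

text \<open>Reparametrising by the compositional inverse of the part of \<open>F\<close> supported in degrees
  congruent to \<open>1\<close> modulo \<open>d\<close>; this inverse has the same support.\<close>

lemma fps_residue_normal_form:
  fixes F :: "complex fps"
  assumes d: "d \<ge> 2" and F: "fps_nth F 0 = 0" "fps_nth F 1 \<noteq> 0"
  obtains w where "fps_nth w 0 = 0" "\<And>e. e mod d = 1 \<Longrightarrow> fps_nth (F oo w) e = (if e = 1 then 1 else 0)"
    "\<And>G e. (\<And>e'. \<not> d dvd e' \<Longrightarrow> fps_nth G e' = 0) \<Longrightarrow> \<not> d dvd e \<Longrightarrow> fps_nth (G oo w) e = 0"
proof -
  \<comment> \<open>Only degrees congruent to 1 are kept, so \<open>p\<close> commutes with
    multiplication by a root of unity of order \<open>d\<close>.\<close>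
  define p where "p = Abs_fps (\<lambda>e. if e mod d = 1 then fps_nth F e else 0)"
  have p: "fps_nth p 0 = 0" "fps_nth p 1 \<noteq> 0" using d F by (simp_all add: p_def)
  define w where "w = fps_inv p"
  have w0: "fps_nth w 0 = 0" by (simp add: w_def fps_inv_def)
  have wp: "w oo p = fps_X" and pw: "p oo w = fps_X"
    unfolding w_def by (rule fps_inv[OF p] fps_inv_right[OF p])+
  define \<zeta> where "\<zeta> = root1 d"
  define c where "c = inverse \<zeta>"
  have \<zeta>: "\<zeta> \<noteq> 0" "\<zeta> ^ d = 1" using root1_power_eq_1[of d d] d by (auto simp: \<zeta>_def root1_def)
  have c1: "c ^ e = c" if "e mod d = 1" for e
  proof -
    have "e = d * (e div d) + 1" using that by (metis mult_div_mod_eq)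
    then have "\<zeta> ^ e = \<zeta> ^ (d * (e div d) + 1)" by simp
    also have "\<dots> = \<zeta>" using \<zeta>(2) by (simp add: power_add power_mult)
    finally show ?thesis by (simp add: c_def power_inverse)
  qed
  let ?z = "fps_const \<zeta> * fps_X"
  let ?u = "w oo ?z"
  let ?w' = "fps_const c * ?u"
  have u0: "fps_nth ?u 0 = 0" using w0 by (simp add: fps_compose_root1)
  \<comment> \<open>\<open>p\<close> commutes with the rotation, hence \<open>?w'\<close>, the
    conjugate of \<open>w\<close> by it, is another right inverse of \<open>p\<close>; as
    \<open>w\<close> is also a left inverse, the two agree.\<close>
  have "p oo ?w' = (p oo (fps_const c * fps_X)) oo ?u"
    using u0 by (subst fps_compose_assoc[symmetric]) (simp_all add: fps_compose_mult_distrib)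
  also have "p oo (fps_const c * fps_X) = fps_const c * p"
    by (rule fps_ext) (auto simp: fps_compose_root1 p_def c1)
  also have "(fps_const c * p) oo ?u = fps_const c * (p oo ?u)"
    using u0 by (simp add: fps_compose_mult_distrib)
  also have "p oo ?u = (p oo w) oo ?z"
    using w0 by (subst fps_compose_assoc) simp_all
  also have "fps_const c * ((p oo w) oo ?z) = fps_X"
    using \<zeta>(1) by (simp add: pw c_def flip: mult.assoc)
  finally have "p oo ?w' = fps_X" .
  then have "w oo (p oo ?w') = w" by simp
  moreover have "w oo (p oo ?w') = (w oo p) oo ?w'"
    using p u0 by (intro fps_compose_assoc) simp_all
  ultimately have ww: "?w' = w" by (simp add: wp u0 w0)
  have "?u = fps_const \<zeta> * w"
    using \<zeta>(1) by (subst ww[symmetric]) (simp add: c_def flip: mult.assoc)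
  then have wz: "(w ^ i) oo ?z = fps_const (\<zeta> ^ i) * w ^ i" for i
    by (subst fps_compose_power[symmetric]) (simp_all add: power_mult_distrib fps_const_power)
  \<comment> \<open>The rotation multiplies \<open>w ^ i\<close> by \<open>\<zeta> ^ i\<close>, so
    only degrees congruent to \<open>i\<close> occur in it. Composition with \<open>w\<close>
    therefore preserves residue classes of degrees.\<close>
  have supp: "e mod d = i mod d" if "fps_nth (w ^ i) e \<noteq> 0" for i e
  proof -
    have "\<zeta> ^ e * fps_nth (w ^ i) e = \<zeta> ^ i * fps_nth (w ^ i) e"
      using arg_cong[OF wz[of i], of "\<lambda>F. fps_nth F e"] by (simp add: fps_compose_root1)
    then show ?thesis using that root1_power_eq[of d e i] d by (simp add: \<zeta>_def)
  qed
  show thesis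
  proof (rule that[OF w0])
    fix e assume e: "e mod d = 1"
    have "fps_nth (F oo w) e = fps_nth (p oo w) e"
      unfolding fps_compose_nth
    proof (intro sum.cong refl)
      fix i
      show "fps_nth F i * fps_nth (w ^ i) e = fps_nth p i * fps_nth (w ^ i) e"
        using supp[of i e] e by (cases "fps_nth (w ^ i) e = 0") (auto simp: p_def)
    qed
    then show "fps_nth (F oo w) e = (if e = 1 then 1 else 0)" by (simp add: pw fps_X_def)
  next
    fix G :: "complex fps" and e
    assume G: "\<And>e'. \<not> d dvd e' \<Longrightarrow> fps_nth G e' = 0" and e: "\<not> d dvd e"
    show "fps_nth (G oo w) e = 0"
      unfolding fps_compose_nth
    proof (intro sum.neutral ballI)
      fix i
      show "fps_nth G i * fps_nth (w ^ i) e = 0"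
        using supp[of i e] G[of i] e by (cases "fps_nth (w ^ i) e = 0") (auto simp: dvd_eq_mod_eq_0)
    qed
  qed
qed

section \<open>Monomials along a curve as power series\<close>

definition mono_fps :: "('n::finite \<Rightarrow> nat) option \<Rightarrow> ('n \<Rightarrow> complex fps) \<Rightarrow> complex fps" where
  "mono_fps A \<gamma> = (case A of None \<Rightarrow> 0 | Some a \<Rightarrow> \<Prod>q\<in>UNIV. \<gamma> q ^ a q)"

lemma has_fps_expansion_mono_fun:
  assumes "\<And>q. (\<lambda>t. c t $ q) has_fps_expansion \<gamma> q"
  shows "(\<lambda>t. mono_fun A (c t)) has_fps_expansion mono_fps A \<gamma>"
  unfolding mono_fun_def mono_fps_def
  by (cases A) (auto intro!: has_fps_expansion_prod has_fps_expansion_power assms)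

lemma mono_fps_compose:
  assumes "fps_nth w 0 = 0"
  shows "mono_fps A \<gamma> oo w = mono_fps A (\<lambda>q. \<gamma> q oo w)"
  using assms by (cases A) (simp_all add: mono_fps_def fps_compose_prod_distrib fps_compose_power)

lemma coeffs_in_mono_fps:
  assumes "rat_algebra R" "\<And>q. coeffs_in R K (\<gamma> q)"
  shows "coeffs_in R K (mono_fps A \<gamma>)"
  unfolding mono_fps_def
  by (cases A) (auto intro!: coeffs_in_closed[OF assms(1)] assms(2))

lemma coeffs_in_deriv:
  assumes "rat_algebra R" "coeffs_in R (Suc K) F" shows "coeffs_in R K (fps_deriv F)"
  unfolding coeffs_in_def
proof (intro allI impI)
  fix e assume "e \<le> K"
  then have "fps_nth F (e + 1) \<in> R" using assms(2) by (simp add: coeffs_in_def)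
  then have "of_nat (e + 1) * fps_nth F (e + 1) \<in> R" by (intro rat_algebra_closed[OF assms(1)])
  then show "fps_nth (fps_deriv F) e \<in> R" by simp
qed

text \<open>Moving a multiple of \<open>d\<close> down by \<open>d - 1\<close> lands on a degree
  congruent to 1, and every multiple, except possibly the first number of the interval, has a
  non-multiple just before it. The former measures the gain from reparametrisation, the latter says
  that about half of the degrees or more carry equations.\<close>

lemma card_multiples_le:
  fixes d r M :: nat
  assumes "d \<ge> 2"
  shows "card {e\<in>{r+1..r+M}. d dvd e} \<le> card {e. e \<le> r + M + 1 \<and> e mod d = 1}"
    "card {e\<in>{r+1..r+M}. d dvd e} \<le> Suc (card {e\<in>{r+1..r+M}. \<not> d dvd e})"
proof -
  have "(\<lambda>e. e - d + 1) ` {e\<in>{r+1..r+M}. d dvd e} \<subseteq> {e. e \<le> r + M + 1 \<and> e mod d = 1}"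
  proof clarify
    fix e assume e: "e \<in> {r+1..r+M}" "d dvd e"
    then have "d \<le> e" by (auto intro: dvd_imp_le)
    then have "d dvd e - d" using e(2) by (simp add: dvd_diff_nat)
    then have "(e - d + 1) mod d = 1" using assms by (auto simp: dvd_def mod_Suc)
    then show "e - d + 1 \<le> r + M + 1 \<and> (e - d + 1) mod d = 1" using e(1) by auto
  qed
  moreover have "inj_on (\<lambda>e. e - d + 1) {e\<in>{r+1..r+M}. d dvd e}"
  proof (rule inj_onI)
    fix e e' assume "e \<in> {e\<in>{r+1..r+M}. d dvd e}" "e' \<in> {e\<in>{r+1..r+M}. d dvd e}" "e - d + 1 = e' - d + 1"
    moreover from this have "d \<le> e" "d \<le> e'" by (auto intro: dvd_imp_le)
    ultimately show "e = e'" by simp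
  qed
  ultimately show "card {e\<in>{r+1..r+M}. d dvd e} \<le> card {e. e \<le> r + M + 1 \<and> e mod d = 1}"
    by (intro card_inj_on_le) auto
  have sub: "{e\<in>{r+1..r+M}. d dvd e} \<subseteq> insert (r + 1) (Suc ` {e\<in>{r+1..r+M}. \<not> d dvd e})"
  proof
    fix e assume e: "e \<in> {e\<in>{r+1..r+M}. d dvd e}"
    show "e \<in> insert (r + 1) (Suc ` {e\<in>{r+1..r+M}. \<not> d dvd e})"
    proof (cases "e = r + 1")
      case False
      obtain e' where e': "e = Suc e'" using e by (cases e) auto
      have "\<not> d dvd e'"
      proof
        assume "d dvd e'"
        then have "d dvd Suc e' - e'" using e e' by (intro dvd_diff_nat) auto
        then show False using assms by simp
      qed
      then show ?thesis using e e' False by auto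
    qed simp
  qed
  have "card {e\<in>{r+1..r+M}. d dvd e} \<le> card (insert (r + 1) (Suc ` {e\<in>{r+1..r+M}. \<not> d dvd e}))"
    by (rule card_mono[OF _ sub]) simp
  also have "\<dots> \<le> Suc (card (Suc ` {e\<in>{r+1..r+M}. \<not> d dvd e}))" by (rule card_insert_le_m1) simp_all
  finally show "card {e\<in>{r+1..r+M}. d dvd e} \<le> Suc (card {e\<in>{r+1..r+M}. \<not> d dvd e})"
    by (simp add: card_image)
qed

text \<open>If \<open>d\<close> divides all exponents of pure powers of coordinate \<open>i\<close>,
  then \<open>f\<close> on that axis is invariant under \<open>\<zeta>\<close>, and so is the
  perturbed germ along \<open>\<gamma>\<close>: its series lives in degrees divisible by
  \<open>d\<close>. The reparametrisation \<open>w\<close> respects this and prescribes one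
  coordinate in degrees congruent to 1, the saving that decides the count.\<close>

lemma A_finite_imp_gcd_condition:
  fixes f :: "complex^'n \<Rightarrow> complex^'p" and A :: "'p \<Rightarrow> ('n \<Rightarrow> nat) option"
  assumes card: "CARD('p) = 2 * CARD('n)" and f: "A_finite f" "holo_germ f"
    and mono: "\<And>k. \<forall>\<^sub>F z in nhds 0. f z $ k = mono_fun (A k) z" and d: "d \<ge> 2"
  shows "\<exists>k a. A k = Some a \<and> (\<forall>q. q \<noteq> i \<longrightarrow> a q = 0) \<and> \<not> d dvd a i"
proof (rule ccontr)
  assume "\<not> ?thesis"
  then have no: "d dvd a i" if "A k = Some a" "\<And>q. q \<noteq> i \<Longrightarrow> a q = 0" for k a
    using that by blast
  obtain r where r: "\<And>M. \<exists>a \<rho> \<sigma> \<psi>'. alg_indep (UNIV \<times> UNIV \<times> {r + 1..r + M}) a \<and> inverse_germs \<rho> \<sigma> \<and> holo_germ \<psi>' \<and>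
      (\<forall>\<^sub>F z in nhds 0. (\<chi> k. mono_fun (A k) (\<sigma> z)) + perturbation {r + 1..r + M} a (\<sigma> z)
        = \<psi>' (\<chi> k. mono_fun (A k) z))"
    using A_finite_monomial_perturbation[OF f mono] by blast
  define n where "n = CARD('n)"
  have n: "n \<ge> 1" by (simp add: n_def Suc_leI)
  define M where "M = 2 * n * (r + 3) + 3"
  define K where "K = r + M"
  define E where "E = {r + 1..r + M}"
  define E0 where "E0 = {e\<in>E. \<not> d dvd e}"
  have E: "finite E" "E \<subseteq> {1..K}" "card E = M" "E0 \<subseteq> E" by (auto simp: E_def K_def E0_def)
  obtain a :: "'p \<times> ('n \<times> 'n) \<times> nat \<Rightarrow> complex" and \<rho> \<sigma> \<psi>'
    where a: "alg_indep (UNIV \<times> UNIV \<times> E) a" and \<rho>: "inverse_germs \<rho> \<sigma>"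
    and eq: "\<forall>\<^sub>F z in nhds 0. (\<chi> k. mono_fun (A k) (\<sigma> z)) + perturbation E a (\<sigma> z) = \<psi>' (\<chi> k. mono_fun (A k) z)"
    using r[of M] unfolding E_def by blast
  have \<sigma>: "holo_germ \<sigma>" using \<rho> by (simp add: inverse_germs_def)
  define g where "g z = (\<chi> k. mono_fun (A k) (\<sigma> z)) + perturbation E a (\<sigma> z)" for z
  have ev: "\<forall>\<^sub>F t in nhds 0. g (axis i t) = \<psi>' (\<chi> k. mono_fun (A k) (axis i t))"
    by (rule eventually_axis) (use eq in \<open>simp add: g_def\<close>)
  define \<zeta> where "\<zeta> = root1 d"
  have \<zeta>: "\<zeta> ^ e = 1 \<longleftrightarrow> d dvd e" for e using root1_power_eq_1[of d e] d by (simp add: \<zeta>_def)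
  have sym: "mono_fun (A k) (axis i (\<zeta> * t)) = mono_fun (A k) (axis i t)" for k t
  proof (cases "A k")
    case (Some b)
    show ?thesis
    proof (cases "\<forall>q. q \<noteq> i \<longrightarrow> b q = 0")
      case True
      have "(\<Prod>q\<in>UNIV. axis i x $ q ^ b q) = x ^ b i" for x :: complex
      proof -
        have "(\<Prod>q\<in>UNIV. axis i x $ q ^ b q) = (\<Prod>q\<in>{i}. axis i x $ q ^ b q)"
          using True by (intro prod.mono_neutral_right) (auto simp: axis_def)
        then show ?thesis by (simp add: axis_def)
      qed
      moreover have "\<zeta> ^ b i = 1" using no[OF Some] True \<zeta> by blast
      ultimately show ?thesis by (simp add: Some mono_fun_def power_mult_distrib)
    next
      case False
      then obtain q where q: "q \<noteq> i" "b q \<noteq> 0" by blast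
      have *: "(\<Prod>q\<in>UNIV. axis i x $ q ^ b q) = 0" for x :: complex
        by (rule prod_zero) (use q in \<open>auto intro!: bexI[of _ q] simp: axis_def\<close>)
      show ?thesis by (simp only: Some mono_fun_def option.case *)
    qed
  qed (simp add: mono_fun_def)
  have "\<forall>\<^sub>F t in nhds 0. g (axis i (\<zeta> * t)) = \<psi>' (\<chi> k. mono_fun (A k) (axis i (\<zeta> * t)))"
  proof -
    have "((\<lambda>t. \<zeta> * t) \<longlongrightarrow> \<zeta> * 0) (nhds 0)" by (intro tendsto_intros filterlim_ident)
    then show ?thesis by (intro eventually_compose_filterlim[OF ev]) simp
  qed
  with ev have g_sym: "\<forall>\<^sub>F t in nhds 0. g (axis i (\<zeta> * t)) = g (axis i t)"
    by eventually_elim (simp add: sym)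
  obtain \<gamma> where \<gamma>: "\<And>q. (\<lambda>t. \<sigma> (axis i t) $ q) has_fps_expansion \<gamma> q"
    "\<And>q. fps_nth (\<gamma> q) 0 = 0" "\<And>q. fps_nth (\<gamma> q) 1 = partial_deriv i (\<lambda>z. \<sigma> z $ q) 0"
    using axis_curve_expansions[OF \<sigma>] by blast
  define Gf where "Gf \<gamma> k = mono_fps (A k) \<gamma>
    + (\<Sum>p\<in>UNIV. \<Sum>e\<in>E. fps_const (a (k, p, e)) * (\<gamma> (fst p) + \<gamma> (snd p)) ^ e)" for \<gamma> k
  have Gf: "(\<lambda>t. g (axis i t) $ k) has_fps_expansion Gf \<gamma> k" for k
    unfolding g_def Gf_def perturbation_def vector_add_component vec_lambda_beta
    by (intro has_fps_expansion_add has_fps_expansion_sum has_fps_expansion_mult has_fps_expansion_power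
        has_fps_expansion_const has_fps_expansion_mono_fun \<gamma>(1))
  have Gf_zero: "fps_nth (Gf \<gamma> k) e = 0" if "\<not> d dvd e" for k e
  proof -
    have "(\<lambda>t. \<zeta> * t) has_fps_expansion fps_const \<zeta> * fps_X"
      by (intro has_fps_expansion_mult has_fps_expansion_const has_fps_expansion_fps_X)
    from has_fps_expansion_compose[OF Gf this]
    have "(\<lambda>t. g (axis i (\<zeta> * t)) $ k) has_fps_expansion (Gf \<gamma> k oo fps_const \<zeta> * fps_X)"
      by (simp add: o_def)
    moreover have "\<forall>\<^sub>F t in nhds 0. g (axis i (\<zeta> * t)) $ k = g (axis i t) $ k"
      using g_sym by eventually_elim simp
    ultimately have "Gf \<gamma> k oo fps_const \<zeta> * fps_X = Gf \<gamma> k"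
      using has_fps_expansion_unique_ev[OF _ Gf] by blast
    then have "\<zeta> ^ e * fps_nth (Gf \<gamma> k) e = fps_nth (Gf \<gamma> k) e" by (metis fps_compose_root1)
    then show ?thesis using \<zeta>[of e] that by simp
  qed
  obtain l where l: "fps_nth (\<gamma> l) 1 \<noteq> 0"
    using inverse_germs_partial_nonzero[OF \<rho>, of i] \<gamma>(3) by auto
  obtain w where w: "fps_nth w 0 = 0" "\<And>e. e mod d = 1 \<Longrightarrow> fps_nth (\<gamma> l oo w) e = (if e = 1 then 1 else 0)"
    "\<And>G e. (\<And>e'. \<not> d dvd e' \<Longrightarrow> fps_nth G e' = 0) \<Longrightarrow> \<not> d dvd e \<Longrightarrow> fps_nth (G oo w) e = 0"
    by (rule fps_residue_normal_form[OF d \<gamma>(2) l]) blast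
  define \<eta> where "\<eta> q = \<gamma> q oo w" for q
  have Gf_w: "Gf \<gamma> k oo w = Gf \<eta> k" for k
    using w(1) unfolding Gf_def \<eta>_def
    by (simp add: fps_compose_add_distrib fps_compose_sum_distrib fps_compose_mult_distrib mono_fps_compose
        flip: fps_compose_power)
  have zero: "fps_nth (Gf \<eta> k) e = 0" if "\<not> d dvd e" for k e
    using w(3)[OF Gf_zero that] by (simp add: Gf_w)
  have \<eta>0: "fps_nth (\<eta> q) 0 = 0" for q using \<gamma>(2) by (simp add: \<eta>_def)
  have \<eta>l: "fps_nth (\<eta> l) e = (if e = 1 then 1 else 0)" if "e mod d = 1" for e
    using w(2)[OF that] by (simp add: \<eta>_def)
  \<comment> \<open>The form of the index pair \<open>(l, l)\<close>. The normal form makes its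
    leading coefficient 2, so no inverse has to be added to the generators.\<close>
  define W where "W = \<eta> l + \<eta> l"
  define V where "V = fps_deriv W"
  have W: "fps_nth W 0 = 0" "fps_nth W 1 = 2" and V: "fps_nth V 0 = 2"
    using \<eta>0 \<eta>l[of 1] d by (simp_all add: W_def V_def)
  \<comment> \<open>Differentiation turns \<open>W ^ e\<close> into
    \<open>e * W ^ (e - 1) * V\<close>, the shape that the elimination expects. It lowers degrees by
    one, so the coefficients of \<open>\<eta>\<close> are listed up to \<open>Suc K\<close>.\<close>
  define P where "P k = fps_deriv (mono_fps (A k) \<eta>
    + (\<Sum>p\<in>UNIV - {(l, l)}. \<Sum>e\<in>E. fps_const (a (k, p, e)) * (\<eta> (fst p) + \<eta> (snd p)) ^ e))" for k
  have PWV: "P k + (\<Sum>e\<in>E. fps_const (a (k, (l, l), e) * of_nat e) * W ^ (e - 1) * V) = fps_deriv (Gf \<eta> k)" for k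
  proof -
    have "Gf \<eta> k = (mono_fps (A k) \<eta>
      + (\<Sum>p\<in>UNIV - {(l, l)}. \<Sum>e\<in>E. fps_const (a (k, p, e)) * (\<eta> (fst p) + \<eta> (snd p)) ^ e))
      + (\<Sum>e\<in>E. fps_const (a (k, (l, l), e)) * W ^ e)"
      unfolding Gf_def by (subst sum.remove[of UNIV "(l, l)"]) (simp_all add: W_def add_ac)
    then show ?thesis
      by (simp add: P_def V_def fps_deriv_sum fps_deriv_power mult_ac flip: fps_const_mult)
  qed
  define X1 where "X1 = (\<lambda>(q, e). fps_nth (\<eta> q) e) ` ((UNIV - {l}) \<times> {..Suc K})"
  define N1 where "N1 = card {e. e \<le> Suc K \<and> e mod d = 1}"
  \<comment> \<open>Coefficients of \<open>\<eta> l\<close> in degrees congruent to 1 are 0 or 1 and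
    cost nothing.\<close>
  define X2 where "X2 = fps_nth (\<eta> l) ` ({..Suc K} - {e. e \<le> Suc K \<and> e mod d = 1})"
  define X0 where "X0 = X1 \<union> X2"
  have cin: "coeffs_in R (Suc K) (\<eta> q)" if R: "rat_algebra R" "X0 \<subseteq> R" for R q
    unfolding coeffs_in_def
  proof (intro allI impI)
    fix e assume e: "e \<le> Suc K"
    show "fps_nth (\<eta> q) e \<in> R"
    proof (cases "q = l")
      case False
      then show ?thesis using R(2) e by (force simp: X0_def X1_def)
    next
      case True
      show ?thesis
      proof (cases "e mod d = 1")
        case False
        then show ?thesis using R(2) e True by (force simp: X0_def X2_def)
      qed (use True \<eta>l rat_algebra_closed[OF R(1)] in simp)
    qed
  qed
  have "CARD('p) * card E0 \<le> card X0"
  proof (rule parameter_bound[OF a E(1,2,4), where W=W and V=V and P=P and c="(l, l)"])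
    show "finite X0" unfolding X0_def X1_def X2_def by (intro finite_UnI card_coeff_family) auto
    show "coeffs_in R K W \<and> coeffs_in R K V \<and> inverse (fps_nth W 1) \<in> R \<and> inverse (fps_nth V 0) \<in> R"
      if R: "rat_algebra R" "X0 \<subseteq> R" for R
    proof -
      have *: "coeffs_in R (Suc K) W" unfolding W_def by (intro coeffs_in_closed[OF R(1)] cin[OF R])
      then have "coeffs_in R K W" by (simp add: coeffs_in_def)
      moreover have "inverse (2::complex) \<in> R" using rat_algebra_closed(9)[OF R(1), of 2] by simp
      ultimately show ?thesis unfolding V_def W(2) V[unfolded V_def] using coeffs_in_deriv[OF R(1) *] by simp
    qed
    show "coeffs_in R K (P k)" if R: "rat_algebra R" "X0 \<subseteq> R" "\<And>c' e. c' \<noteq> (l, l) \<Longrightarrow> e \<in> E \<Longrightarrow> a (k, c', e) \<in> R" for R k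
      unfolding P_def
      by (intro coeffs_in_deriv R(1) coeffs_in_closed[OF R(1)] coeffs_in_mono_fps cin[OF R(1,2)] R(3)) auto
    fix k e assume "e \<in> E0"
    then have "\<not> d dvd e" "e \<ge> 1" by (auto simp: E0_def E_def)
    then show "fps_nth (P k + (\<Sum>e'\<in>E. fps_const (a (k, (l, l), e') * of_nat e') * W ^ (e' - 1) * V)) (e - 1) = 0"
      unfolding PWV using zero[of e k] by simp
  qed (use W V in simp_all)
  also have "card X0 \<le> card X1 + card X2" unfolding X0_def by (rule card_Un_le)
  also have "\<dots> \<le> (n - 1) * Suc (Suc K) + (Suc (Suc K) - N1)"
  proof (rule add_mono)
    show "card X1 \<le> (n - 1) * Suc (Suc K)"
      using card_coeff_family(2)[of \<eta> "UNIV - {l}" "Suc K"]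
      by (simp add: X1_def n_def card_Diff_singleton)
    have "card X2 \<le> card ({..Suc K} - {e. e \<le> Suc K \<and> e mod d = 1})"
      unfolding X2_def by (rule card_image_le) simp
    also have "\<dots> = Suc (Suc K) - N1" unfolding N1_def by (subst card_Diff_subset) auto
    finally show "card X2 \<le> Suc (Suc K) - N1" .
  qed
  finally have main: "2 * n * card E0 \<le> (n - 1) * Suc (Suc K) + (Suc (Suc K) - N1)"
    by (simp add: card n_def)
  define N0 where "N0 = card {e\<in>E. d dvd e}"
  have N0: "N0 \<le> N1" "N0 \<le> Suc (card E0)"
    using card_multiples_le[OF d, of r M] by (simp_all add: N0_def N1_def E0_def E_def K_def)
  have N1: "N1 \<le> Suc (Suc K)"
    unfolding N1_def using card_mono[of "{..Suc K}" "{e. e \<le> Suc K \<and> e mod d = 1}"] by auto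
  have sum: "N0 + card E0 = M"
  proof -
    have "E = {e\<in>E. d dvd e} \<union> E0" by (auto simp: E0_def)
    then have "card E = N0 + card E0"
      unfolding N0_def by (subst card_Un_disjoint[symmetric]) (use E(1) in \<open>auto simp: E0_def\<close>)
    then show ?thesis using E(3) by simp
  qed
  \<comment> \<open>The excess of non-multiples over multiples, raised by one to be a natural
    number. After substitution the terms \<open>2 * n * N0\<close> cancel and
    \<open>n * y + N0 \<le> n * (r + 3)\<close> is left; this bounds \<open>M\<close> because
    \<open>M = 2 * N0 + y - 1\<close>.\<close>
  obtain y where y: "Suc (card E0) = N0 + y" using N0(2) le_Suc_ex by blast
  obtain n' where n': "n = Suc n'" using n by (cases n) auto
  have "2 * n * card E0 + N1 \<le> n * Suc (Suc K)"
    using main N1 by (simp add: n' algebra_simps)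
  then have "2 * n * card E0 + N0 \<le> n * (r + M + 2)" using N0(1) by (simp add: K_def)
  then have "int (2 * n * card E0 + N0) \<le> int (n * (r + M + 2))" by (simp only: of_nat_le_iff)
  moreover have "int (card E0) = int N0 + int y - 1" using y by linarith
  moreover have "int M = 2 * int N0 + int y - 1" using y sum by linarith
  ultimately have *: "int n * int y + int N0 \<le> int n * (int r + 3)"
    by (simp add: algebra_simps)
  have "int y \<le> int n * int y" using n by (simp add: mult_le_cancel_right1)
  with * have "2 * int N0 + int y \<le> 2 * (int n * (int r + 3))" using zero_le_mult_iff[of "int n" "int y"] by linarith
  then have "int M + 1 \<le> 2 * (int n * (int r + 3))" using \<open>int M = 2 * int N0 + int y - 1\<close> by linarith
  then show False by (simp add: M_def algebra_simps)
qed

section \<open>Monomial germs\<close>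

lemma inverse_germs_permute:
  assumes "bij \<theta>"
  shows "inverse_germs (\<lambda>W. \<chi> p. W $ \<theta> p) (\<lambda>W. \<chi> p. W $ inv \<theta> p)"
  using assms
  by (simp add: inverse_germs_def holo_germ_select vec_eq_iff bij_is_surj surj_f_inv_f bij_is_inj inv_f_f)

definition unit_exp :: "'n \<Rightarrow> 'n \<Rightarrow> nat" where
  "unit_exp j = (\<lambda>q. if q = j then 1 else 0)"

lemma mono_fun_unit_exp: "mono_fun (Some (unit_exp j)) z = z $ j"
proof -
  have "(\<Prod>q\<in>UNIV. z $ q ^ unit_exp j q) = (\<Prod>q\<in>UNIV. if q = j then z $ q else 1)"
    by (intro prod.cong) (auto simp: unit_exp_def)
  then show ?thesis by (simp add: mono_fun_def)
qed

text \<open>Components are sorted by the support of their monomial: different supports give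
  different components, which is what makes counting them possible.\<close>

definition comps :: "('p \<Rightarrow> ('n \<Rightarrow> nat) option) \<Rightarrow> 'n set \<Rightarrow> 'p set" where
  "comps A B = {k. \<exists>a. A k = Some a \<and> {q. a q \<noteq> 0} = B}"

lemma comps_disjoint: "k \<in> comps A B \<Longrightarrow> k \<in> comps A B' \<Longrightarrow> B = B'"
  by (auto simp: comps_def)

lemma mono_fun_pure:
  assumes "\<And>q. q \<noteq> i \<Longrightarrow> a q = 0" shows "mono_fun (Some a) z = z $ i ^ a i"
proof -
  have "(\<Prod>q\<in>UNIV. z $ q ^ a q) = (\<Prod>q\<in>{i}. z $ q ^ a q)"
    using assms by (intro prod.mono_neutral_right) auto
  then show ?thesis by (simp add: mono_fun_def)
qed

lemma mono_fun_pair: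
  assumes "i \<noteq> j" "\<And>q. q \<noteq> i \<Longrightarrow> q \<noteq> j \<Longrightarrow> a q = 0"
  shows "mono_fun (Some a) z = z $ i ^ a i * z $ j ^ a j"
proof -
  have "(\<Prod>q\<in>UNIV. z $ q ^ a q) = (\<Prod>q\<in>{i, j}. z $ q ^ a q)"
    using assms(2) by (intro prod.mono_neutral_right) auto
  then show ?thesis using assms(1) by (simp add: mono_fun_def)
qed

text \<open>The hypothesis says that the exponents of pure powers of coordinate \<open>i\<close>
  have greatest common divisor 1. Taking for \<open>d\<close> the exponent of one of them produces a
  second one, unless that exponent is 1.\<close>

lemma pure_exponents:
  fixes A :: "'p \<Rightarrow> ('n \<Rightarrow> nat) option"
  assumes B: "\<And>i d. d \<ge> 2 \<Longrightarrow> \<exists>k a. A k = Some a \<and> (\<forall>q. q \<noteq> i \<longrightarrow> a q = 0) \<and> \<not> d dvd a i"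
  shows "\<exists>k. k \<in> comps A {i}"
    and "\<not> (\<exists>k. A k = Some (unit_exp i)) \<Longrightarrow> \<exists>k k'. k \<in> comps A {i} \<and> k' \<in> comps A {i} \<and> k \<noteq> k'"
proof -
  have *: "\<exists>k a. A k = Some a \<and> {q. a q \<noteq> 0} = {i} \<and> \<not> d dvd a i" if d: "d \<ge> 2" for d
  proof -
    obtain k a where "A k = Some a" "\<forall>q. q \<noteq> i \<longrightarrow> a q = 0" "\<not> d dvd a i" using B[OF d] by blast
    moreover from this(3) have "a i \<noteq> 0" by (metis dvd_0_right)
    ultimately show ?thesis by (intro exI[of _ k] exI[of _ a]) auto
  qed
  obtain k a where k: "A k = Some a" "{q. a q \<noteq> 0} = {i}" using *[of 2] by auto
  then have k_in: "k \<in> comps A {i}" by (auto simp: comps_def)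
  then show "\<exists>k. k \<in> comps A {i}" ..
  assume no: "\<not> (\<exists>k. A k = Some (unit_exp i))"
  have a0: "a q = 0" if "q \<noteq> i" for q using k(2) that by blast
  have ai: "a i \<noteq> 0" using k(2) by blast
  have "a i \<noteq> 1"
  proof
    assume "a i = 1"
    then have "a = unit_exp i" using a0 by (simp add: unit_exp_def fun_eq_iff)
    then show False using no k(1) by blast
  qed
  then have "a i \<ge> 2" using ai by simp
  from *[OF this] obtain k' a' where k': "A k' = Some a'" "{q. a' q \<noteq> 0} = {i}" "\<not> a i dvd a' i" by blast
  then have "k' \<noteq> k" using k(1) by auto
  moreover have "k' \<in> comps A {i}" using k' by (auto simp: comps_def)
  ultimately show "\<exists>k k'. k \<in> comps A {i} \<and> k' \<in> comps A {i} \<and> k \<noteq> k'" using k_in by blast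
qed

lemma mixed_component:
  assumes "\<exists>k a. A k = Some a \<and> a j = 1 \<and> (\<forall>q. q \<noteq> i \<longrightarrow> q \<noteq> j \<longrightarrow> a q = 0)"
    and no: "\<not> (\<exists>k. A k = Some (unit_exp j))"
  shows "\<exists>k a. A k = Some a \<and> a j = 1 \<and> {q. a q \<noteq> 0} = {j, i}"
proof -
  obtain k a where a: "A k = Some a" "a j = 1" "\<forall>q. q \<noteq> i \<longrightarrow> q \<noteq> j \<longrightarrow> a q = 0"
    using assms(1) by blast
  have "a i \<noteq> 0"
  proof
    assume "a i = 0"
    then have "a q = 0" if "q \<noteq> j" for q using a(3) that by (cases "q = i") auto
    then have "a = unit_exp j" using a(2) by (simp add: unit_exp_def fun_eq_iff)
    then show False using no a(1) by blast
  qed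
  then show ?thesis using a by (intro exI[of _ k] exI[of _ a]) auto
qed

text \<open>Two coordinates that are not components would require \<open>n\<close> pure powers, two
  more pure powers, and \<open>n - 1\<close> plus \<open>n - 2\<close> mixed monomials:
  \<open>3 * n - 1\<close> components, more than \<open>2 * n\<close> once
  \<open>n \<ge> 2\<close>.\<close>

lemma at_most_one_nonlinear:
  fixes A :: "'p::finite \<Rightarrow> ('n::finite \<Rightarrow> nat) option"
  assumes card: "CARD('p) = 2 * CARD('n)"
    and CA: "\<And>i j. i \<noteq> j \<Longrightarrow> \<exists>k a. A k = Some a \<and> a j = 1 \<and> (\<forall>q. q \<noteq> i \<longrightarrow> q \<noteq> j \<longrightarrow> a q = 0)"
    and CB: "\<And>i d. d \<ge> 2 \<Longrightarrow> \<exists>k a. A k = Some a \<and> (\<forall>q. q \<noteq> i \<longrightarrow> a q = 0) \<and> \<not> d dvd a i"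
    and no: "\<not> (\<exists>k. A k = Some (unit_exp j1))" "\<not> (\<exists>k. A k = Some (unit_exp j2))"
  shows "j1 = j2"
proof (rule ccontr)
  assume ne: "j1 \<noteq> j2"
  have mixed: "\<exists>k. k \<in> comps A {j, i}" if "i \<noteq> j" "\<not> (\<exists>k. A k = Some (unit_exp j))" for i j
    using mixed_component[OF CA[OF that(1)] that(2)] by (auto simp: comps_def)
  have "\<exists>k. k \<in> comps A {i}" for i by (rule pure_exponents(1)[OF CB])
  then obtain p0 where p0: "\<And>i. p0 i \<in> comps A {i}" by metis
  have "\<exists>k. k \<in> comps A {j} \<and> k \<noteq> p0 j" if "j \<in> {j1, j2}" for j
    using pure_exponents(2)[OF CB, of j] no that by (metis insertE singletonD)
  then obtain p1 where p1: "\<And>j. j \<in> {j1, j2} \<Longrightarrow> p1 j \<in> comps A {j} \<and> p1 j \<noteq> p0 j" by metis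
  have "\<exists>k. k \<in> comps A {j1, i}" if "i \<noteq> j1" for i using mixed[OF that no(1)] .
  then obtain p2 where p2: "\<And>i. i \<noteq> j1 \<Longrightarrow> p2 i \<in> comps A {j1, i}" by metis
  have "\<exists>k. k \<in> comps A {j2, i}" if "i \<noteq> j2" for i using mixed[OF that no(2)] .
  then obtain p3 where p3: "\<And>i. i \<noteq> j2 \<Longrightarrow> p3 i \<in> comps A {j2, i}" by metis
  define S0 where "S0 = range p0"
  define S1 where "S1 = p1 ` {j1, j2}"
  define S2 where "S2 = p2 ` (UNIV - {j1})"
  \<comment> \<open>\<open>j1\<close> is left out because the product of the coordinates
    \<open>j1\<close> and \<open>j2\<close> may serve both.\<close>
  define S3 where "S3 = p3 ` (UNIV - {j1, j2})"
  have inj: "inj p0" "inj_on p1 {j1, j2}" "inj_on p2 (UNIV - {j1})" "inj_on p3 (UNIV - {j1, j2})"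
  proof -
    show "inj p0" by (rule injI) (metis p0 comps_disjoint singleton_inject)
    show "inj_on p1 {j1, j2}" by (rule inj_onI) (metis p1 comps_disjoint singleton_inject)
    show "inj_on p2 (UNIV - {j1})"
      by (rule inj_onI) (metis p2 comps_disjoint doubleton_eq_iff DiffD2 singletonI)
    show "inj_on p3 (UNIV - {j1, j2})"
      by (rule inj_onI) (metis p3 comps_disjoint doubleton_eq_iff DiffD2 insertI1 insertI2)
  qed
  have c: "card S0 = CARD('n)" "card S1 = 2" "card S2 = CARD('n) - 1" "card S3 = CARD('n) - 2"
    using inj ne by (simp_all add: S0_def S1_def S2_def S3_def card_image card_Diff_subset)
  have k0: "\<exists>i. k \<in> comps A {i} \<and> k = p0 i" if "k \<in> S0" for k using that p0 by (auto simp: S0_def)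
  have k1: "\<exists>i. k \<in> comps A {i} \<and> k \<noteq> p0 i" if "k \<in> S1" for k using that p1 by (auto simp: S1_def)
  have k2: "\<exists>i. i \<noteq> j1 \<and> k \<in> comps A {j1, i}" if "k \<in> S2" for k using that p2 by (auto simp: S2_def)
  have k3: "\<exists>i. i \<noteq> j1 \<and> i \<noteq> j2 \<and> k \<in> comps A {j2, i}" if "k \<in> S3" for k using that p3 by (auto simp: S3_def)
  have d01: "S0 \<inter> S1 = {}" using k0 k1 comps_disjoint by (metis disjoint_iff singleton_inject)
  have d23: "S2 \<inter> S3 = {}"
  proof -
    have False if kS: "k \<in> S2" "k \<in> S3" for k
    proof -
      obtain i i' where "k \<in> comps A {j1, i}" "i' \<noteq> j1" "k \<in> comps A {j2, i'}"
        using k2[OF kS(1)] k3[OF kS(2)] by blast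
      then have "{j1, i} = {j2, i'}" by (metis comps_disjoint)
      then show False using ne \<open>i' \<noteq> j1\<close> by auto
    qed
    then show ?thesis by blast
  qed
  have d: "(S0 \<union> S1) \<inter> (S2 \<union> S3) = {}"
  proof -
    have False if kS: "k \<in> S0 \<union> S1" "k \<in> S2 \<union> S3" for k
    proof -
      obtain i where i: "k \<in> comps A {i}" using kS(1) k0 k1 by blast
      obtain x y where xy: "x \<noteq> y" "k \<in> comps A {x, y}" using kS(2) k2 k3 by (metis Un_iff)
      have "{i} = {x, y}" using comps_disjoint[OF i xy(2)] .
      then show False using xy(1) by auto
    qed
    then show ?thesis by blast
  qed
  have fin: "finite S" for S :: "'p set" by simp
  have "card ((S0 \<union> S1) \<union> (S2 \<union> S3)) = CARD('n) + 2 + ((CARD('n) - 1) + (CARD('n) - 2))"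
    by (simp only: card_Un_disjoint[OF fin fin d] card_Un_disjoint[OF fin fin d01] card_Un_disjoint[OF fin fin d23] c)
  moreover have "card ((S0 \<union> S1) \<union> (S2 \<union> S3)) \<le> CARD('p)" by (rule card_mono) auto
  moreover have "CARD('n) \<ge> 2"
    using card_mono[of UNIV "{j1, j2}"] ne by simp
  ultimately show False using card by linarith
qed

section \<open>Reduction to the normal forms by permutations and shears\<close>

lemma permuted_A_equivalent:
  fixes f :: "complex^'n \<Rightarrow> complex^'p" and t :: "nat \<Rightarrow> 'p" and c :: "complex^'n \<Rightarrow> nat \<Rightarrow> complex"
  assumes t: "bij_betw t {1..N} UNIV" and \<kappa>: "bij_betw \<kappa> {1..N} UNIV" and \<pi>: "bij \<pi>"
    and c: "\<forall>\<^sub>F z in nhds 0. \<forall>k\<in>{1..N}. f (\<chi> q. z $ \<pi> q) $ \<kappa> k = c z k"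
  shows "A_equivalent f (\<lambda>z. coord_vec N t (c z))"
proof -
  define \<theta> where "\<theta> = \<kappa> \<circ> the_inv_into {1..N} t"
  have "bij \<theta>" unfolding \<theta>_def
    using bij_betw_trans[OF bij_betw_the_inv_into[OF t] \<kappa>] .
  then have "biholo_germ (\<lambda>W :: complex^'p. \<chi> p. W $ \<theta> p)"
    unfolding biholo_germ_def using inverse_germs_permute by blast
  moreover have "inverse_germs (\<lambda>z :: complex^'n. \<chi> q. z $ inv \<pi> q) (\<lambda>z. \<chi> q. z $ \<pi> q)"
    by (rule inverse_germs_sym[OF inverse_germs_permute[OF \<pi>]])
  moreover have "\<forall>\<^sub>F z in nhds 0. coord_vec N t (c z) = (\<chi> p. f (\<chi> q. z $ \<pi> q) $ \<theta> p)"
    using c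
  proof eventually_elim
    case (elim z)
    show ?case unfolding vec_eq_iff
      using elim the_inv_into_bij_betw(1)[OF t] by (simp add: coord_vec_def \<theta>_def)
  qed
  ultimately show ?thesis unfolding A_equivalent_def by blast
qed

lemma A_equivalent_trans_left:
  assumes "biholo_germ \<phi>" "A_equivalent (\<lambda>z. \<phi> (f z)) F"
  shows "A_equivalent f F"
proof -
  obtain \<rho> \<sigma> \<psi> where *: "inverse_germs \<rho> \<sigma>" "biholo_germ \<psi>" "\<forall>\<^sub>F z in nhds 0. F z = \<psi> (\<phi> (f (\<sigma> z)))"
    using assms(2) unfolding A_equivalent_def by blast
  have "biholo_germ (\<lambda>z. \<psi> (\<phi> z))" by (rule biholo_germ_compose[OF assms(1) *(2)])
  then show ?thesis using *(1,3) unfolding A_equivalent_def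
    by (intro exI[of _ \<rho>] exI[of _ \<sigma>] exI[of _ "\<lambda>z. \<psi> (\<phi> z)"]) simp
qed

text \<open>Once all coordinates occur as components, every other component is a function of these
  and can be subtracted by a shear of the target, whose inverse adds it back.\<close>

lemma monomial_immersion:
  fixes f :: "complex^'n \<Rightarrow> complex^'p" and A :: "'p \<Rightarrow> ('n \<Rightarrow> nat) option"
  assumes s: "bij_betw s {1..n} UNIV" and t: "bij_betw t {1..2 * n} UNIV" and f: "holo_germ f"
    and mono: "\<And>k. \<forall>\<^sub>F z in nhds 0. f z $ k = mono_fun (A k) z"
    and lin: "\<And>j. \<exists>k. A k = Some (unit_exp j)"
  shows "A_equivalent f (immersion_form n s t)"
proof -
  obtain c where c: "\<And>j. A (c j) = Some (unit_exp j)" using lin by metis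
  have unit_inj: "unit_exp i = unit_exp j \<Longrightarrow> i = j" for i j :: 'n
    by (metis unit_exp_def zero_neq_one)
  have injc: "inj c" by (rule injI) (metis c option.inject unit_inj)
  have cn: "CARD('n) = n" "CARD('p) = 2 * n"
    using bij_betw_same_card[OF s] bij_betw_same_card[OF t] by simp_all
  have zero: "mono_fun (A k) 0 = 0" for k
    using eventually_nhds_x_imp_x[OF mono[of k]] f by (simp add: holo_germ_def)
  define \<tau> :: "complex^'p \<Rightarrow> complex^'n" where "\<tau> W = (\<chi> q. W $ c q)" for W
  have \<tau>: "holo_germ \<tau>" unfolding \<tau>_def by (rule holo_germ_select)
  define shear where "shear \<epsilon> W = (\<chi> p. if p \<in> range c then W $ p else W $ p + \<epsilon> * mono_fun (A p) (\<tau> W))"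
    for \<epsilon> :: complex and W :: "complex^'p"
  have hol: "holo_germ (shear \<epsilon>)" for \<epsilon>
    unfolding holo_germ_iff
  proof (intro conjI allI)
    have "\<tau> 0 = 0" using \<tau> by (simp add: holo_germ_def)
    then have "mono_fun (A p) (\<tau> 0) = 0" for p by (simp only: zero)
    then show "shear \<epsilon> 0 = 0" by (simp add: shear_def vec_eq_iff)
    fix p
    have "chol_at (\<lambda>W. shear \<epsilon> W $ p) W" for W
    proof (cases "p \<in> range c")
      case False
      have "chol_at (\<lambda>W. mono_fun (A p) (\<tau> W)) W"
        by (rule chol_at_compose[of \<tau>]) (simp_all add: \<tau>_def chol_at_mono_fun)
      then show ?thesis
        using False by (simp add: shear_def chol_at_add chol_at_mult)
    qed (simp add: shear_def)
    then show "cgerm (\<lambda>W. shear \<epsilon> W $ p)" by simp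
  qed
  have \<tau>_shear: "\<tau> (shear \<epsilon> W) = \<tau> W" for \<epsilon> W by (simp add: \<tau>_def shear_def)
  have "shear (- \<epsilon>) (shear \<epsilon> W) $ p = W $ p" for \<epsilon> W p
    unfolding shear_def[of "- \<epsilon>"] \<tau>_shear by (simp add: shear_def)
  then have "shear (- \<epsilon>) (shear \<epsilon> W) = W" for \<epsilon> W by (simp add: vec_eq_iff)
  from this[of "-1"] this[of 1] have inv: "shear 1 (shear (-1) W) = W" "shear (-1) (shear 1 W) = W" for W by simp_all
  have "inverse_germs (shear (-1)) (shear 1)" using hol inv by (simp add: inverse_germs_def)
  then have bi: "biholo_germ (shear (-1))" unfolding biholo_germ_def by blast
  have "bij_betw (c \<circ> s) {1..n} (range c)"
    using bij_betw_trans[OF s, of c "range c"] injc by (simp add: inj_imp_bij_betw_inv bij_betw_def)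
  moreover obtain h where "bij_betw h {n + 1..2 * n} (UNIV - range c)"
  proof -
    have "card (UNIV - range c) = card {n + 1..2 * n}"
      using injc cn by (simp add: card_Diff_subset card_image)
    then show ?thesis using that finite_same_card_bij[of "{n + 1..2 * n}" "UNIV - range c"] by auto
  qed
  ultimately have "bij_betw (\<lambda>k. if k \<in> {1..n} then (c \<circ> s) k else h k) ({1..n} \<union> {n + 1..2 * n}) (range c \<union> (UNIV - range c))"
    by (rule bij_betw_disjoint_Un) auto
  moreover have "{1..n} \<union> {n + 1..2 * n} = {1..2 * n}" by auto
  ultimately have \<kappa>: "bij_betw (\<lambda>k. if k \<in> {1..n} then (c \<circ> s) k else h k) {1..2 * n} UNIV" by simp
  have hr: "h k \<notin> range c" if "k \<in> {n + 1..2 * n}" for k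
    using bij_betw_apply[OF \<open>bij_betw h {n + 1..2 * n} (UNIV - range c)\<close> that] by simp
  have "\<forall>\<^sub>F z in nhds 0. \<forall>k. f z $ k = mono_fun (A k) z"
    using mono by (simp add: eventually_all_iff)
  then have "\<forall>\<^sub>F z in nhds 0. \<forall>k\<in>{1..2 * n}.
      shear (-1) (f (\<chi> q. z $ id q)) $ (if k \<in> {1..n} then (c \<circ> s) k else h k) = (if k \<le> n then z $ s k else 0)"
  proof eventually_elim
    case (elim z)
    have "\<tau> (f z) = z" using elim by (simp add: \<tau>_def vec_eq_iff c mono_fun_unit_exp)
    then show ?case using elim hr by (auto simp: shear_def c mono_fun_unit_exp)
  qed
  from permuted_A_equivalent[OF t \<kappa> bij_id this]
  have "A_equivalent (\<lambda>z. shear (-1) (f z)) (\<lambda>z. coord_vec (2 * n) t (\<lambda>k. if k \<le> n then z $ s k else 0))" .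
  then show ?thesis
    unfolding immersion_form_def[abs_def] by (rule A_equivalent_trans_left[OF bi])
qed

text \<open>The required components, \<open>n - 1\<close> coordinates, two powers of
  \<open>y\<close> and \<open>n - 1\<close> mixed monomials, already number \<open>2 * n\<close>. So
  there are no others, which fixes the shape and forces the two pure exponents of \<open>y\<close>
  to be coprime.\<close>

lemma monomial_singular:
  fixes f :: "complex^'n \<Rightarrow> complex^'p" and A :: "'p \<Rightarrow> ('n \<Rightarrow> nat) option"
  assumes n: "n \<ge> 2" and s: "bij_betw s {1..n} UNIV" and t: "bij_betw t {1..2 * n} UNIV"
    and mono: "\<And>k. \<forall>\<^sub>F z in nhds 0. f z $ k = mono_fun (A k) z"
    and CA: "\<And>i j. i \<noteq> j \<Longrightarrow> \<exists>k a. A k = Some a \<and> a j = 1 \<and> (\<forall>q. q \<noteq> i \<longrightarrow> q \<noteq> j \<longrightarrow> a q = 0)"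
    and CB: "\<And>i d. d \<ge> 2 \<Longrightarrow> \<exists>k a. A k = Some a \<and> (\<forall>q. q \<noteq> i \<longrightarrow> a q = 0) \<and> \<not> d dvd a i"
    and y: "\<not> (\<exists>k. A k = Some (unit_exp y))" and lin: "\<And>j. j \<noteq> y \<Longrightarrow> \<exists>k. A k = Some (unit_exp j)"
  shows "\<exists>m1 m2 l. m1 > 0 \<and> m2 > 0 \<and> gcd m1 m2 = 1 \<and> (\<forall>i\<in>{1..n - 1}. l i \<ge> 1) \<and>
    A_equivalent f (singular_form n s t m1 m2 l)"
proof -
  \<comment> \<open>Moves the exceptional coordinate \<open>y\<close> to the last place
    \<open>s n\<close>.\<close>
  define \<pi> where "\<pi> = Transposition.transpose y (s n)"
  have \<pi>: "bij \<pi>" "\<pi> y = s n" "\<And>q. \<pi> (\<pi> q) = q" by (simp_all add: \<pi>_def)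
  define q where "q k = \<pi> (s k)" for k
  have s_inj: "s i = s j \<Longrightarrow> i = j" if "i \<in> {1..n}" "j \<in> {1..n}" for i j
    using s that by (auto simp: bij_betw_def dest: inj_onD)
  have q_inj: "q i = q j \<Longrightarrow> i = j" if "i \<in> {1..n}" "j \<in> {1..n}" for i j
    using s_inj[OF that] \<pi>(3) unfolding q_def by metis
  have qn: "q n = y" unfolding q_def using \<pi>(2,3) by metis
  have qy: "q k \<noteq> y" if "k \<in> {1..<n}" for k
    using q_inj[of k n] that n qn by auto
  have qy2: "q (k - (n + 1)) \<noteq> y" if "k \<in> {1..2 * n}" "k > n + 1" for k
  proof (rule qy)
    show "k - (n + 1) \<in> {1..<n}" using that by auto
  qed
  have \<pi>q: "\<pi> (q k) = s k" for k by (simp add: q_def \<pi>(3))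
  obtain k1 k2 where k12: "k1 \<in> comps A {y}" "k2 \<in> comps A {y}" "k1 \<noteq> k2"
    using pure_exponents(2)[OF CB y] by blast
  then obtain a1 a2 where a12: "A k1 = Some a1" "{q. a1 q \<noteq> 0} = {y}" "A k2 = Some a2" "{q. a2 q \<noteq> 0} = {y}"
    by (auto simp: comps_def)
  have "\<forall>j. \<exists>k. j \<noteq> y \<longrightarrow> A k = Some (unit_exp j)" using lin by blast
  then obtain c where c: "\<And>j. j \<noteq> y \<Longrightarrow> A (c j) = Some (unit_exp j)" by metis
  have "\<exists>k a. A k = Some a \<and> a y = 1 \<and> {q. a q \<noteq> 0} = {y, i}" if "i \<noteq> y" for i
    by (rule mixed_component[OF CA[OF that] y])
  then obtain e b where eb: "\<And>i. i \<noteq> y \<Longrightarrow> A (e i) = Some (b i) \<and> b i y = 1 \<and> {q. b i q \<noteq> 0} = {y, i}" by metis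
  \<comment> \<open>Lists the components in the order of the normal form. Injectivity comes from
    distinct supports, except for the two pure powers of \<open>y\<close>, which differ by
    choice.\<close>
  define \<kappa> where "\<kappa> k = (if k < n then c (q k) else if k = n then k1 else if k = n + 1 then k2
    else e (q (k - (n + 1))))" for k
  have kin: "\<kappa> k \<in> comps A (if k < n then {q k} else if k \<le> n + 1 then {y} else {y, q (k - (n + 1))})"
    if "k \<in> {1..2 * n}" for k
  proof -
    have ck: "c j \<in> comps A {j}" if "j \<noteq> y" for j
      using c[OF that] by (auto simp: comps_def unit_exp_def)
    have ek: "e j \<in> comps A {y, j}" if "j \<noteq> y" for j
      using eb[OF that] by (auto simp: comps_def)
    consider "k < n" | "k = n" | "k = n + 1" | "k > n + 1" by linarith
    then show ?thesis
    proof cases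
      case 1
      then show ?thesis using ck[OF qy[of k]] that by (simp add: \<kappa>_def)
    next
      case 4
      from ek[OF qy2[OF that]] 4 show ?thesis by (simp add: \<kappa>_def)
    qed (use k12 in \<open>simp_all add: \<kappa>_def\<close>)
  qed
  have inj: "inj_on \<kappa> {1..2 * n}"
  proof (rule inj_onI)
    fix i j assume ij: "i \<in> {1..2 * n}" "j \<in> {1..2 * n}" and eq: "\<kappa> i = \<kappa> j"
    have supp: "(if i < n then {q i} else if i \<le> n + 1 then {y} else {y, q (i - (n + 1))}) =
        (if j < n then {q j} else if j \<le> n + 1 then {y} else {y, q (j - (n + 1))})"
      by (rule comps_disjoint[OF kin[OF ij(1)] kin[OF ij(2), folded eq]])
    consider "i < n" | "i = n \<or> i = n + 1" | "i > n + 1" by linarith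
    then show "i = j"
    proof cases
      case 1
      then have qi: "q i \<noteq> y" using qy ij by auto
      have "j < n"
        using supp 1 qi by (auto split: if_splits)
      then show ?thesis using supp 1 q_inj[of i j] ij by auto
    next
      case 2
      have "j = n \<or> j = n + 1"
      proof -
        have "\<not> j < n" using supp 2 qy[of j] ij by auto
        moreover have "\<not> j > n + 1" using supp 2 qy2[OF ij(2)] by auto
        ultimately show ?thesis by auto
      qed
      then show ?thesis using 2 eq k12(3) by (auto simp: \<kappa>_def)
    next
      case 3
      then have qi: "q (i - (n + 1)) \<noteq> y" using qy2 ij by simp
      have j: "j > n + 1"
        using supp 3 qi by (auto split: if_splits)
      then have "{y, q (i - (n + 1))} = {y, q (j - (n + 1))}" using supp 3 by auto
      then have "q (i - (n + 1)) = q (j - (n + 1))" by (auto simp: doubleton_eq_iff)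
      then have "i - (n + 1) = j - (n + 1)" using 3 j ij by (intro q_inj) auto
      then show ?thesis using 3 j by linarith
    qed
  qed
  have "card (\<kappa> ` {1..2 * n}) = CARD('p)"
    using card_image[OF inj] bij_betw_same_card[OF t] by simp
  then have "\<kappa> ` {1..2 * n} = UNIV" by (intro card_eq_UNIV_imp_eq_UNIV) auto
  with inj have \<kappa>: "bij_betw \<kappa> {1..2 * n} UNIV" by (simp add: bij_betw_def)
  define l where "l k = b (q k) (q k)" for k
  have m: "a1 y > 0" "a2 y > 0" using a12(2,4) by blast+
  have gcd: "gcd (a1 y) (a2 y) = 1"
  proof (rule ccontr)
    assume "gcd (a1 y) (a2 y) \<noteq> 1"
    moreover have "gcd (a1 y) (a2 y) > 0" using m by simp
    ultimately have "gcd (a1 y) (a2 y) \<ge> 2" by linarith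
    \<comment> \<open>A common divisor would call for a further pure power of \<open>y\<close>, but
      by surjectivity of \<open>\<kappa>\<close> there is none besides \<open>k1\<close> and
      \<open>k2\<close>.\<close>
    from CB[OF this, of y] obtain k a where k: "A k = Some a" "\<forall>q. q \<noteq> y \<longrightarrow> a q = 0" "\<not> gcd (a1 y) (a2 y) dvd a y"
      by blast
    have "a y \<noteq> 0" using k(3) by (metis dvd_0_right)
    then have "{q. a q \<noteq> 0} = {y}" using k(2) by auto
    then have ky: "k \<in> comps A {y}" using k(1) by (auto simp: comps_def)
    obtain j where j: "j \<in> {1..2 * n}" "k = \<kappa> j" using bij_betw_imp_surj_on[OF \<kappa>] by blast
    have supp: "{y} = (if j < n then {q j} else if j \<le> n + 1 then {y} else {y, q (j - (n + 1))})"
      by (rule comps_disjoint[OF ky kin[OF j(1), folded j(2)]])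
    have "\<not> j < n"
    proof
      assume "j < n"
      moreover from this have "y = q j" using supp by simp
      ultimately show False using qy[of j] j(1) by simp
    qed
    moreover have "\<not> j > n + 1"
    proof
      assume "j > n + 1"
      moreover from this have "{y} = {y, q (j - (n + 1))}" using supp by simp
      then have "q (j - (n + 1)) = y" by blast
      ultimately show False using qy2[OF j(1)] by simp
    qed
    ultimately have "k = k1 \<or> k = k2" using j(2) by (auto simp: \<kappa>_def)
    then have "a = a1 \<or> a = a2" using a12 k(1) by auto
    then show False using k(3) by auto
  qed
  have l: "l i \<ge> 1" if "i \<in> {1..n - 1}" for i
  proof -
    have "i \<in> {1..<n}" using that n by auto
    from eb[OF qy[OF this]] have "b (q i) (q i) \<noteq> 0" by blast
    then show ?thesis by (simp add: l_def)
  qed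
  have "\<forall>\<^sub>F z in nhds 0. \<forall>k. f z $ k = mono_fun (A k) z"
    using mono by (simp add: eventually_all_iff)
  from holo_germ_eventually[OF holo_germ_select this]
  have "\<forall>\<^sub>F z in nhds 0. \<forall>k. f (\<chi> q. z $ \<pi> q) $ k = mono_fun (A k) (\<chi> q. z $ \<pi> q)" .
  then have "\<forall>\<^sub>F z in nhds 0. \<forall>k\<in>{1..2 * n}. f (\<chi> q. z $ \<pi> q) $ \<kappa> k =
     (if k < n then z $ s k
          else if k = n then (z $ s n) ^ a1 y
          else if k = n + 1 then (z $ s n) ^ a2 y
          else (z $ s (k - (n + 1))) ^ l (k - (n + 1)) * z $ s n)"
  proof eventually_elim
    case (elim z)
    show ?case
    proof
      fix k assume k: "k \<in> {1..2 * n}"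
      have p1: "mono_fun (A k1) w = w $ y ^ a1 y" "mono_fun (A k2) w = w $ y ^ a2 y" for w
        unfolding a12(1,3) by (rule mono_fun_pure, use a12(2,4) in blast)+
      consider "k < n" | "k = n" | "k = n + 1" | "k > n + 1" by linarith
      then show "f (\<chi> q. z $ \<pi> q) $ \<kappa> k = (if k < n then z $ s k
          else if k = n then (z $ s n) ^ a1 y
          else if k = n + 1 then (z $ s n) ^ a2 y
          else (z $ s (k - (n + 1))) ^ l (k - (n + 1)) * z $ s n)"
      proof cases
        case 1
        then show ?thesis using elim c[OF qy[of k]] k by (simp add: \<kappa>_def mono_fun_unit_exp \<pi>q)
      next
        case 4
        define i where "i = k - (n + 1)"
        have i: "q i \<noteq> y" using qy2[OF k] 4 by (simp add: i_def)
        have "mono_fun (Some (b (q i))) w = w $ q i ^ b (q i) (q i) * w $ y ^ b (q i) y" for w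
          by (rule mono_fun_pair[OF i]) (use eb[OF i] in blast)
        then have "mono_fun (A (e (q i))) w = w $ q i ^ l i * w $ y" for w
          using conjunct1[OF eb[OF i]] conjunct1[OF conjunct2[OF eb[OF i]]] by (simp add: l_def)
        moreover have "\<kappa> k = e (q i)" using 4 by (simp add: \<kappa>_def i_def)
        ultimately have "f (\<chi> q. z $ \<pi> q) $ \<kappa> k = z $ s i ^ l i * z $ s n"
          using elim by (simp add: \<pi>q \<pi>(2))
        then show ?thesis using 4 by (simp add: i_def)
      qed (use elim p1 in \<open>simp_all add: \<kappa>_def \<pi>(2)\<close>)
    qed
  qed
  from permuted_A_equivalent[OF t \<kappa> \<pi>(1) this]
  have "A_equivalent f (singular_form n s t (a1 y) (a2 y) l)"
    unfolding singular_form_def[abs_def] .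
  with m gcd show ?thesis
    by (intro exI[of _ "a1 y"] exI[of _ "a2 y"] exI[of _ l] conjI ballI) (assumption | erule l)+
qed

lemma monomial_germ_mono_fun:
  assumes "monomial_germ f"
  obtains A where "\<And>k. \<forall>\<^sub>F z in nhds 0. f z $ k = mono_fun (A k) z"
proof -
  have "\<exists>A. \<forall>\<^sub>F z in nhds 0. f z $ k = mono_fun A z" for k
  proof -
    consider "\<forall>\<^sub>F z in nhds 0. f z $ k = 0"
      | a where "\<forall>\<^sub>F z in nhds 0. f z $ k = (\<Prod>i\<in>UNIV. (z $ i) ^ a i)"
      using assms unfolding monomial_germ_def by blast
    then show ?thesis
    proof cases
      case 1
      then show ?thesis by (intro exI[of _ None]) (simp add: mono_fun_def)
    next
      case (2 a)
      then show ?thesis by (intro exI[of _ "Some a"]) (simp add: mono_fun_def)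
    qed
  qed
  then show thesis using that by metis
qed

theorem corollary4p3:
  fixes n :: nat
    and s :: "nat \<Rightarrow> 'n::finite" and t :: "nat \<Rightarrow> 'p::finite"
    and f :: "complex^'n \<Rightarrow> complex^'p"
  assumes "n \<ge> 2"
    and "bij_betw s {1..n} UNIV"
    and "bij_betw t {1..2 * n} UNIV"
    and "holo_germ f"
    and "monomial_germ f"
  shows "A_finite f \<longleftrightarrow>
    A_equivalent f (immersion_form n s t) \<or>
    (\<exists>(m1::nat) (m2::nat) (l::nat \<Rightarrow> nat).
        m1 > 0 \<and> m2 > 0 \<and> gcd m1 m2 = 1 \<and> (\<forall>i\<in>{1..n - 1}. l i \<ge> 1) \<and>
        A_equivalent f (singular_form n s t m1 m2 l))"
proof (rule iffI, goal_cases)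
  case 1
  note fin = this
  obtain A where A: "\<And>k. \<forall>\<^sub>F z in nhds 0. f z $ k = mono_fun (A k) z"
    using monomial_germ_mono_fun[OF assms(5)] by blast
  have card: "CARD('p) = 2 * CARD('n)"
    using bij_betw_same_card[OF assms(2)] bij_betw_same_card[OF assms(3)] by simp
  note CA = A_finite_imp_immersive_monomial[OF card fin assms(4) A]
  note CB = A_finite_imp_gcd_condition[OF card fin assms(4) A]
  show ?case
  proof (cases "\<forall>j. \<exists>k. A k = Some (unit_exp j)")
    case True
    then show ?thesis using monomial_immersion[OF assms(2-4) A] by blast
  next
    case False
    then obtain y where y: "\<not> (\<exists>k. A k = Some (unit_exp y))" by blast
    have "\<exists>k. A k = Some (unit_exp j)" if "j \<noteq> y" for j
      using at_most_one_nonlinear[OF card CA CB _ y, of j] that by blast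
    from monomial_singular[OF assms(1-3) A CA CB y this] show ?thesis by blast
  qed
next
  case 2
  then show ?case
    using left_determined_imp_A_finite[OF assms(4)] left_determined_immersion[OF assms(2,3)]
      left_determined_singular[OF assms(1-3)]
    by (metis coprime_iff_gcd_eq_1)
qed

end
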